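(* For each integer $n\ge1$ let $\rho^n=(\rho^n_t)_{t\ge0}$ be the fraction of occupied servers in the $n$-th system of the sequence of $M_t/G/n/n$ loss models described in the context, where the initial fractions satisfy $\lim_{n\to\infty}|\rho^n_0-r_0|=0$ almost surely for some $r_0\in(0,1]$, and the remaining service times of the jobs initially in service are iid with distribution $G$. Let $$\Theta^n_t=\int_0^t\rho^n_u\,du .$$ Then for any $T>0$, $$\lim_{n\to\infty}\ \sup_{t\in[0,T]}\left|\Theta^n_t-\Theta_t\right|=0\quad\text{almost surely},$$ where $\Theta_t=\int_0^t\rho_u\,du$ and $\rho$ is the solution of the non-linear Volterra integral equation $$\rho_t=\rho_0\,\bar G(t)+\int_0^t \mathbf 1_{\{\rho_{u-}<1\}}\,\bar F(t-u)\,\lambda_u\,du\quad\text{for } t>0,\qquad \rho_0=r_0.$$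
   Context: Model. Let $\lambda:[0,\infty)\to[0,\infty)$ be a locally integrable function, let $F$ be a distribution function on $[0,\infty)$ with density $\nu$ and finite first moment, and let $G$ be a distribution function on $[0,\infty)$; write $\bar F=1-F$, $\bar G=1-G$. For each $n\ge1$ the $n$-th system is an $M_t/G/n/n$ loss queue: it has $n$ servers and no waiting buffer. Arrivals occur according to a non-homogeneous Poisson process $A^n$ with intensity $n\lambda_t$ at time $t$, with arrival epochs $T^n_1<T^n_2<\cdots$. The service times $S^n_1,S^n_2,\dots$ of arriving jobs are iid with distribution $F$ and independent of $A^n$. An arrival finding all $n$ servers busy is blocked and lost; an arrival finding a free server immediately occupies it for the duration of its service time. The relevant random variables for all $n$ are defined on a common filtered probability space. Initial condition. At time $0$ there are $N^n_0=n\rho^n_0$ occupied servers, with remaining service times $S^{0,n}_1,\dots,S^{0,n}_{N^n_0}$ that are iid with distribution $G$. Fraction of occupied servers. $\rho^n_t$ is the number of busy servers at time $t$ divided by $n$, i.e. for $t>0$ $$\rho^n_t=\frac1n\sum_{i=1}^{N^n_0}\mathbf 1_{\{S^{0,n}_i>t\}}+\frac1n\sum_{i=1}^\infty \mathbf 1_{\{\rho^n_{T^n_i-}<1\}}\,\mathbf 1_{\{S^n_i>t-T^n_i\}}\,\mathbf 1_{\{T^n_i\le t\}}.$$ Notation. $f_{u-}$ denotes the left limit of $f$ at $u$. A solution of the Volterra equation is a real-valued function on $[0,\infty)$ with left limits satisfying the equation for every $t>0$ and the stated initial condition.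
   Formalization: The existence of a solution ρ of the Volterra equation is taken as a hypothesis (the result is for any such ρ, uniqueness not assumed), since a solution may fail to exist, e.g. for λ=2, F=G=Exp(1), r_0=1/2, where none continues after ρ reaches 1. *)

theory Defs
  imports "HOL-Probability.Probability"
begin

definition left_limit :: "(real \<Rightarrow> real) \<Rightarrow> real \<Rightarrow> real" where
  "left_limit f t = Lim (at_left t) f"

definition nonneg_distribution_function :: "(real \<Rightarrow> real) \<Rightarrow> bool" where
  "nonneg_distribution_function F \<longleftrightarrow>
     (\<exists>\<mu>. real_distribution \<mu> \<and> cdf \<mu> = F) \<and> (\<forall>x<0. F x = 0)"

definition has_density :: "(real \<Rightarrow> real) \<Rightarrow> (real \<Rightarrow> real) \<Rightarrow> bool" where
  "has_density F \<nu> \<longleftrightarrow>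
     \<nu> \<in> borel_measurable borel \<and> (\<forall>x. 0 \<le> \<nu> x) \<and>
     F = cdf (density lborel (\<lambda>x. ennreal (\<nu> x)))"

definition iid_with_cdf ::
  "'w measure \<Rightarrow> 'i set \<Rightarrow> ('i \<Rightarrow> 'w \<Rightarrow> real) \<Rightarrow> (real \<Rightarrow> real) \<Rightarrow> bool" where
  "iid_with_cdf M I X F \<longleftrightarrow>
     prob_space.indep_vars M (\<lambda>_. borel) X I \<and> (\<forall>i\<in>I. cdf (distr M borel (X i)) = F)"

text \<open>
  Independence of two random elements whose value types may differ, as independence of the
  \<open>\<sigma>\<close>-algebras they generate.
\<close>

definition indep_random_elements ::
  "'w measure \<Rightarrow> 'a measure \<Rightarrow> ('w \<Rightarrow> 'a) \<Rightarrow> 'b measure \<Rightarrow> ('w \<Rightarrow> 'b) \<Rightarrow> bool" where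
  "indep_random_elements M MX X MY Y \<longleftrightarrow>
     X \<in> measurable M MX \<and> Y \<in> measurable M MY \<and>
     prob_space.indep_set M (sets (vimage_algebra (space M) X MX)) (sets (vimage_algebra (space M) Y MY))"

text \<open>
  A path of a simple point process on \<^term>\<open>{0<..} :: real set\<close>.  The last conjunct says that no
  value is skipped, i.e. all jumps have size one, so that the arrival epochs are strictly
  increasing.
\<close>

definition counting_path :: "(real \<Rightarrow> nat) \<Rightarrow> bool" where
  "counting_path a \<longleftrightarrow>
     a 0 = 0 \<and> mono_on {0..} a \<and>
     (\<forall>t\<ge>0. continuous (at_right t) a) \<and>
     (\<forall>t\<ge>0. \<forall>k\<le>a t. \<exists>s\<in>{0..t}. a s = k)"

definition poisson_process ::
  "'w measure \<Rightarrow> (real \<Rightarrow> real) \<Rightarrow> (real \<Rightarrow> 'w \<Rightarrow> nat) \<Rightarrow> bool" where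
  "poisson_process M intensity A \<longleftrightarrow>
     (\<forall>t\<ge>0. A t \<in> measurable M (count_space UNIV)) \<and>
     (\<forall>\<omega>\<in>space M. counting_path (\<lambda>t. A t \<omega>)) \<and>
     (\<forall>(ts :: nat \<Rightarrow> real) k. 0 \<le> ts 0 \<and> mono ts \<longrightarrow>
        prob_space.indep_vars M (\<lambda>_. count_space UNIV)
          (\<lambda>j \<omega>. A (ts (Suc j)) \<omega> - A (ts j) \<omega>) {..<k}) \<and>
     (\<forall>s t k. 0 \<le> s \<and> s \<le> t \<longrightarrow>
        (let m = (LINT u:{s..t}|lborel. intensity u) in
          measure M {\<omega> \<in> space M. A t \<omega> - A s \<omega> = k} = m ^ k / fact k * exp (- m)))"

text \<open>
  The epoch of the \<open>i\<close>-th arrival, for \<open>i \<ge> 1\<close>.  It is \<open>\<infinity>\<close> when there are fewer than \<open>i\<close> arrivals,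
  which can happen when the total intensity is finite.
\<close>

definition arrival_epoch :: "(real \<Rightarrow> nat) \<Rightarrow> nat \<Rightarrow> ereal" where
  "arrival_epoch a i = Inf {ereal t |t. 0 \<le> t \<and> i \<le> a t}"

text \<open>
  \<open>x\<close> is the occupied fraction of an \<open>n\<close>-server loss system along one path, given the arrival
  counting path \<open>a\<close>, the service times \<open>s i\<close> (\<open>i \<ge> 1\<close>), the initial number \<open>k\<close> of busy servers and
  their remaining service times \<open>s0 i\<close> (\<open>1 \<le> i \<le> k\<close>).  The occupied fraction occurs on both sides of
  the equation, which determines it recursively from one arrival to the next.  Only finitely many
  terms of the infinite sum are nonzero; those with \<open>arrival_epoch a i = \<infinity>\<close> vanish because of the
  last factor.
\<close>

definition loss_system_path ::
  "nat \<Rightarrow> (real \<Rightarrow> nat) \<Rightarrow> (nat \<Rightarrow> real) \<Rightarrow> nat \<Rightarrow> (nat \<Rightarrow> real) \<Rightarrow> (real \<Rightarrow> real) \<Rightarrow> bool" where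
  "loss_system_path n a s k s0 x \<longleftrightarrow>
     x 0 = real k / real n \<and>
     (\<forall>t>0. x t =
        1 / real n * (\<Sum>i\<in>{1..k}. of_bool (s0 i > t)) +
        1 / real n * (\<Sum>\<^sub>\<infinity>i\<in>{1..}.
            of_bool (left_limit x (real_of_ereal (arrival_epoch a i)) < 1) *
            of_bool (ereal (s i) > ereal t - arrival_epoch a i) *
            of_bool (arrival_epoch a i \<le> ereal t)))"

definition volterra_solution ::
  "(real \<Rightarrow> real) \<Rightarrow> (real \<Rightarrow> real) \<Rightarrow> (real \<Rightarrow> real) \<Rightarrow> real \<Rightarrow> (real \<Rightarrow> real) \<Rightarrow> bool" where
  "volterra_solution rate F G r\<^sub>0 r \<longleftrightarrow>
     (\<forall>t>0. \<exists>l. (r \<longlongrightarrow> l) (at_left t)) \<and>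
     r 0 = r\<^sub>0 \<and>
     (\<forall>t>0. r t = r 0 * (1 - G t) +
        (LINT u:{0..t}|lborel. of_bool (left_limit r u < 1) * (1 - F (t - u)) * rate u))"

end

theory Submission
  imports Defs
begin

text \<open>
  Let \<open>W\<close> be the set of times \<open>u\<close> in \<open>(0, T]\<close> with \<open>\<rho>\<^bsub>u-\<^esub> < 1\<close>.  The limit accepts exactly
  the arrivals in \<open>W\<close>.  The \<open>n\<close>-th system is compared, path by path, with the fictitious policy
  that also accepts exactly the jobs arriving in \<open>W\<close>:
  \<open>\<rho>\<^sup>n = I + H + P - Q\<close>, where, in units of \<open>1/n\<close> and counting at time \<open>t\<close> only jobs whose service
  would not have ended by \<open>t\<close>,
  \<open>I\<close> are the initial jobs, \<open>H\<close> all jobs that arrived in \<open>W\<close>, \<open>P\<close> the jobs accepted outside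
  \<open>W\<close>, and \<open>Q\<close> the jobs rejected inside \<open>W\<close>.  Since \<open>W\<close> is deterministic, \<open>I + H\<close> converges to
  \<open>\<rho>\<close> uniformly on \<open>(0, T]\<close> by laws of large numbers (\<open>AE_eventually_initial_close\<close>,
  \<open>AE_eventually_busy_close\<close>), so that \<open>\<rho>\<^sup>n - \<rho> = P - Q\<close> up to a uniform error \<open>\<delta>\<close>.

  The feedback through blocking is handled by an order argument.  A job enters \<open>P\<close> only at a time
  with \<open>\<rho>\<^sup>n\<^bsub>u-\<^esub> < 1 \<le> \<rho>\<^bsub>u-\<^esub>\<close>, hence only while \<open>P < Q + \<delta>\<close>; a job enters \<open>Q\<close> only at a time with
  \<open>\<rho>\<^bsub>u-\<^esub> < 1 \<le> \<rho>\<^sup>n\<^bsub>u-\<^esub>\<close>, hence only while \<open>Q < P + \<delta>\<close>.  Between their jumps both decrease.  As long as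
  time stays in \<open>W\<close>, only \<open>Q\<close> can jump, and outside \<open>W\<close> only \<open>P\<close> can.  In each such period
  \<open>max P Q\<close> therefore grows by at most \<open>\<delta> + 1/n\<close>.

  Time may alternate infinitely often between \<open>W\<close> and its complement.  But \<open>\<rho>\<close> can only jump
  downwards, which makes \<open>W\<close> relatively open (\<open>unsaturated_relatively_open\<close>), so the
  union \<open>U\<close> of the level-\<open>m\<close> dyadic cells inside \<open>W\<close> exhausts \<open>W\<close> as \<open>m\<close> grows.  For fixed \<open>m\<close>
  there are at most \<open>2\<^sup>m\<close> periods, and every arrival in \<open>W - U\<close> adds at most \<open>1/n\<close>
  (\<open>loss_comparison\<close>).  The number of these arrivals is asymptotically at most \<open>n\<close> times the
  intensity of \<open>W - U\<close> (\<open>AE_eventually_arrivals_outside_dyadic_inner\<close>).  Letting first \<open>n\<close>, then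
  \<open>m\<close> tend to infinity gives \<open>\<rho>\<^sup>n \<rightarrow> \<rho>\<close> uniformly on \<open>(0, T]\<close>, and integration gives the claim.

  The systems for different \<open>n\<close> have no prescribed joint law.  All almost sure statements
  therefore come from the Borel-Cantelli lemma and exponential tail bounds, Hoeffding's for the
  service times and Chernoff's for the arrivals.
\<close>

section \<open>Exponential tail bounds\<close>

lemma summable_linear_times_exp:
  fixes c :: real
  assumes "c > 0"
  shows "summable (\<lambda>n. real n * exp (- c * real n))"
proof (rule summable_comparison_test')
  show "summable (\<lambda>n. 2 / c * exp (- c / 2) ^ n)"
    using assms by (intro summable_mult summable_geometric) auto
  fix n :: nat
  have "c / 2 * real n \<le> exp (c / 2 * real n)"
    using exp_ge_add_one_self[of "c / 2 * real n"] by linarith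
  then have "real n * exp (- c * real n) \<le> 2 / c * exp (c / 2 * real n) * exp (- c * real n)"
    using assms by (intro mult_right_mono) (auto simp: field_simps)
  also have "\<dots> = 2 / c * exp (- c / 2) ^ n"
    by (simp add: exp_of_nat_mult[symmetric] exp_add[symmetric] algebra_simps)
  finally show "norm (real n * exp (- c * real n)) \<le> 2 / c * exp (- c / 2) ^ n"
    by simp
qed

text \<open>
  This is \<open>s * \<epsilon> / 2\<close> for \<open>s = \<epsilon> / (2 * (b + \<epsilon>))\<close>, a choice of \<open>s\<close> that nearly optimises the exponent
  \<open>b * s\<^sup>2 - s * \<epsilon>\<close> arising below.
\<close>

definition chernoff_rate :: "real \<Rightarrow> real \<Rightarrow> real" where
  "chernoff_rate b \<epsilon> = \<epsilon>\<^sup>2 / (4 * (b + \<epsilon>))"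

context prob_space
begin

text \<open>
  The bound is uniform in the number \<open>k\<close> of summands, at the price of a factor \<open>C * n\<close> in the union
  bound, because \<open>k\<close> is later replaced by a random index such as the number of arrivals.
\<close>

lemma AE_eventually_uniform_partial_sums:
  fixes Y :: "nat \<Rightarrow> nat \<Rightarrow> 'a \<Rightarrow> real" and C :: nat and p \<epsilon> :: real
  assumes indep: "\<And>n. 1 \<le> n \<Longrightarrow> indep_vars (\<lambda>_. borel) (Y n) {1..C * n}"
    and unit: "\<And>n i \<omega>. Y n i \<omega> \<in> {0..1}"
    and mean: "\<And>n i. 1 \<le> n \<Longrightarrow> i \<in> {1..C * n} \<Longrightarrow> expectation (Y n i) = p"
    and \<epsilon>: "\<epsilon> > 0"
  shows "AE \<omega> in M. \<forall>\<^sub>F n in sequentially. \<forall>k\<le>C * n. \<bar>(\<Sum>i=1..k. Y n i \<omega>) - k * p\<bar> < \<epsilon> * n"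
proof -
  define B where "B n k = {\<omega>\<in>space M. \<bar>(\<Sum>i=1..k. Y n i \<omega>) - k * p\<bar> \<ge> \<epsilon> * n}" for n k :: nat
  define E where "E n = (\<Union>k\<in>{1..C * n}. B n k)" for n
  have meas: "Y n i \<in> borel_measurable M" if "1 \<le> n" "i \<in> {1..C * n}" for n i
    using indep[OF that(1)] that(2) by (auto simp: indep_vars_def)
  have B_meas: "B n k \<in> events" if "1 \<le> n" "k \<in> {1..C * n}" for n k
    unfolding B_def using that by (measurable, intro meas) auto
  have E_meas: "E n \<in> events" for n
    unfolding E_def by (cases "n = 0") (auto intro!: B_meas)
  define c where "c = 2 * \<epsilon>\<^sup>2 / (real C + 1)"
  have c: "c > 0"
    using \<epsilon> by (simp add: c_def)
  have B_prob: "prob (B n k) \<le> 2 * exp (- c * n)" if n: "1 \<le> n" and k: "k \<in> {1..C * n}" for n k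
  proof -
    interpret Hoeffding_ineq M "{1..k}" "Y n" "\<lambda>_. 0" "\<lambda>_. 1" "\<Sum>i\<in>{1..k}. expectation (Y n i)"
      using k unit by unfold_locales (auto intro: indep_vars_subset[OF indep[OF n]])
    have mu: "(\<Sum>i\<in>{1..k}. expectation (Y n i)) = k * p"
      using k mean[OF n] by simp
    have "prob (B n k) \<le> 2 * exp (- 2 * (\<epsilon> * n)\<^sup>2 / (\<Sum>i\<in>{1..k}. (1 - 0)\<^sup>2))"
      unfolding B_def mu[symmetric]
      by (rule Hoeffding_ineq_abs_ge) (use \<epsilon> k in auto)
    also have "\<dots> = 2 * exp (- (2 * (\<epsilon> * n)\<^sup>2 / k))"
      by simp
    also have "\<dots> \<le> 2 * exp (- (c * n))"
    proof -
      have "real k \<le> (real C + 1) * n"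
        using k by (simp add: algebra_simps of_nat_mult[symmetric] del: of_nat_mult)
      then have "2 * (\<epsilon> * n)\<^sup>2 / ((real C + 1) * n) \<le> 2 * (\<epsilon> * n)\<^sup>2 / k"
        using n k by (intro divide_left_mono) auto
      also have "2 * (\<epsilon> * n)\<^sup>2 / ((real C + 1) * n) = c * n"
        using n by (simp add: c_def power2_eq_square)
      finally show ?thesis by simp
    qed
    finally show ?thesis by simp
  qed
  have E_prob: "prob (E n) \<le> 2 * C * (n * exp (- c * n))" for n
  proof (cases "n = 0")
    case False
    have "prob (E n) \<le> (\<Sum>k\<in>{1..C * n}. prob (B n k))"
      unfolding E_def using False B_meas by (intro finite_measure_subadditive_finite) auto
    also have "\<dots> \<le> (\<Sum>k\<in>{1..C * n}. 2 * exp (- c * n))"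
      using False by (intro sum_mono B_prob) auto
    finally show ?thesis by simp
  qed (simp add: E_def)
  have "summable (\<lambda>n. prob (E n))"
  proof (rule summable_comparison_test')
    show "summable (\<lambda>n. 2 * real C * (real n * exp (- c * real n)))"
      using c by (intro summable_mult summable_linear_times_exp)
  qed (use E_prob in auto)
  then have "AE \<omega> in M. \<forall>\<^sub>F n in sequentially. \<omega> \<in> space M - E n"
    by (intro borel_cantelli_AE1 E_meas) (auto simp: less_top[symmetric])
  then show ?thesis
  proof eventually_elim
    case (elim \<omega>)
    show ?case
      using elim eventually_ge_at_top[of 1]
    proof eventually_elim
      case (elim n)
      show ?case
      proof (intro allI impI)
        fix k assume "k \<le> C * n"
        then show "\<bar>(\<Sum>i=1..k. Y n i \<omega>) - k * p\<bar> < \<epsilon> * n"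
          using elim \<epsilon> by (cases "k = 0") (auto simp: E_def B_def not_le)
      qed
    qed
  qed
qed

lemma iid_with_cdf_distr:
  assumes "iid_with_cdf M I X (cdf \<mu>)" "real_distribution \<mu>" "i \<in> I"
  shows "X i \<in> borel_measurable M" "distr M borel (X i) = \<mu>"
proof -
  show X: "X i \<in> borel_measurable M"
    using assms by (auto simp: iid_with_cdf_def indep_vars_def)
  have "real_distribution (distr M borel (X i))"
    using X by (intro real_distribution_distr)
  then show "distr M borel (X i) = \<mu>"
    using assms by (intro cdf_unique) (auto simp: iid_with_cdf_def)
qed

lemma AE_eventually_iid_counts:
  fixes X :: "nat \<Rightarrow> nat \<Rightarrow> 'a \<Rightarrow> real" and C :: nat and \<epsilon> :: real
  assumes iid: "\<And>n. 1 \<le> n \<Longrightarrow> iid_with_cdf M (I n) (X n) (cdf \<mu>)"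
    and I: "\<And>n. 1 \<le> n \<Longrightarrow> {1..C * n} \<subseteq> I n"
    and \<mu>: "real_distribution \<mu>" and B: "B \<in> sets borel" and \<epsilon>: "\<epsilon> > 0"
  shows "AE \<omega> in M. \<forall>\<^sub>F n in sequentially. \<forall>k\<le>C * n.
           \<bar>(\<Sum>i=1..k. indicat_real B (X n i \<omega>)) - k * measure \<mu> B\<bar> < \<epsilon> * n"
proof (rule AE_eventually_uniform_partial_sums)
  fix n :: nat assume n: "1 \<le> n"
  have "indep_vars (\<lambda>_. borel) (X n) (I n)"
    using iid[OF n] by (simp add: iid_with_cdf_def)
  then have "indep_vars (\<lambda>_. borel) (X n) {1..C * n}"
    using I[OF n] by (rule indep_vars_subset)
  then show "indep_vars (\<lambda>_. borel) (\<lambda>i \<omega>. indicat_real B (X n i \<omega>)) {1..C * n}"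
    by (rule indep_vars_compose2) (use B in auto)
  fix i assume i: "i \<in> {1..C * n}"
  then have "i \<in> I n" using I[OF n] by auto
  note Xi = iid_with_cdf_distr[OF iid[OF n] \<mu> this]
  have "expectation (\<lambda>\<omega>. indicat_real B (X n i \<omega>)) = (LINT x|distr M borel (X n i). indicat_real B x)"
    using Xi(1) B by (subst integral_distr) auto
  also have "\<dots> = measure \<mu> B"
    using B Xi(2) \<mu> by (simp add: real_distribution_def real_distribution_axioms_def)
  finally show "expectation (\<lambda>\<omega>. indicat_real B (X n i \<omega>)) = measure \<mu> B" .
qed (use \<epsilon> in \<open>auto simp: indicator_def\<close>)

lemma nn_integral_exp_poisson:
  fixes X :: "'a \<Rightarrow> nat" and m s :: real
  assumes X[measurable]: "X \<in> measurable M (count_space UNIV)"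
    and m: "0 \<le> m" and pois: "\<And>k. prob {\<omega>\<in>space M. X \<omega> = k} = m ^ k / fact k * exp (- m)"
  shows "(\<integral>\<^sup>+\<omega>. ennreal (exp (s * X \<omega>)) \<partial>M) = ennreal (exp (m * (exp s - 1)))"
proof -
  have "(\<integral>\<^sup>+\<omega>. ennreal (exp (s * X \<omega>)) \<partial>M) =
        (\<integral>\<^sup>+k. ennreal (exp (s * real k)) \<partial>distr M (count_space UNIV) X)"
    by (subst nn_integral_distr) auto
  also have "distr M (count_space UNIV) X =
      density (count_space UNIV) (\<lambda>k. ennreal (m ^ k / fact k * exp (- m)))"
  proof (rule measure_eqI_countable)
    fix k :: nat
    have "X -` {k} \<inter> space M = {\<omega>\<in>space M. X \<omega> = k}" by auto
    then show "emeasure (distr M (count_space UNIV) X) {k} =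
      emeasure (density (count_space UNIV) (\<lambda>k. ennreal (m ^ k / fact k * exp (- m)))) {k}"
      by (simp add: emeasure_distr emeasure_eq_measure pois emeasure_density nn_integral_count_space_indicator[symmetric] nn_integral_count_space_finite)
  qed auto
  also have "(\<integral>\<^sup>+k. ennreal (exp (s * real k)) \<partial>\<dots>) =
      (\<Sum>k. ennreal (m ^ k / fact k * exp (- m) * exp (s * real k)))"
    using m by (subst nn_integral_density) (auto simp: nn_integral_count_space_nat ennreal_mult[symmetric])
  also have "\<dots> = ennreal (exp (m * (exp s - 1)))"
  proof -
    have "(\<lambda>k. exp (- m) * ((m * exp s) ^ k /\<^sub>R fact k)) sums (exp (- m) * exp (m * exp s))"
      by (intro sums_mult exp_converges)
    also have "(\<lambda>k. exp (- m) * ((m * exp s) ^ k /\<^sub>R fact k)) =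
               (\<lambda>k. m ^ k / fact k * exp (- m) * exp (s * real k))"
      by (auto simp: power_mult_distrib exp_of_nat2_mult field_simps)
    also have "exp (- m) * exp (m * exp s) = exp (m * (exp s - 1))"
      by (simp add: exp_add[symmetric] algebra_simps)
    finally show ?thesis
      using m by (intro suminf_ennreal_eq) auto
  qed
  finally show ?thesis .
qed

text \<open>Markov's inequality for \<open>exp (s * X)\<close>; the sign of \<open>s\<close> selects the upper or the lower tail.\<close>

lemma poisson_sum_exponential_bound:
  fixes X :: "'i \<Rightarrow> 'a \<Rightarrow> nat" and m :: "'i \<Rightarrow> real" and s c :: real
  assumes J: "finite J" and indep: "indep_vars (\<lambda>_. count_space UNIV) X J"
    and m: "\<And>j. j \<in> J \<Longrightarrow> 0 \<le> m j"
    and pois: "\<And>j k. j \<in> J \<Longrightarrow> prob {\<omega>\<in>space M. X j \<omega> = k} = m j ^ k / fact k * exp (- m j)"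
  shows "prob {\<omega>\<in>space M. c \<le> s * real (\<Sum>j\<in>J. X j \<omega>)} \<le> exp ((\<Sum>j\<in>J. m j) * (exp s - 1) - c)"
proof -
  have X[measurable]: "X j \<in> measurable M (count_space UNIV)" if "j \<in> J" for j
    using indep that by (auto simp: indep_vars_def)
  have "indep_vars (\<lambda>_. borel) (\<lambda>j \<omega>. ennreal (exp (s * real (X j \<omega>)))) J"
    using indep by (rule indep_vars_compose2) auto
  then have "(\<integral>\<^sup>+\<omega>. (\<Prod>j\<in>J. ennreal (exp (s * real (X j \<omega>)))) \<partial>M) =
      (\<Prod>j\<in>J. \<integral>\<^sup>+\<omega>. ennreal (exp (s * real (X j \<omega>))) \<partial>M)"
    using J by (intro indep_vars_nn_integral) auto
  also have "\<dots> = (\<Prod>j\<in>J. ennreal (exp (m j * (exp s - 1))))"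
    by (intro prod.cong refl nn_integral_exp_poisson X m pois)
  also have "\<dots> = ennreal (exp ((\<Sum>j\<in>J. m j) * (exp s - 1)))"
    using J by (simp add: prod_ennreal exp_sum sum_distrib_right)
  also have "(\<integral>\<^sup>+\<omega>. (\<Prod>j\<in>J. ennreal (exp (s * real (X j \<omega>)))) \<partial>M) =
      (\<integral>\<^sup>+\<omega>. ennreal (exp (s * real (\<Sum>j\<in>J. X j \<omega>))) \<partial>M)"
    using J by (simp add: prod_ennreal exp_sum sum_distrib_left)
  finally have mgf: "(\<integral>\<^sup>+\<omega>. ennreal (exp (s * real (\<Sum>j\<in>J. X j \<omega>))) \<partial>M) =
      ennreal (exp ((\<Sum>j\<in>J. m j) * (exp s - 1)))" .
  have "emeasure M {\<omega>\<in>space M. c \<le> s * real (\<Sum>j\<in>J. X j \<omega>)} =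
      (\<integral>\<^sup>+\<omega>. indicator {\<omega>\<in>space M. c \<le> s * real (\<Sum>j\<in>J. X j \<omega>)} \<omega> \<partial>M)"
    by (subst nn_integral_indicator) auto
  also have "\<dots> \<le> (\<integral>\<^sup>+\<omega>. ennreal (exp (- c)) * ennreal (exp (s * real (\<Sum>j\<in>J. X j \<omega>))) \<partial>M)"
    by (intro nn_integral_mono)
       (auto simp: indicator_def ennreal_mult[symmetric] exp_add[symmetric] ennreal_1[symmetric] simp del: ennreal_1
             intro!: ennreal_leI)
  also have "\<dots> = ennreal (exp (- c)) * ennreal (exp ((\<Sum>j\<in>J. m j) * (exp s - 1)))"
    by (subst nn_integral_cmult) (auto simp: mgf[simplified])
  also have "\<dots> = ennreal (exp ((\<Sum>j\<in>J. m j) * (exp s - 1) - c))"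
    by (simp add: ennreal_mult[symmetric] exp_add[symmetric])
  finally show ?thesis
    by (simp add: emeasure_eq_measure)
qed

lemma exp_le_quadratic:
  fixes s :: real assumes "0 \<le> s" "s \<le> 1"
  shows "exp s - 1 - s \<le> s\<^sup>2" "exp (- s) - 1 + s \<le> s\<^sup>2"
proof -
  show "exp s - 1 - s \<le> s\<^sup>2"
    using exp_bound[OF assms] by simp
  have "exp (- s) \<le> 1 / (1 + s)"
    using assms by (simp add: exp_minus field_simps)
  also have "\<dots> \<le> 1 - s + s\<^sup>2"
    using assms by (simp add: field_simps power2_eq_square) 
  finally show "exp (- s) - 1 + s \<le> s\<^sup>2" by simp
qed

text \<open>
  The rate depends on the means only through the bound \<open>b\<close>, so that it applies to all finite
  unions of cells inside a given set at once.
\<close>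

lemma poisson_sum_chernoff:
  fixes X :: "'i \<Rightarrow> 'a \<Rightarrow> nat" and v :: "'i \<Rightarrow> real" and n b \<epsilon> :: real
  assumes J: "finite J" and indep: "indep_vars (\<lambda>_. count_space UNIV) X J"
    and v: "\<And>j. j \<in> J \<Longrightarrow> 0 \<le> v j" and n: "0 \<le> n" and b: "(\<Sum>j\<in>J. v j) \<le> b" and \<epsilon>: "\<epsilon> > 0"
    and pois: "\<And>j k. j \<in> J \<Longrightarrow> prob {\<omega>\<in>space M. X j \<omega> = k} = (n * v j) ^ k / fact k * exp (- (n * v j))"
  shows "prob {\<omega>\<in>space M. n * ((\<Sum>j\<in>J. v j) + \<epsilon>) \<le> real (\<Sum>j\<in>J. X j \<omega>)} \<le> exp (- chernoff_rate b \<epsilon> * n)"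
    and "prob {\<omega>\<in>space M. real (\<Sum>j\<in>J. X j \<omega>) \<le> n * ((\<Sum>j\<in>J. v j) - \<epsilon>)} \<le> exp (- chernoff_rate b \<epsilon> * n)"
proof -
  define V where "V = (\<Sum>j\<in>J. v j)"
  have V: "0 \<le> V" "V \<le> b" using v b by (auto simp: V_def intro: sum_nonneg)
  define s where "s = \<epsilon> / (2 * (b + \<epsilon>))"
  have s: "0 < s" "s \<le> 1" using V \<epsilon> by (auto simp: s_def field_simps)
  have Vs: "V * s\<^sup>2 - s * \<epsilon> \<le> - chernoff_rate b \<epsilon>"
  proof -
    have "V * s \<le> (b + \<epsilon>) * s"
      using V \<epsilon> s by (intro mult_right_mono) auto
    also have "(b + \<epsilon>) * s = \<epsilon> / 2"
      using V \<epsilon> by (simp add: s_def field_simps)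
    finally have "V * s * s \<le> \<epsilon> / 2 * s" using s by (intro mult_right_mono) auto
    moreover have "\<epsilon> / 2 * s = chernoff_rate b \<epsilon>"
      by (simp add: s_def chernoff_rate_def power2_eq_square)
    ultimately show ?thesis by (simp add: power2_eq_square algebra_simps)
  qed
  have nv: "(\<Sum>j\<in>J. n * v j) = n * V" by (simp add: V_def sum_distrib_left)
  note bound = poisson_sum_exponential_bound[OF J indep _ pois, unfolded nv]
  have "prob {\<omega>\<in>space M. n * (V + \<epsilon>) \<le> real (\<Sum>j\<in>J. X j \<omega>)} =
        prob {\<omega>\<in>space M. s * (n * (V + \<epsilon>)) \<le> s * real (\<Sum>j\<in>J. X j \<omega>)}"
    using s by simp
  also have "\<dots> \<le> exp (n * V * (exp s - 1) - s * (n * (V + \<epsilon>)))"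
    by (rule bound) (use v n in auto)
  also have "\<dots> \<le> exp (- chernoff_rate b \<epsilon> * n)"
  proof -
    have "V * (exp s - 1) - s * (V + \<epsilon>) = V * (exp s - 1 - s) - s * \<epsilon>" by algebra
    also have "\<dots> \<le> V * s\<^sup>2 - s * \<epsilon>"
      using exp_le_quadratic(1)[of s] s V by (intro diff_right_mono mult_left_mono) auto
    also note Vs
    finally have "n * (V * (exp s - 1) - s * (V + \<epsilon>)) \<le> n * (- chernoff_rate b \<epsilon>)"
      using n by (rule mult_left_mono)
    then show ?thesis by (simp add: algebra_simps)
  qed
  finally show "prob {\<omega>\<in>space M. n * ((\<Sum>j\<in>J. v j) + \<epsilon>) \<le> real (\<Sum>j\<in>J. X j \<omega>)} \<le> exp (- chernoff_rate b \<epsilon> * n)"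
    by (simp add: V_def)
  have "prob {\<omega>\<in>space M. real (\<Sum>j\<in>J. X j \<omega>) \<le> n * (V - \<epsilon>)} =
        prob {\<omega>\<in>space M. - s * (n * (V - \<epsilon>)) \<le> - s * real (\<Sum>j\<in>J. X j \<omega>)}"
    using s by simp
  also have "\<dots> \<le> exp (n * V * (exp (- s) - 1) - (- s * (n * (V - \<epsilon>))))"
    by (rule bound) (use v n in auto)
  also have "\<dots> \<le> exp (- chernoff_rate b \<epsilon> * n)"
  proof -
    have "V * (exp (- s) - 1) + s * (V - \<epsilon>) = V * (exp (- s) - 1 + s) - s * \<epsilon>" by algebra
    also have "\<dots> \<le> V * s\<^sup>2 - s * \<epsilon>"
      using exp_le_quadratic(2)[of s] s V by (intro diff_right_mono mult_left_mono) auto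
    also note Vs
    finally have "n * (V * (exp (- s) - 1) + s * (V - \<epsilon>)) \<le> n * (- chernoff_rate b \<epsilon>)"
      using n by (rule mult_left_mono)
    then show ?thesis by (simp add: algebra_simps)
  qed
  finally show "prob {\<omega>\<in>space M. real (\<Sum>j\<in>J. X j \<omega>) \<le> n * ((\<Sum>j\<in>J. v j) - \<epsilon>)} \<le> exp (- chernoff_rate b \<epsilon> * n)"
    by (simp add: V_def)
qed

lemma AE_eventually_not_if_exponentially_small:
  assumes "\<And>n. 1 \<le> n \<Longrightarrow> E n \<in> events" and "c > 0"
    and "\<And>n. 1 \<le> n \<Longrightarrow> prob (E n) \<le> a * exp (- c * real n)"
  shows "AE \<omega> in M. \<forall>\<^sub>F n in sequentially. \<omega> \<notin> E n"
proof -
  define E' where "E' n = (if n = 0 then {} else E n)" for n :: nat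
  have "summable (\<lambda>n. prob (E' n))"
  proof (rule summable_comparison_test'[where N = 1])
    show "summable (\<lambda>n. a * exp (- c) ^ n)"
      using assms by (intro summable_mult summable_geometric) auto
    show "norm (prob (E' n)) \<le> a * exp (- c) ^ n" if "1 \<le> n" for n
      using assms(3)[OF that] that by (simp add: E'_def exp_of_nat_mult[symmetric] mult.commute)
  qed
  then have "AE \<omega> in M. \<forall>\<^sub>F n in sequentially. \<omega> \<in> space M - E' n"
    using assms(1) by (intro borel_cantelli_AE1) (auto simp: less_top[symmetric] E'_def)
  then show ?thesis
  proof eventually_elim
    case (elim \<omega>)
    show ?case
      using elim eventually_ge_at_top[of 1] by eventually_elim (auto simp: E'_def)
  qed
qed

end

section \<open>Paths of a loss system\<close>

text \<open>
  The value at an infinite epoch is \<open>0\<close>; the function is only used at indices \<open>1 \<le> i \<le> a t\<close>,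
  where the epoch is finite and positive.
\<close>

definition epoch_time :: "(real \<Rightarrow> nat) \<Rightarrow> nat \<Rightarrow> real" where
  "epoch_time a i = real_of_ereal (arrival_epoch a i)"

text \<open>
  The infimum defining the epoch is attained because \<open>a\<close> is right-continuous with discrete
  values, and the value there is exactly \<open>i\<close> because no value is skipped.
\<close>

lemma counting_path_epoch_time:
  assumes a: "counting_path a" and i: "1 \<le> i" and t: "0 \<le> t" "i \<le> a t"
  shows "arrival_epoch a i = ereal (epoch_time a i)" "0 < epoch_time a i" "a (epoch_time a i) = i"
proof -
  have a0: "a 0 = 0" and mono: "mono_on {0..} a"
    and rc: "\<And>t. 0 \<le> t \<Longrightarrow> continuous (at_right t) a"
    and skip: "\<And>t k. 0 \<le> t \<Longrightarrow> k \<le> a t \<Longrightarrow> \<exists>s\<in>{0..t}. a s = k"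
    using a by (auto simp: counting_path_def)
  define U where "U = {u. 0 \<le> u \<and> i \<le> a u}"
  define m where "m = Inf U"
  have "t \<in> U" using t by (simp add: U_def)
  have bdd: "bdd_below U" by (auto simp: U_def intro!: bdd_belowI[of _ 0])
  have m0: "0 \<le> m" unfolding m_def using \<open>t \<in> U\<close> by (intro cInf_greatest) (auto simp: U_def)
  have m_le: "m \<le> u" if "u \<in> U" for u
    unfolding m_def using that bdd by (rule cInf_lower)
  have "i \<le> a m"
  proof -
    have "(a \<longlongrightarrow> a m) (at_right m)"
      using rc[OF m0] by (simp add: continuous_within)
    then have "\<forall>\<^sub>F u in at_right m. a u = a m"
      by (simp add: tendsto_discrete)
    then obtain b where b: "m < b" "\<And>u. m < u \<Longrightarrow> u < b \<Longrightarrow> a u = a m"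
      by (auto simp: eventually_at_right_field)
    obtain u where u: "u \<in> U" "u < b"
      using b(1) \<open>t \<in> U\<close> bdd unfolding m_def by (metis cInf_less_iff empty_iff)
    show ?thesis
      using u b m_le[of u] by (cases "u = m") (auto simp: U_def)
  qed
  then obtain s where s: "s \<in> {0..m}" "a s = i" using skip[OF m0] by blast
  then have "s = m" using m_le[of s] by (auto simp: U_def)
  with s have am: "a m = i" by simp
  have "arrival_epoch a i = ereal m"
    unfolding arrival_epoch_def
  proof (rule antisym)
    show "Inf {ereal t |t. 0 \<le> t \<and> i \<le> a t} \<le> ereal m"
      using m0 am by (intro Inf_lower) auto
    show "ereal m \<le> Inf {ereal t |t. 0 \<le> t \<and> i \<le> a t}"
      using m_le by (intro Inf_greatest) (auto simp: U_def)
  qed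
  moreover have "m \<noteq> 0" using am a0 i by auto
  ultimately show "arrival_epoch a i = ereal (epoch_time a i)" "0 < epoch_time a i" "a (epoch_time a i) = i"
    using am m0 by (auto simp: epoch_time_def)
qed

lemma counting_path_mono:
  "counting_path a \<Longrightarrow> 0 \<le> s \<Longrightarrow> s \<le> t \<Longrightarrow> a s \<le> a t"
  by (auto simp: counting_path_def mono_on_def)

lemma counting_path_epoch_le_iff:
  assumes a: "counting_path a" and i: "1 \<le> i" and t: "0 \<le> t"
  shows "arrival_epoch a i \<le> ereal t \<longleftrightarrow> i \<le> a t"
proof
  assume le: "arrival_epoch a i \<le> ereal t"
  have "\<exists>u\<ge>0. i \<le> a u"
  proof (rule ccontr)
    assume "\<not> (\<exists>u\<ge>0. i \<le> a u)"
    then have "{ereal t |t. 0 \<le> t \<and> i \<le> a t} = {}" by blast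
    then show False using le unfolding arrival_epoch_def by (simp only:) (simp add: top_ereal_def)
  qed
  then obtain u where "0 \<le> u" "i \<le> a u" by blast
  note u = counting_path_epoch_time[OF a i \<open>0 \<le> u\<close> \<open>i \<le> a u\<close>]
  have "epoch_time a i \<le> t" using le u by simp
  then show "i \<le> a t" using counting_path_mono[OF a, of "epoch_time a i" t] u by simp
next
  assume "i \<le> a t"
  then show "arrival_epoch a i \<le> ereal t"
    unfolding arrival_epoch_def using t by (intro Inf_lower) auto
qed

lemma counting_path_epoch_time_le_iff:
  assumes a: "counting_path a" and i: "1 \<le> i" "i \<le> a T" and t: "0 \<le> t" "0 \<le> T"
  shows "epoch_time a i \<le> t \<longleftrightarrow> i \<le> a t"
  using counting_path_epoch_le_iff[OF a i(1) t(1)] counting_path_epoch_time(1)[OF a i(1) t(2) i(2)] by simp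

lemma inj_on_epoch_time:
  assumes "counting_path a" "0 \<le> T"
  shows "inj_on (epoch_time a) {1..a T}"
  using counting_path_epoch_time(3)[OF assms(1) _ assms(2)]
  by (intro inj_on_inverseI[of _ a]) auto

definition in_service :: "real \<Rightarrow> real \<Rightarrow> real \<Rightarrow> real" where
  "in_service \<tau> s t = of_bool (\<tau> \<le> t \<and> t < \<tau> + s)"

text \<open>
  On \<open>(0, T]\<close> only the first \<open>a T\<close> arrivals matter, so the infinite sum becomes a finite one whose
  index set does not depend on \<open>t\<close>.
\<close>

lemma loss_system_path_eq:
  assumes a: "counting_path a" and x: "loss_system_path n a s k s0 x" and t: "0 < t" "t \<le> T"
  shows "x t = 1 / real n * (\<Sum>i\<in>{1..k}. of_bool (s0 i > t)) +
    1 / real n * (\<Sum>i\<in>{1..a T}. of_bool (left_limit x (epoch_time a i) < 1) *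
       in_service (epoch_time a i) (s i) t)"
proof -
  let ?f = "\<lambda>i. of_bool (left_limit x (real_of_ereal (arrival_epoch a i)) < 1) *
            of_bool (ereal (s i) > ereal t - arrival_epoch a i) *
            of_bool (arrival_epoch a i \<le> ereal t) :: real"
  let ?g = "\<lambda>i. of_bool (left_limit x (epoch_time a i) < 1) * in_service (epoch_time a i) (s i) t"
  have "(\<Sum>\<^sub>\<infinity>i\<in>{1..}. ?f i) = (\<Sum>\<^sub>\<infinity>i\<in>{1..a T}. ?g i)"
  proof (rule infsum_cong_neutral)
    fix i assume "i \<in> {1..} - {1..a T}"
    then have "1 \<le> i" "\<not> i \<le> a t"
      using counting_path_mono[OF a, of t T] t by auto
    then show "?f i = 0"
      using counting_path_epoch_le_iff[OF a, of i t] t by simp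
  next
    fix i assume "i \<in> {1..} \<inter> {1..a T}"
    then have i: "1 \<le> i" "i \<le> a T" by auto
    have "arrival_epoch a i = ereal (epoch_time a i)"
      using t by (intro counting_path_epoch_time(1)[OF a i(1) _ i(2)]) auto
    then show "?f i = ?g i"
      by (auto simp: in_service_def epoch_time_def[symmetric])
  qed auto
  then show ?thesis
    using x t by (simp add: loss_system_path_def)
qed

text \<open>A path is a finite combination of indicators of half-lines, hence has left limits.\<close>

lemma of_bool_left_limits:
  fixes c u :: real
  shows "\<exists>l. ((\<lambda>t. of_bool (c \<le> t) :: real) \<longlongrightarrow> l) (at_left u)"
    and "\<exists>l. ((\<lambda>t. of_bool (t < c) :: real) \<longlongrightarrow> l) (at_left u)"
proof -
  have "(\<forall>\<^sub>F t in at_left u. c \<le> t) \<or> (\<forall>\<^sub>F t in at_left u. t < c)"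
  proof (cases "c < u")
    case True
    then show ?thesis using eventually_at_left_real[OF True] by (auto elim: eventually_mono)
  next
    case False
    then have "\<forall>\<^sub>F t in at_left u. t < c" by (auto simp: eventually_at_filter)
    then show ?thesis ..
  qed
  then show "\<exists>l. ((\<lambda>t. of_bool (c \<le> t) :: real) \<longlongrightarrow> l) (at_left u)"
  proof
    assume "\<forall>\<^sub>F t in at_left u. c \<le> t"
    then have "\<forall>\<^sub>F t in at_left u. of_bool (c \<le> t) = (1::real)" by eventually_elim auto
    then show ?thesis by (blast intro: tendsto_eventually)
  next
    assume "\<forall>\<^sub>F t in at_left u. t < c"
    then have "\<forall>\<^sub>F t in at_left u. of_bool (c \<le> t) = (0::real)" by eventually_elim auto
    then show ?thesis by (blast intro: tendsto_eventually)
  qed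
  then obtain l where "((\<lambda>t. of_bool (c \<le> t) :: real) \<longlongrightarrow> l) (at_left u)" ..
  then have "((\<lambda>t. 1 - of_bool (c \<le> t) :: real) \<longlongrightarrow> 1 - l) (at_left u)"
    by (intro tendsto_intros)
  moreover have "(\<lambda>t. 1 - of_bool (c \<le> t) :: real) = (\<lambda>t. of_bool (t < c))"
    by (auto simp: fun_eq_iff)
  ultimately show "\<exists>l. ((\<lambda>t. of_bool (t < c) :: real) \<longlongrightarrow> l) (at_left u)" by auto
qed

lemma tendsto_sum_ex:
  fixes f :: "'i \<Rightarrow> 'b \<Rightarrow> real"
  assumes "\<And>i. i \<in> K \<Longrightarrow> \<exists>l. (f i \<longlongrightarrow> l) F"
  shows "\<exists>l. ((\<lambda>t. \<Sum>i\<in>K. f i t) \<longlongrightarrow> l) F"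
proof -
  obtain l where "\<And>i. i \<in> K \<Longrightarrow> (f i \<longlongrightarrow> l i) F" using assms by metis
  then show ?thesis by (blast intro: tendsto_sum)
qed

lemma in_service_left_limit: "\<exists>l. (in_service \<tau> s \<longlongrightarrow> l) (at_left u)"
proof -
  have eq: "in_service \<tau> s = (\<lambda>t. of_bool (\<tau> \<le> t) * of_bool (t < \<tau> + s))"
    by (auto simp: in_service_def fun_eq_iff)
  obtain l l' where "((\<lambda>t. of_bool (\<tau> \<le> t) :: real) \<longlongrightarrow> l) (at_left u)"
    "((\<lambda>t. of_bool (t < \<tau> + s) :: real) \<longlongrightarrow> l') (at_left u)"
    using of_bool_left_limits by metis
  from tendsto_mult[OF this] show ?thesis unfolding eq by (rule exI)
qed

lemma loss_system_path_left_limit: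
  assumes a: "counting_path a" and x: "loss_system_path n a s k s0 x" and u: "0 < u"
  shows "(x \<longlongrightarrow> left_limit x u) (at_left u)"
proof -
  let ?I = "\<lambda>t. \<Sum>i\<in>{1..k}. of_bool (t < s0 i) :: real"
  let ?J = "\<lambda>t. \<Sum>i\<in>{1..a u}. of_bool (left_limit x (epoch_time a i) < 1) * in_service (epoch_time a i) (s i) t"
  have "\<exists>l. (?I \<longlongrightarrow> l) (at_left u)"
    by (intro tendsto_sum_ex of_bool_left_limits)
  then obtain l where l: "(?I \<longlongrightarrow> l) (at_left u)" ..
  have "\<exists>l. (?J \<longlongrightarrow> l) (at_left u)"
  proof (rule tendsto_sum_ex)
    fix i
    obtain l where "(in_service (epoch_time a i) (s i) \<longlongrightarrow> l) (at_left u)"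
      using in_service_left_limit by blast
    from tendsto_mult[OF tendsto_const this]
    show "\<exists>l. ((\<lambda>t. of_bool (left_limit x (epoch_time a i) < 1) * in_service (epoch_time a i) (s i) t) \<longlongrightarrow> l) (at_left u)"
      by (rule exI)
  qed
  then obtain l' where l': "(?J \<longlongrightarrow> l') (at_left u)" ..
  have "\<forall>\<^sub>F t in at_left u. 1 / real n * ?I t + 1 / real n * ?J t = x t"
    using eventually_at_left_real[OF u]
    by eventually_elim (simp add: loss_system_path_eq[OF a x, of _ u])
  moreover have "((\<lambda>t. 1 / real n * ?I t + 1 / real n * ?J t) \<longlongrightarrow> 1 / real n * l + 1 / real n * l') (at_left u)"
    by (intro tendsto_intros l l')
  ultimately have "(x \<longlongrightarrow> 1 / real n * l + 1 / real n * l') (at_left u)"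
    using tendsto_cong by fastforce
  moreover from this have "left_limit x u = 1 / real n * l + 1 / real n * l'"
    unfolding left_limit_def by (intro tendsto_Lim) auto
  ultimately show ?thesis by simp
qed

section \<open>Comparison along a single path\<close>

definition busy :: "'i set \<Rightarrow> ('i \<Rightarrow> real) \<Rightarrow> ('i \<Rightarrow> real) \<Rightarrow> real \<Rightarrow> real" where
  "busy K \<tau> s t = (\<Sum>i\<in>K. in_service (\<tau> i) (s i) t)"

lemma busy_filter:
  assumes "finite K"
  shows "busy {i\<in>K. R i} \<tau> s t = (\<Sum>i\<in>K. of_bool (R i) * in_service (\<tau> i) (s i) t)"
proof -
  have "busy {i\<in>K. R i} \<tau> s t = (\<Sum>i\<in>K. if R i then in_service (\<tau> i) (s i) t else 0)"
    unfolding busy_def using assms by (rule sum.inter_filter)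
  also have "\<dots> = (\<Sum>i\<in>K. of_bool (R i) * in_service (\<tau> i) (s i) t)"
    by (intro sum.cong) auto
  finally show ?thesis .
qed

lemma busy_le_arrivals:
  assumes "finite K" "u \<le> t"
  shows "busy K \<tau> s t \<le> busy K \<tau> s u + card {i\<in>K. u < \<tau> i \<and> \<tau> i \<le> t}"
proof -
  have "busy K \<tau> s t \<le> (\<Sum>i\<in>K. in_service (\<tau> i) (s i) u + of_bool (u < \<tau> i \<and> \<tau> i \<le> t))"
    unfolding busy_def using assms by (intro sum_mono) (auto simp: in_service_def)
  also have "\<dots> = busy K \<tau> s u + card {i\<in>K. u < \<tau> i \<and> \<tau> i \<le> t}"
    using assms(1) by (simp add: busy_def sum.distrib of_bool_def sum.If_cases Int_def)
  finally show ?thesis .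
qed

text \<open>
  Consider the last admission in \<open>(u, t]\<close>: just before it the count was at most \<open>y\<close>, it adds one,
  and afterwards the count only decreases.  Distinct arrival times make the increment one.
\<close>

lemma busy_le_if_admissions_below:
  assumes K: "finite K" "inj_on \<tau> K" and ut: "u \<le> t"
    and adm: "\<And>i. i \<in> K \<Longrightarrow> u < \<tau> i \<Longrightarrow> \<tau> i \<le> t \<Longrightarrow> \<forall>\<^sub>F v in at_left (\<tau> i). busy K \<tau> s v \<le> y"
  shows "busy K \<tau> s t \<le> max (busy K \<tau> s u) (y + 1)"
proof (cases "{i\<in>K. u < \<tau> i \<and> \<tau> i \<le> t} = {}")
  case True
  then show ?thesis using busy_le_arrivals[OF K(1) ut, of \<tau> s] by (simp only: True) simp
next
  case False
  define K' where "K' = {i\<in>K. u < \<tau> i \<and> \<tau> i \<le> t}"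
  have K': "finite K'" "K' \<noteq> {}" using K False by (auto simp: K'_def)
  define m where "m = Max (\<tau> ` K')"
  have "m \<in> \<tau> ` K'" using K' by (auto simp: m_def)
  then obtain i where i: "i \<in> K'" "\<tau> i = m" by auto
  have max: "\<tau> k \<le> \<tau> i" if "k \<in> K'" for k using that K' i by (simp add: m_def)
  have "\<forall>\<^sub>F v in at_left (\<tau> i). \<forall>k\<in>K. \<tau> k < \<tau> i \<longrightarrow> \<tau> k < v"
    using K(1) by (subst eventually_ball_finite_distrib)
      (auto simp: eventually_at_left_field intro: exI[of _ "\<tau> _"])
  moreover have "\<forall>\<^sub>F v in at_left (\<tau> i). v \<in> {u<..<\<tau> i}"
    using i by (intro eventually_at_left_real) (auto simp: K'_def)
  moreover have "\<forall>\<^sub>F v in at_left (\<tau> i). busy K \<tau> s v \<le> y"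
    using i by (intro adm) (auto simp: K'_def)
  ultimately have "\<forall>\<^sub>F v in at_left (\<tau> i). (\<forall>k\<in>K. \<tau> k < \<tau> i \<longrightarrow> \<tau> k < v) \<and> v \<in> {u<..<\<tau> i} \<and> busy K \<tau> s v \<le> y"
    by eventually_elim auto
  then obtain v where v: "\<And>k. k \<in> K \<Longrightarrow> \<tau> k < \<tau> i \<Longrightarrow> \<tau> k < v" "u < v" "v < \<tau> i" "busy K \<tau> s v \<le> y"
    using eventually_happens by fastforce
  have "k = i" if "k \<in> K" "v < \<tau> k" "\<tau> k \<le> t" for k
  proof -
    have "\<tau> k \<le> \<tau> i" using that v by (intro max) (auto simp: K'_def)
    moreover have "\<not> \<tau> k < \<tau> i" using v(1)[of k] that by auto
    ultimately show ?thesis using that i K(2) by (auto simp: K'_def inj_on_def)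
  qed
  then have "{k\<in>K. v < \<tau> k \<and> \<tau> k \<le> t} = {i}" using i v by (auto simp: K'_def)
  moreover have "v \<le> t" using i v by (auto simp: K'_def)
  ultimately show ?thesis using busy_le_arrivals[OF K(1), of v t \<tau> s] v(4) by simp
qed

text \<open>
  The order argument for a single path.  Here \<open>x\<close> is the occupied fraction, \<open>y\<close> the limit, \<open>J\<close>
  the contribution of the initial jobs, \<open>K\<close> the set of arrivals with arrival times \<open>\<tau>\<close>, service
  times \<open>s\<close> and acceptance decisions \<open>acc\<close>, and \<open>D\<close> consists of the arrivals in \<open>W\<close> that lie in
  a cell not contained in \<open>W\<close>.  In a cell inside \<open>W\<close> nothing enters the
  wrongly accepted jobs \<open>P\<close>, and in any other cell only members of \<open>D\<close> enter the wrongly rejected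
  jobs \<open>Q\<close>.  The other one of the two counts cannot overtake by more than \<open>n * \<delta> + 1\<close>.
\<close>

lemma loss_comparison:
  fixes K :: "'i set" and \<tau> s :: "'i \<Rightarrow> real" and acc :: "'i \<Rightarrow> bool" and x y J :: "real \<Rightarrow> real"
    and n \<delta> T :: real and L :: nat and a :: "nat \<Rightarrow> real" and W :: "real set"
  defines "D \<equiv> {i\<in>K. \<tau> i \<in> W \<and> (\<exists>j<L. \<tau> i \<in> {a j<..a (Suc j)} \<and> \<not> {a j<..a (Suc j)} \<subseteq> W)}"
  assumes K: "finite K" "inj_on \<tau> K" "\<And>i. i \<in> K \<Longrightarrow> 0 < \<tau> i \<and> \<tau> i \<le> T"
    and n: "0 < n" and \<delta>: "0 \<le> \<delta>"
    and a: "mono a" "a 0 = 0" "a L = T"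
    and x: "\<And>t. 0 < t \<Longrightarrow> t \<le> T \<Longrightarrow> x t = J t + 1 / n * busy {i\<in>K. acc i} \<tau> s t"
    and y: "\<And>t. 0 < t \<Longrightarrow> t \<le> T \<Longrightarrow> \<bar>J t + 1 / n * busy {i\<in>K. \<tau> i \<in> W} \<tau> s t - y t\<bar> \<le> \<delta>"
    and acc: "\<And>i. i \<in> K \<Longrightarrow> acc i \<Longrightarrow> \<tau> i \<notin> W \<Longrightarrow> \<forall>\<^sub>F t in at_left (\<tau> i). x t < y t"
    and rej: "\<And>i. i \<in> K \<Longrightarrow> \<not> acc i \<Longrightarrow> \<tau> i \<in> W \<Longrightarrow> \<forall>\<^sub>F t in at_left (\<tau> i). y t < x t"
    and t: "0 < t" "t \<le> T"
  shows "\<bar>x t - y t\<bar> \<le> \<delta> + real L * (\<delta> + 1 / n) + card D / n"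
proof -
  define P where "P = {i\<in>K. acc i \<and> \<tau> i \<notin> W}"
  define Q where "Q = {i\<in>K. \<not> acc i \<and> \<tau> i \<in> W}"
  define p where "p = busy P \<tau> s"
  define q where "q = busy Q \<tau> s"
  have PQ: "finite P" "finite Q" "inj_on \<tau> P" "inj_on \<tau> Q"
    using K by (auto simp: P_def Q_def inj_on_def)
  have diff: "busy {i\<in>K. acc i} \<tau> s t - busy {i\<in>K. \<tau> i \<in> W} \<tau> s t = p t - q t" for t
  proof -
    note * = busy_filter[OF K(1), of _ \<tau> s t]
    show ?thesis
      unfolding p_def q_def P_def Q_def * sum_subtractf[symmetric]
      by (intro sum.cong) auto
  qed
  have close: "\<bar>(x t - y t) - (p t - q t) / n\<bar> \<le> \<delta>" if "0 < t" "t \<le> T" for t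
  proof -
    have "x t - (p t - q t) / n = J t + 1 / n * busy {i\<in>K. \<tau> i \<in> W} \<tau> s t"
      unfolding x[OF that] diff[symmetric] by (simp add: diff_divide_distrib)
    then show ?thesis using y[OF that] by (simp add: algebra_simps)
  qed
  \<comment> \<open>A wrong acceptance happens only while \<open>x < y\<close>, that is, while \<open>p < q\<close> up to the error.\<close>
  have p_below: "\<forall>\<^sub>F v in at_left (\<tau> i). p v \<le> q v + n * \<delta>" if "i \<in> P" for i
  proof -
    have i: "i \<in> K" "acc i" "\<tau> i \<notin> W" using that by (auto simp: P_def)
    have "\<forall>\<^sub>F v in at_left (\<tau> i). v \<in> {0<..<\<tau> i}"
      using K(3)[OF i(1)] by (intro eventually_at_left_real) auto
    then show ?thesis
      using acc[OF i]
    proof eventually_elim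
      case (elim v)
      then have "(p v - q v) / n \<le> \<delta>" using close[of v] K(3)[OF i(1)] by auto
      then show ?case using n by (simp add: field_simps)
    qed
  qed
  have q_below: "\<forall>\<^sub>F v in at_left (\<tau> i). q v \<le> p v + n * \<delta>" if "i \<in> Q" for i
  proof -
    have i: "i \<in> K" "\<not> acc i" "\<tau> i \<in> W" using that by (auto simp: Q_def)
    have "\<forall>\<^sub>F v in at_left (\<tau> i). v \<in> {0<..<\<tau> i}"
      using K(3)[OF i(1)] by (intro eventually_at_left_real) auto
    then show ?thesis
      using rej[OF i]
    proof eventually_elim
      case (elim v)
      then have "(q v - p v) / n \<le> \<delta>"
        using close[of v] K(3)[OF i(1)] by (auto simp: diff_divide_distrib)
      then show ?case using n by (simp add: field_simps)
    qed
  qed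
  have nonneg: "0 \<le> p t" "0 \<le> q t" for t
    by (auto simp: p_def q_def busy_def in_service_def intro: sum_nonneg)
  \<comment> \<open>The largest value that \<open>p\<close> and \<open>q\<close> can have reached after \<open>j\<close> cells.\<close>
  define M where "M j = real j * (n * \<delta> + 1) + card {i\<in>D. \<tau> i \<le> a j}" for j
  have D: "finite D" using K by (simp add: D_def)
  have bound: "p t \<le> M j \<and> q t \<le> M j" if "j \<le> L" "0 \<le> t" "t \<le> a j" for j t
    using that
  proof (induction j arbitrary: t)
    case 0
    then have "t = 0" using a by simp
    have "i \<in> K \<Longrightarrow> in_service (\<tau> i) (s i) 0 = 0" for i
      using K(3)[of i] by (auto simp: in_service_def)
    then have "p 0 = 0" "q 0 = 0"
      by (auto simp: p_def q_def busy_def P_def Q_def intro!: sum.neutral)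
    then show ?case using \<open>t = 0\<close> by (simp add: M_def)
  next
    case (Suc j)
    have aj: "0 \<le> a j" "a j \<le> a (Suc j)" using monoD[OF a(1), of 0 j] a monoD[OF a(1), of j "Suc j"] by auto
    define E where "E = {i\<in>D. a j < \<tau> i \<and> \<tau> i \<le> a (Suc j)}"
    have "{i\<in>D. \<tau> i \<le> a (Suc j)} = {i\<in>D. \<tau> i \<le> a j} \<union> E" using aj by (auto simp: E_def)
    moreover have "card \<dots> = card {i\<in>D. \<tau> i \<le> a j} + card E"
      using D by (intro card_Un_disjoint) (auto simp: E_def)
    ultimately have M_Suc: "M (Suc j) = M j + (n * \<delta> + 1) + card E"
      by (simp add: M_def algebra_simps)
    have step0: "0 \<le> n * \<delta>" using n \<delta> by simp
    then have le: "M j \<le> M (Suc j)" using M_Suc by simp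
    show ?case
    proof (cases "t \<le> a j")
      case True
      then show ?thesis using Suc.IH[of t] Suc.prems le by simp
    next
      case False
      then have t: "a j < t" "t \<le> a (Suc j)" using Suc.prems by auto
      have start: "p (a j) \<le> M j" "q (a j) \<le> M j" using Suc.IH[of "a j"] Suc.prems aj by auto
      show ?thesis
      proof (cases "{a j<..a (Suc j)} \<subseteq> W")
        case True
        have p_le: "p v \<le> M j" if "a j < v" "v \<le> a (Suc j)" for v
        proof -
          have "{i\<in>P. a j < \<tau> i \<and> \<tau> i \<le> v} = {}"
            using True that by (auto simp: P_def subset_iff)
          then have "card {i\<in>P. a j < \<tau> i \<and> \<tau> i \<le> v} = 0"
            by (simp only: card.empty)
          then show ?thesis
            using busy_le_arrivals[OF PQ(1), of "a j" v \<tau> s] that start by (simp add: p_def)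
        qed
        have "q t \<le> max (q (a j)) (M j + n * \<delta> + 1)"
          unfolding q_def
        proof (rule busy_le_if_admissions_below[OF PQ(2,4)])
          fix i assume i: "i \<in> Q" "a j < \<tau> i" "\<tau> i \<le> t"
          show "\<forall>\<^sub>F v in at_left (\<tau> i). busy Q \<tau> s v \<le> M j + n * \<delta>"
            using q_below[OF i(1)] eventually_at_left_real[OF i(2)]
            by eventually_elim (use p_le i t in \<open>fastforce simp: q_def\<close>)
        qed (use t in auto)
        then show ?thesis
          using p_le[of t] t start M_Suc le step0 by auto
      next
        case False
        have q_le: "q v \<le> M j + card E" if "a j < v" "v \<le> a (Suc j)" for v
        proof -
          have "{i\<in>Q. a j < \<tau> i \<and> \<tau> i \<le> v} \<subseteq> E"
          proof
            fix i assume "i \<in> {i\<in>Q. a j < \<tau> i \<and> \<tau> i \<le> v}"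
            then have "i \<in> K" "\<tau> i \<in> W" "\<tau> i \<in> {a j<..a (Suc j)}"
              using that by (auto simp: Q_def)
            moreover have "j < L" using Suc.prems by simp
            ultimately show "i \<in> E" using False unfolding E_def D_def by auto
          qed
          then have "card {i\<in>Q. a j < \<tau> i \<and> \<tau> i \<le> v} \<le> card E"
            using D by (intro card_mono) (auto simp: E_def)
          then show ?thesis
            using busy_le_arrivals[OF PQ(2), of "a j" v \<tau> s] that start by (simp add: q_def)
        qed
        have "p t \<le> max (p (a j)) (M j + card E + n * \<delta> + 1)"
          unfolding p_def
        proof (rule busy_le_if_admissions_below[OF PQ(1,3)])
          fix i assume i: "i \<in> P" "a j < \<tau> i" "\<tau> i \<le> t"
          show "\<forall>\<^sub>F v in at_left (\<tau> i). busy P \<tau> s v \<le> M j + card E + n * \<delta>"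
            using p_below[OF i(1)] eventually_at_left_real[OF i(2)]
            by eventually_elim (use q_le i t in \<open>fastforce simp: p_def\<close>)
        qed (use t in auto)
        then show ?thesis
          using q_le[of t] t start M_Suc le step0 by auto
      qed
    qed
  qed
  have "card {i\<in>D. \<tau> i \<le> a L} \<le> card D" using D by (intro card_mono) auto
  then have "M L \<le> real L * (n * \<delta> + 1) + card D" by (simp add: M_def)
  then have "M L / n \<le> (real L * (n * \<delta> + 1) + card D) / n" using n by (simp add: divide_right_mono)
  also have "\<dots> = real L * (\<delta> + 1 / n) + card D / n" using n by (simp add: field_simps)
  finally have M_at_T: "M L / n \<le> real L * (\<delta> + 1 / n) + card D / n" .
  have "\<bar>p t - q t\<bar> \<le> M L" using bound[of L t] t a nonneg[of t] by auto
  then have "\<bar>(p t - q t) / n\<bar> \<le> M L / n" using n by (simp add: divide_right_mono)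
  then show ?thesis using close[OF t] M_at_T by linarith
qed

section \<open>Equidistant cells\<close>

text \<open>
  The cells are half-open on the left, so that they partition \<open>(0, L * h]\<close>; all arrivals lie in
  this interval, and an increment of the counting path counts the arrivals in one cell.
\<close>

definition cell :: "real \<Rightarrow> nat \<Rightarrow> real set" where
  "cell h j = {real j * h<..real (Suc j) * h}"

lemma cell_exists:
  assumes "0 < h" "0 < u" "u \<le> real L * h"
  obtains j where "j < L" "u \<in> cell h j"
proof -
  define j where "j = nat (\<lceil>u / h\<rceil> - 1)"
  have c: "0 < \<lceil>u / h\<rceil>" using assms by simp
  have "u / h \<le> real_of_int (int L)" using assms by (simp add: field_simps)
  then have "\<lceil>u / h\<rceil> \<le> int L" by (simp add: ceiling_le_iff)
  then have "j < L" using c unfolding j_def by linarith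
  have "real j = real_of_int \<lceil>u / h\<rceil> - 1" using c by (simp add: j_def)
  then have "real j < u / h" "u / h \<le> real j + 1" by linarith+
  then have "u \<in> cell h j" using assms by (simp add: cell_def field_simps)
  with \<open>j < L\<close> show ?thesis by (rule that)
qed

lemma cell_unique:
  assumes "0 < h" "u \<in> cell h i" "u \<in> cell h j"
  shows "i = j"
proof -
  have "real i * h < real (Suc j) * h" "real j * h < real (Suc i) * h"
    using assms unfolding cell_def greaterThanAtMost_iff by linarith+
  then have "real i < real (Suc j)" "real j < real (Suc i)"
    using assms(1) by (simp_all only: mult_less_cancel_right_pos)
  then show ?thesis by linarith
qed

lemma disjoint_family_cell: "0 < h \<Longrightarrow> disjoint_family_on (cell h) J"
  unfolding disjoint_family_on_def using cell_unique by blast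

lemma cell_subset:
  assumes "0 < h" "j < L"
  shows "cell h j \<subseteq> {0<..real L * h}"
proof -
  have "real (Suc j) * h \<le> real L * h" "0 \<le> real j * h"
    using assms by (auto intro!: mult_right_mono)
  then show ?thesis unfolding cell_def by auto
qed

lemma sets_cell[measurable]: "cell h j \<in> sets borel"
  by (simp add: cell_def)

lemma sum_indicator_cell:
  fixes f :: "nat \<Rightarrow> real"
  assumes "0 < h" "finite J" "u \<in> cell h i"
  shows "(\<Sum>j\<in>J. f j * indicator (cell h j) u) = (if i \<in> J then f i else 0)"
proof -
  have "(\<Sum>j\<in>J. f j * indicator (cell h j) u) = (\<Sum>j\<in>J. if i = j then f j else 0)"
  proof (intro sum.cong refl)
    fix j
    show "f j * indicator (cell h j) u = (if i = j then f j else 0)"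
    proof (cases "i = j")
      case False
      then have "u \<notin> cell h j" using cell_unique[OF assms(1,3)] by blast
      then show ?thesis using False by simp
    qed (use assms(3) in simp)
  qed
  then show ?thesis using assms(2) by simp
qed

text \<open>
  If \<open>u\<close> lies in cell \<open>j\<close> and \<open>t\<close> in cell \<open>l\<close> with \<open>j < l\<close>, then \<open>t - u\<close> lies between
  \<open>(l - j - 1) * h\<close> and \<open>(l - j + 1) * h\<close>.  The lemma is used twice: with \<open>\<phi>\<close> the survival function of
  the service time, to bound the limit, and with \<open>\<phi> x = of_bool (x < s)\<close> for a single job with
  service time \<open>s\<close>, to bound the count.
\<close>

lemma in_service_sandwich:
  fixes \<phi> :: "real \<Rightarrow> real" and W :: "real set"
  assumes h: "0 < h" and \<phi>: "antimono \<phi>" "\<And>x. 0 \<le> \<phi> x" "\<And>x. \<phi> x \<le> 1"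
    and J: "finite J" "\<And>j. j \<in> J \<Longrightarrow> cell h j \<subseteq> W"
    and u: "0 < u" "u \<le> real L * h" and t: "t \<in> cell h l"
  shows "(\<Sum>j\<in>J \<inter> {..<l}. \<phi> (real (Suc l - j) * h) * indicator (cell h j) u) \<le>
      of_bool (u \<in> W \<and> u \<le> t) * \<phi> (t - u)"
    and "of_bool (u \<in> W \<and> u \<le> t) * \<phi> (t - u) \<le>
      (\<Sum>j\<in>J \<inter> {..<l}. \<phi> (real (l - Suc j) * h) * indicator (cell h j) u) +
      indicator (cell h l) u + indicator (W - (\<Union>j\<in>J. cell h j)) u"
proof -
  obtain i where i: "i < L" "u \<in> cell h i" using cell_exists[OF h u] .
  have ui: "real i * h < u" "u \<le> real (Suc i) * h" and tl: "real l * h < t" "t \<le> real (Suc l) * h"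
    using i(2) t by (simp_all only: cell_def greaterThanAtMost_iff)
  have le: "u \<le> t" if "i < l"
  proof -
    have "real (Suc i) * h \<le> real l * h" using that h by (intro mult_right_mono) auto
    then show ?thesis using ui tl by linarith
  qed
  have diff_le: "t - u \<le> real (Suc l - i) * h" if "i < l"
  proof -
    have "real (Suc l - i) * h = real (Suc l) * h - real i * h"
      using that by (simp only: of_nat_diff left_diff_distrib less_imp_le less_SucI)
    then show ?thesis using ui tl by linarith
  qed
  have diff_ge: "real (l - Suc i) * h \<le> t - u" if "i < l"
  proof -
    have "real (l - Suc i) * h = real l * h - real (Suc i) * h"
      using that by (simp only: of_nat_diff left_diff_distrib Suc_leI)
    then show ?thesis using ui tl by linarith
  qed
  have gt: "\<not> u \<le> t" if "l < i"
  proof -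
    have "real (Suc l) * h \<le> real i * h" using that h by (intro mult_right_mono) auto
    then show ?thesis using ui tl by linarith
  qed
  have notU: "u \<notin> (\<Union>j\<in>J. cell h j)" if "i \<notin> J"
    using that cell_unique[OF h i(2)] by blast
  have fin: "finite (J \<inter> {..<l})" using J(1) by simp
  have lower: "(\<Sum>j\<in>J \<inter> {..<l}. \<phi> (real (Suc l - j) * h) * indicator (cell h j) u) =
      (if i \<in> J \<inter> {..<l} then \<phi> (real (Suc l - i) * h) else 0)"
    by (rule sum_indicator_cell[OF h fin i(2)])
  have upper: "(\<Sum>j\<in>J \<inter> {..<l}. \<phi> (real (l - Suc j) * h) * indicator (cell h j) u) =
      (if i \<in> J \<inter> {..<l} then \<phi> (real (l - Suc i) * h) else 0)"
    by (rule sum_indicator_cell[OF h fin i(2)])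
  show "(\<Sum>j\<in>J \<inter> {..<l}. \<phi> (real (Suc l - j) * h) * indicator (cell h j) u) \<le>
      of_bool (u \<in> W \<and> u \<le> t) * \<phi> (t - u)"
  proof (cases "i \<in> J \<inter> {..<l}")
    case True
    then have "i < l" "u \<in> W" using J(2) i(2) by blast+
    moreover have "\<phi> (real (Suc l - i) * h) \<le> \<phi> (t - u)"
      using diff_le[OF \<open>i < l\<close>] by (rule antimonoD[OF \<phi>(1)])
    ultimately show ?thesis unfolding lower using True le by simp
  next
    case False
    then show ?thesis unfolding lower using \<phi>(2)[of "t - u"] by (simp only: if_False of_bool_def) simp
  qed
  show "of_bool (u \<in> W \<and> u \<le> t) * \<phi> (t - u) \<le>
      (\<Sum>j\<in>J \<inter> {..<l}. \<phi> (real (l - Suc j) * h) * indicator (cell h j) u) +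
      indicator (cell h l) u + indicator (W - (\<Union>j\<in>J. cell h j)) u"
  proof (cases "u \<in> W \<and> u \<le> t")
    case True
    have nonneg: "0 \<le> (if i \<in> J \<inter> {..<l} then \<phi> (real (l - Suc i) * h) else 0)"
      "0 \<le> (indicator (cell h l) u :: real)" "0 \<le> (indicator (W - (\<Union>j\<in>J. cell h j)) u :: real)"
      using \<phi>(2) by simp_all
    have *: "of_bool (u \<in> W \<and> u \<le> t) * \<phi> (t - u) = \<phi> (t - u)" using True by simp
    have "\<not> l < i" using gt True by blast
    then consider "i = l" | "i < l" "i \<in> J" | "i \<notin> J" by linarith
    then show ?thesis
    proof cases
      case 1
      then have "indicator (cell h l) u = (1::real)" using i(2) by simp
      then show ?thesis unfolding upper * using nonneg \<phi>(3)[of "t - u"] by linarith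
    next
      case 2
      then have "\<phi> (t - u) \<le> (if i \<in> J \<inter> {..<l} then \<phi> (real (l - Suc i) * h) else 0)"
        using antimonoD[OF \<phi>(1) diff_ge[OF 2(1)]] by simp
      then show ?thesis unfolding upper * using nonneg by linarith
    next
      case 3
      then have "indicator (W - (\<Union>j\<in>J. cell h j)) u = (1::real)" using True notU by simp
      then show ?thesis unfolding upper * using nonneg \<phi>(3)[of "t - u"] by linarith
    qed
  next
    case False
    then have "of_bool (u \<in> W \<and> u \<le> t) * \<phi> (t - u) = 0" by simp
    also have "0 \<le> (\<Sum>j\<in>J \<inter> {..<l}. \<phi> (real (l - Suc j) * h) * indicator (cell h j) u) +
      indicator (cell h l) u + indicator (W - (\<Union>j\<in>J. cell h j)) u"
      by (intro add_nonneg_nonneg sum_nonneg mult_nonneg_nonneg \<phi>(2)) simp_all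
    finally show ?thesis .
  qed
qed

text \<open>
  The jobs that arrived in \<open>W\<close> and are still present, and the corresponding integral, obey the
  same upper and lower bounds up to \<open>\<eta>\<close> per cell.  These bounds differ little because the
  distribution function oscillates little over two cells, and because the cell containing
  \<open>t\<close> and the part of \<open>W\<close> not covered by cells have small measure.  The closeness is uniform in \<open>t\<close>
  although only finitely many counts are controlled.
\<close>

lemma busy_close_to_fluid:
  fixes K :: "'i set" and \<tau> s :: "'i \<Rightarrow> real" and F :: "real \<Rightarrow> real" and W :: "real set"
  assumes h: "0 < h" and K: "finite K" "\<And>i. i \<in> K \<Longrightarrow> 0 < \<tau> i \<and> \<tau> i \<le> real L * h"
    and J: "J \<subseteq> {..<L}" "\<And>j. j \<in> J \<Longrightarrow> cell h j \<subseteq> W"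
    and F: "mono F" "\<And>x. 0 \<le> F x" "\<And>x. F x \<le> 1"
    and \<mu>: "finite_measure \<mu>" "sets \<mu> = sets borel" "emeasure \<mu> (- {0<..real L * h}) = 0"
    and W: "W \<in> sets borel" and n: "0 < n" and \<eta>: "0 \<le> \<eta>"
    and thinned: "\<And>j r. j < L \<Longrightarrow> r \<le> L \<Longrightarrow>
        \<bar>1 / n * (\<Sum>i\<in>K. of_bool (real r * h < s i) * indicator (cell h j) (\<tau> i)) -
         (1 - F (real r * h)) * measure \<mu> (cell h j)\<bar> \<le> \<eta>"
    and all: "\<And>j. j < L \<Longrightarrow> 1 / n * (\<Sum>i\<in>K. indicator (cell h j) (\<tau> i)) \<le> measure \<mu> (cell h j) + \<eta>"
    and rest: "1 / n * (\<Sum>i\<in>K. indicator (W - (\<Union>j\<in>J. cell h j)) (\<tau> i)) \<le> measure \<mu> (W - (\<Union>j\<in>J. cell h j)) + \<eta>"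
    and small: "\<And>j. j < L \<Longrightarrow> measure \<mu> (cell h j) \<le> \<theta>" "measure \<mu> (W - (\<Union>j\<in>J. cell h j)) \<le> \<theta>"
    and osc: "\<And>r. Suc (Suc r) \<le> L \<Longrightarrow> F (real (Suc (Suc r)) * h) - F (real r * h) \<le> \<theta>"
    and t: "0 < t" "t \<le> real L * h"
  shows "\<bar>1 / n * busy {i\<in>K. \<tau> i \<in> W} \<tau> s t -
      (LINT u|\<mu>. of_bool (u \<in> W \<and> u \<le> t) * (1 - F (t - u)))\<bar> \<le>
      \<theta> * (measure \<mu> UNIV + 2) + real (L + 2) * \<eta>"
proof -
  interpret finite_measure \<mu> by fact
  note [measurable_cong] = \<mu>(2)
  note [measurable] = W
  have [measurable]: "F \<in> borel_measurable borel" using F(1) by (rule borel_measurable_mono)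
  define D where "D = W - (\<Union>j\<in>J. cell h j)"
  have J_fin: "finite J" using J(1) finite_subset by blast
  have [measurable]: "D \<in> sets borel" unfolding D_def using J_fin by measurable
  have spc: "space \<mu> = UNIV" using \<mu>(2) sets_eq_imp_space_eq by fastforce
  obtain l where l: "l < L" "t \<in> cell h l" using cell_exists[OF h t] .
  define J' where "J' = J \<inter> {..<l}"
  have J': "finite J'" "\<And>j. j \<in> J' \<Longrightarrow> j < l" using J_fin by (auto simp: J'_def)
  define v where "v j = measure \<mu> (cell h j)" for j
  define lo where "lo = (\<Sum>j\<in>J'. (1 - F (real (Suc l - j) * h)) * v j)"
  define up where "up = (\<Sum>j\<in>J'. (1 - F (real (l - Suc j) * h)) * v j) + v l + measure \<mu> D"
  define X where "X = (LINT u|\<mu>. of_bool (u \<in> W \<and> u \<le> t) * (1 - F (t - u)))"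
  define Y where "Y = 1 / n * busy {i\<in>K. \<tau> i \<in> W} \<tau> s t"
  have F': "antimono (\<lambda>x. 1 - F x)" using F(1) by (auto simp: antimono_def mono_def)
  have AE_u: "AE u in \<mu>. 0 < u \<and> u \<le> real L * h"
    using \<mu>(3) by (intro AE_I[where N = "- {0<..real L * h}"]) (auto simp: \<mu>(2))
  have int1: "integrable \<mu> f" if "f \<in> borel_measurable borel" "\<And>x. \<bar>f x\<bar> \<le> B" for f :: "real \<Rightarrow> real" and B
    using that by (intro integrable_const_bound[where B = B]) (auto simp: measurable_def \<mu>(2) spc)
  have int_cell: "integrable \<mu> (\<lambda>u. c * indicator (cell h j) u)" for j and c :: real
    by (rule int1[where B = "\<bar>c\<bar>"]) (auto simp: indicator_def)
  have int_ind: "integrable \<mu> (indicator B :: real \<Rightarrow> real)" if "B \<in> sets borel" for B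
    using that by (intro int1[where B = 1]) (auto simp: indicator_def)
  have int_X: "integrable \<mu> (\<lambda>u. of_bool (u \<in> W \<and> u \<le> t) * (1 - F (t - u)))"
    using F(2,3) by (intro int1[where B = 1]) (auto simp: abs_mult of_bool_def)
  \<comment> \<open>Both \<open>X\<close> and \<open>Y\<close> lie between \<open>lo\<close> and \<open>up\<close>, \<open>Y\<close> only up to multiples of \<open>\<eta>\<close>.\<close>
  have lo_X: "lo \<le> X"
  proof -
    have "lo = (LINT u|\<mu>. (\<Sum>j\<in>J'. (1 - F (real (Suc l - j) * h)) * indicator (cell h j) u))"
      by (subst Bochner_Integration.integral_sum[OF int_cell]) (simp add: lo_def v_def spc)
    also have "\<dots> \<le> X"
      unfolding X_def
    proof (rule integral_mono_AE)
      show "AE u in \<mu>. (\<Sum>j\<in>J'. (1 - F (real (Suc l - j) * h)) * indicator (cell h j) u) \<le>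
          of_bool (u \<in> W \<and> u \<le> t) * (1 - F (t - u))"
        using AE_u
      proof eventually_elim
        case (elim u)
        then show ?case unfolding J'_def
          by (intro in_service_sandwich(1)[where L = L, OF h F' _ _ J_fin J(2) _ _ l(2)])
             (simp_all add: F(2,3))
      qed
    qed (intro int_X Bochner_Integration.integrable_sum int_cell)+
    finally show ?thesis .
  qed
  have X_up: "X \<le> up"
  proof -
    have "X \<le> (LINT u|\<mu>. (\<Sum>j\<in>J'. (1 - F (real (l - Suc j) * h)) * indicator (cell h j) u) +
        indicator (cell h l) u + indicator D u)"
      unfolding X_def
    proof (rule integral_mono_AE)
      show "AE u in \<mu>. of_bool (u \<in> W \<and> u \<le> t) * (1 - F (t - u)) \<le>
          (\<Sum>j\<in>J'. (1 - F (real (l - Suc j) * h)) * indicator (cell h j) u) +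
          indicator (cell h l) u + indicator D u"
        using AE_u
      proof eventually_elim
        case (elim u)
        then show ?case unfolding J'_def D_def
          by (intro in_service_sandwich(2)[where L = L, OF h F' _ _ J_fin J(2) _ _ l(2)])
             (simp_all add: F(2,3))
      qed
    qed (intro int_X Bochner_Integration.integrable_sum Bochner_Integration.integrable_add int_cell int_ind; simp)+
    also have "\<dots> = up"
      by (simp add: Bochner_Integration.integral_sum[OF int_cell] Bochner_Integration.integral_add
          Bochner_Integration.integrable_sum[OF int_cell] int_ind up_def v_def spc del: integral_mult_right_zero integral_mult_left_zero)
    finally show ?thesis .
  qed
  have Y_eq: "Y = 1 / n * (\<Sum>i\<in>K. of_bool (\<tau> i \<in> W \<and> \<tau> i \<le> t) * of_bool (t - \<tau> i < s i))"
    unfolding Y_def busy_filter[OF K(1)]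
    by (intro arg_cong[where f = "\<lambda>x. 1 / n * x"] sum.cong refl) (auto simp: in_service_def)
  have \<phi>: "antimono (\<lambda>x. of_bool (x < s i) :: real)" for i by (auto simp: antimono_def)
  have sum_le: "(\<Sum>j\<in>J'. \<eta>) \<le> real L * \<eta>"
  proof -
    have "card J' \<le> card {..<L}" using J' l by (intro card_mono) (auto dest!: J'(2))
    then show ?thesis using \<eta> by (simp add: mult_right_mono)
  qed
  have lo_Y: "lo - real L * \<eta> \<le> Y"
  proof -
    have "lo - (\<Sum>j\<in>J'. \<eta>) = (\<Sum>j\<in>J'. (1 - F (real (Suc l - j) * h)) * v j - \<eta>)"
      by (simp add: lo_def sum_subtractf)
    also have "\<dots> \<le> (\<Sum>j\<in>J'. 1 / n * (\<Sum>i\<in>K. of_bool (real (Suc l - j) * h < s i) * indicator (cell h j) (\<tau> i)))"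
    proof (rule sum_mono)
      fix j assume "j \<in> J'"
      then have "j < L" "Suc l - j \<le> L" using J'(2)[of j] l by auto
      from thinned[OF this]
      show "(1 - F (real (Suc l - j) * h)) * v j - \<eta> \<le> 1 / n * (\<Sum>i\<in>K. of_bool (real (Suc l - j) * h < s i) * indicator (cell h j) (\<tau> i))"
        unfolding v_def by linarith
    qed
    also have "\<dots> = 1 / n * (\<Sum>i\<in>K. \<Sum>j\<in>J'. of_bool (real (Suc l - j) * h < s i) * indicator (cell h j) (\<tau> i))"
      unfolding sum_distrib_left by (rule sum.swap)
    also have "\<dots> \<le> Y"
      unfolding Y_eq
    proof (intro mult_left_mono sum_mono)
      fix i assume "i \<in> K"
      then show "(\<Sum>j\<in>J'. (of_bool :: bool \<Rightarrow> real) (real (Suc l - j) * h < s i) * indicator (cell h j) (\<tau> i)) \<le>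
          of_bool (\<tau> i \<in> W \<and> \<tau> i \<le> t) * of_bool (t - \<tau> i < s i)"
        unfolding J'_def using K(2)[of i]
        by (intro in_service_sandwich(1)[where L = L, OF h \<phi> _ _ J_fin J(2) _ _ l(2)]) simp_all
    qed (use n in auto)
    finally show ?thesis using sum_le by linarith
  qed
  have Y_up: "Y \<le> up + real (L + 2) * \<eta>"
  proof -
    have "Y \<le> 1 / n * (\<Sum>i\<in>K. (\<Sum>j\<in>J'. of_bool (real (l - Suc j) * h < s i) * indicator (cell h j) (\<tau> i)) +
        indicator (cell h l) (\<tau> i) + indicator D (\<tau> i))"
      unfolding Y_eq
    proof (intro mult_left_mono sum_mono)
      fix i assume "i \<in> K"
      then show "(of_bool :: bool \<Rightarrow> real) (\<tau> i \<in> W \<and> \<tau> i \<le> t) * of_bool (t - \<tau> i < s i) \<le>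
          (\<Sum>j\<in>J'. of_bool (real (l - Suc j) * h < s i) * indicator (cell h j) (\<tau> i)) +
          indicator (cell h l) (\<tau> i) + indicator D (\<tau> i)"
        unfolding J'_def D_def using K(2)[of i]
        by (intro in_service_sandwich(2)[where L = L, OF h \<phi> _ _ J_fin J(2) _ _ l(2)]) simp_all
    qed (use n in auto)
    also have "\<dots> = (\<Sum>j\<in>J'. 1 / n * (\<Sum>i\<in>K. of_bool (real (l - Suc j) * h < s i) * indicator (cell h j) (\<tau> i))) +
        1 / n * (\<Sum>i\<in>K. indicator (cell h l) (\<tau> i)) + 1 / n * (\<Sum>i\<in>K. indicator D (\<tau> i))"
      unfolding sum.distrib distrib_left sum.swap[of _ J' K] by (simp add: sum_distrib_left)
    also have "\<dots> \<le> (\<Sum>j\<in>J'. (1 - F (real (l - Suc j) * h)) * v j + \<eta>) + (v l + \<eta>) + (measure \<mu> D + \<eta>)"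
    proof (intro add_mono sum_mono)
      fix j assume "j \<in> J'"
      then have "j < L" "l - Suc j \<le> L" using J'(2)[of j] l by auto
      from thinned[OF this]
      show "1 / n * (\<Sum>i\<in>K. of_bool (real (l - Suc j) * h < s i) * indicator (cell h j) (\<tau> i)) \<le>
          (1 - F (real (l - Suc j) * h)) * v j + \<eta>"
        unfolding v_def by linarith
    qed (use all[OF l(1)] rest in \<open>auto simp: v_def D_def\<close>)
    also have "\<dots> = up + (\<Sum>j\<in>J'. \<eta>) + 2 * \<eta>"
      by (simp add: up_def sum.distrib)
    finally show ?thesis using sum_le by (simp add: algebra_simps)
  qed
  have "up - lo \<le> \<theta> * (measure \<mu> UNIV + 2)"
  proof -
    have \<theta>: "0 \<le> \<theta>" using small(2) measure_nonneg order_trans by blast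
    have "up - lo = (\<Sum>j\<in>J'. (F (real (Suc l - j) * h) - F (real (l - Suc j) * h)) * v j) + v l + measure \<mu> D"
      by (simp add: up_def lo_def sum.distrib[symmetric] left_diff_distrib sum_subtractf)
    also have "\<dots> \<le> (\<Sum>j\<in>J'. \<theta> * v j) + \<theta> + \<theta>"
    proof (intro add_mono sum_mono mult_right_mono)
      fix j assume "j \<in> J'"
      then have "Suc l - j = Suc (Suc (l - Suc j))" "Suc (Suc (l - Suc j)) \<le> L"
        using J'(2)[of j] l by auto
      then show "F (real (Suc l - j) * h) - F (real (l - Suc j) * h) \<le> \<theta>"
        using osc[of "l - Suc j"] by metis
    qed (use small l in \<open>auto simp: v_def D_def\<close>)
    also have "(\<Sum>j\<in>J'. \<theta> * v j) = \<theta> * measure \<mu> (\<Union>j\<in>J'. cell h j)"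
      unfolding sum_distrib_left[symmetric] v_def
      using J'(1) \<mu>(2) disjoint_family_cell[OF h]
      by (subst finite_measure_finite_Union) auto
    also have "\<dots> \<le> \<theta> * measure \<mu> UNIV"
      using \<theta> bounded_measure[of "\<Union>j\<in>J'. cell h j"] by (auto simp: spc intro!: mult_left_mono)
    finally show ?thesis by (simp add: algebra_simps)
  qed
  moreover have "\<bar>Y - X\<bar> \<le> (up - lo) + real (L + 2) * \<eta>"
  proof -
    have "real L * \<eta> \<le> real (L + 2) * \<eta>" using \<eta> by (intro mult_right_mono) auto
    then show ?thesis using lo_X X_up lo_Y Y_up by linarith
  qed
  ultimately show ?thesis unfolding X_def Y_def by linarith
qed

section \<open>Dyadic approximation of open sets from inside\<close>

definition dyadic_cells :: "real \<Rightarrow> real set \<Rightarrow> nat \<Rightarrow> nat set" where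
  "dyadic_cells T W m = {j. j < 2 ^ m \<and> cell (T / 2 ^ m) j \<subseteq> W}"

definition dyadic_inner :: "real \<Rightarrow> real set \<Rightarrow> nat \<Rightarrow> real set" where
  "dyadic_inner T W m = (\<Union>j\<in>dyadic_cells T W m. cell (T / 2 ^ m) j)"

lemma dyadic_cell_nested:
  assumes T: "0 < T" and mk: "m \<le> k"
  shows "cell (T / 2 ^ k) j \<subseteq> cell (T / 2 ^ m) (j div 2 ^ (k - m))"
proof -
  define d where "d = k - m"
  define q where "q = j div 2 ^ d"
  have k: "k = m + d" using mk by (simp add: d_def)
  have split: "real x * (T / 2 ^ m) = real (x * 2 ^ d) * (T / 2 ^ k)" for x :: nat
    by (simp add: k power_add)
  have "j mod 2 ^ d < 2 ^ d" by simp
  then have "q * 2 ^ d \<le> j" "j < Suc q * 2 ^ d"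
    using div_mult_mod_eq[of j "2 ^ d"] unfolding q_def mult_Suc by linarith+
  then have "q * 2 ^ d \<le> j" "Suc j \<le> Suc q * 2 ^ d" by auto
  then have "real (q * 2 ^ d) \<le> real j" "real (Suc j) \<le> real (Suc q * 2 ^ d)"
    by (simp_all only: of_nat_le_iff)
  then have "real q * (T / 2 ^ m) \<le> real j * (T / 2 ^ k)"
    "real (Suc j) * (T / 2 ^ k) \<le> real (Suc q) * (T / 2 ^ m)"
    unfolding split using T by (intro mult_right_mono; simp only: zero_le_divide_iff zero_le_power zero_le_numeral less_imp_le simp_thms)+
  then show ?thesis
    unfolding cell_def d_def[symmetric] q_def[symmetric] by auto
qed

lemma dyadic_cells_finite: "finite (dyadic_cells T W m)" "dyadic_cells T W m \<subseteq> {..<2 ^ m}"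
  by (auto simp: dyadic_cells_def)

lemma dyadic_inner_subset: "dyadic_inner T W m \<subseteq> W"
  by (auto simp: dyadic_inner_def dyadic_cells_def)

lemma sets_dyadic_inner[measurable]: "dyadic_inner T W m \<in> sets borel"
  unfolding dyadic_inner_def using dyadic_cells_finite(1)
  by (intro sets.finite_UN) auto

lemma dyadic_inner_mono:
  assumes T: "0 < T" and mk: "m \<le> k"
  shows "dyadic_inner T W m \<subseteq> dyadic_inner T W k"
proof
  fix u assume "u \<in> dyadic_inner T W m"
  then obtain i where i: "i < 2 ^ m" "cell (T / 2 ^ m) i \<subseteq> W" "u \<in> cell (T / 2 ^ m) i"
    by (auto simp: dyadic_inner_def dyadic_cells_def)
  have hm: "0 < T / 2 ^ m" and hk: "0 < T / 2 ^ k" using T by auto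
  have "0 < u" "u \<le> real (2 ^ k) * (T / 2 ^ k)"
    using cell_subset[OF hm i(1)] i(3) T by auto
  then obtain j where j: "j < 2 ^ k" "u \<in> cell (T / 2 ^ k) j"
    by (rule cell_exists[OF hk])
  have "u \<in> cell (T / 2 ^ m) (j div 2 ^ (k - m))"
    using dyadic_cell_nested[OF T mk] j(2) by blast
  then have "j div 2 ^ (k - m) = i" by (rule cell_unique[OF hm _ i(3)])
  then have "cell (T / 2 ^ k) j \<subseteq> W" using dyadic_cell_nested[OF T mk, of j] i(2) by auto
  with j show "u \<in> dyadic_inner T W k" by (auto simp: dyadic_inner_def dyadic_cells_def)
qed

text \<open>
  Two levels differ by whole cells of the finer level, so the number of arrivals in the
  difference is a sum of independent increments.
\<close>

lemma dyadic_inner_diff: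
  assumes T: "0 < T" and mk: "m \<le> k"
  shows "dyadic_inner T W k - dyadic_inner T W m =
    (\<Union>j\<in>{j\<in>dyadic_cells T W k. cell (T / 2 ^ k) j \<inter> dyadic_inner T W m = {}}. cell (T / 2 ^ k) j)"
    (is "?L = ?R")
proof
  show "?R \<subseteq> ?L" by (auto simp: dyadic_inner_def)
  show "?L \<subseteq> ?R"
  proof
    fix u assume u: "u \<in> ?L"
    then obtain j where j: "j \<in> dyadic_cells T W k" "u \<in> cell (T / 2 ^ k) j"
      by (auto simp: dyadic_inner_def)
    have "cell (T / 2 ^ k) j \<inter> dyadic_inner T W m = {}"
    proof (rule ccontr)
      assume "\<not> ?thesis"
      then obtain w i where w: "w \<in> cell (T / 2 ^ k) j" "i \<in> dyadic_cells T W m" "w \<in> cell (T / 2 ^ m) i"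
        by (auto simp: dyadic_inner_def)
      have "w \<in> cell (T / 2 ^ m) (j div 2 ^ (k - m))"
        using dyadic_cell_nested[OF T mk] w(1) by blast
      then have "j div 2 ^ (k - m) = i" by (rule cell_unique[rotated, OF _ w(3)]) (use T in simp)
      then have "u \<in> dyadic_inner T W m"
        using dyadic_cell_nested[OF T mk, of j] j(2) w(2) by (auto simp: dyadic_inner_def)
      then show False using u by simp
    qed
    with j show "u \<in> ?R" by auto
  qed
qed

lemma Union_dyadic_inner:
  assumes T: "0 < T" and W: "W \<subseteq> {0<..T}"
    and W_open: "\<And>u. u \<in> W \<Longrightarrow> \<exists>d>0. {u - d<..<u + d} \<inter> {0<..T} \<subseteq> W"
  shows "(\<Union>m. dyadic_inner T W m) = W"
proof
  show "(\<Union>m. dyadic_inner T W m) \<subseteq> W" using dyadic_inner_subset by blast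
  show "W \<subseteq> (\<Union>m. dyadic_inner T W m)"
  proof
    fix u assume u: "u \<in> W"
    then obtain d where d: "0 < d" "{u - d<..<u + d} \<inter> {0<..T} \<subseteq> W" using W_open by blast
    obtain m where "T / d < 2 ^ m" using real_arch_pow[of 2 "T / d"] by auto
    then have m: "T / 2 ^ m < d" using d(1) T by (simp add: field_simps)
    have h: "0 < T / 2 ^ m" using T by simp
    have "0 < u" "u \<le> real (2 ^ m) * (T / 2 ^ m)" using u W by auto
    then obtain j where j: "j < 2 ^ m" "u \<in> cell (T / 2 ^ m) j" by (rule cell_exists[OF h])
    have "cell (T / 2 ^ m) j \<subseteq> {u - d<..<u + d}"
    proof
      fix v assume "v \<in> cell (T / 2 ^ m) j"
      moreover have "real (Suc j) * (T / 2 ^ m) = real j * (T / 2 ^ m) + T / 2 ^ m"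
        by (simp add: algebra_simps add_divide_distrib)
      ultimately show "v \<in> {u - d<..<u + d}"
        using j(2) m unfolding cell_def greaterThanAtMost_iff greaterThanLessThan_iff by linarith
    qed
    moreover have "cell (T / 2 ^ m) j \<subseteq> {0<..T}" using cell_subset[OF h j(1)] by simp
    ultimately have "j \<in> dyadic_cells T W m" using d(2) j(1) by (auto simp: dyadic_cells_def)
    with j(2) show "u \<in> (\<Union>m. dyadic_inner T W m)" by (auto simp: dyadic_inner_def)
  qed
qed

lemma sets_relatively_open:
  fixes T :: real
  assumes T: "0 < T" and W: "W \<subseteq> {0<..T}"
    and W_open: "\<And>u. u \<in> W \<Longrightarrow> \<exists>d>0. {u - d<..<u + d} \<inter> {0<..T} \<subseteq> W"
  shows "W \<in> sets borel"
proof -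
  have "(\<Union>m. dyadic_inner T W m) \<in> sets borel" by (intro sets.countable_UN) auto
  moreover have "(\<Union>m. dyadic_inner T W m) = W" by (rule Union_dyadic_inner[OF T W W_open])
  ultimately show ?thesis by simp
qed

section \<open>Poisson arrivals\<close>

lemma sum_arrivals_in_cell:
  fixes f :: "nat \<Rightarrow> real"
  assumes a: "counting_path a" and h: "0 < h" and j: "j < L"
  shows "(\<Sum>i\<in>{1..a (real L * h)}. f i * indicator (cell h j) (epoch_time a i)) =
    (\<Sum>i\<in>{a (real j * h)<..a (real (Suc j) * h)}. f i)"
proof -
  let ?T = "real L * h"
  have nn: "0 \<le> real j * h" "0 \<le> real (Suc j) * h" "0 \<le> ?T" using h by auto
  have le: "a (real (Suc j) * h) \<le> a ?T"
    using h j by (intro counting_path_mono[OF a] mult_right_mono) auto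
  have set_eq: "{a (real j * h)<..a (real (Suc j) * h)} = {i\<in>{1..a ?T}. epoch_time a i \<in> cell h j}"
  proof (intro set_eqI)
    fix i
    show "i \<in> {a (real j * h)<..a (real (Suc j) * h)} \<longleftrightarrow> i \<in> {i\<in>{1..a ?T}. epoch_time a i \<in> cell h j}"
    proof (cases "1 \<le> i \<and> i \<le> a ?T")
      case True
      then have "epoch_time a i \<le> real j * h \<longleftrightarrow> i \<le> a (real j * h)"
        "epoch_time a i \<le> real (Suc j) * h \<longleftrightarrow> i \<le> a (real (Suc j) * h)"
        using counting_path_epoch_time_le_iff[OF a _ _ nn(1,3), of i]
          counting_path_epoch_time_le_iff[OF a _ _ nn(2,3), of i] by blast+
      then show ?thesis
        using True unfolding cell_def greaterThanAtMost_iff mem_Collect_eq atLeastAtMost_iff by linarith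
    next
      case False
      then show ?thesis using le by auto
    qed
  qed
  have "(\<Sum>i\<in>{1..a ?T}. f i * indicator (cell h j) (epoch_time a i)) =
      (\<Sum>i\<in>{1..a ?T}. if epoch_time a i \<in> cell h j then f i else 0)"
    by (intro sum.cong) (auto simp: indicator_def)
  also have "\<dots> = (\<Sum>i\<in>{i\<in>{1..a ?T}. epoch_time a i \<in> cell h j}. f i)"
    by (rule sum.inter_filter[symmetric]) simp
  finally show ?thesis unfolding set_eq .
qed

lemma sum_arrivals_in_cells:
  assumes a: "counting_path a" and h: "0 < h" and J: "J \<subseteq> {..<L}"
  shows "(\<Sum>i\<in>{1..a (real L * h)}. indicator (\<Union>j\<in>J. cell h j) (epoch_time a i)) =
    real (\<Sum>j\<in>J. a (real (Suc j) * h) - a (real j * h))"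
proof -
  have fin: "finite J" using J finite_subset by blast
  have "(\<Sum>i\<in>{1..a (real L * h)}. indicator (\<Union>j\<in>J. cell h j) (epoch_time a i) :: real) =
      (\<Sum>i\<in>{1..a (real L * h)}. \<Sum>j\<in>J. 1 * indicator (cell h j) (epoch_time a i))"
    by (simp add: indicator_UN_disjoint[OF fin disjoint_family_cell[OF h]])
  also have "\<dots> = (\<Sum>j\<in>J. \<Sum>i\<in>{1..a (real L * h)}. 1 * indicator (cell h j) (epoch_time a i))"
    by (rule sum.swap)
  also have "\<dots> = (\<Sum>j\<in>J. \<Sum>i\<in>{a (real j * h)<..a (real (Suc j) * h)}. 1)"
    using J by (intro sum.cong refl sum_arrivals_in_cell[OF a h]) auto
  finally show ?thesis by simp
qed

locale poisson_arrivals = prob_space M for M :: "'w measure" +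
  fixes rate :: "real \<Rightarrow> real" and A :: "nat \<Rightarrow> real \<Rightarrow> 'w \<Rightarrow> nat" and T :: real
  assumes T: "0 < T"
    and rate_nonneg: "\<And>t. 0 \<le> t \<Longrightarrow> 0 \<le> rate t"
    and rate_int: "set_integrable lborel {0..T} rate"
    and poisson: "\<And>n. 1 \<le> n \<Longrightarrow> poisson_process M (\<lambda>t. real n * rate t) (A n)"
begin

text \<open>
  The intensity measure on \<open>[0, T]\<close>.  Multiplying the rate by the indicator inside the density makes it
  measurable and nonnegative everywhere; outside \<open>[0, \<infinity>)\<close> the rate is arbitrary.
\<close>

definition \<mu> :: "real measure" where
  "\<mu> = density lborel (\<lambda>u. ennreal (indicator {0..T} u * rate u))"

lemma rate_measurable[measurable]: "(\<lambda>u. indicator {0..T} u * rate u) \<in> borel_measurable borel"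
  using borel_measurable_integrable[OF rate_int[unfolded set_integrable_def]] by simp

lemma rate_ind_nonneg: "0 \<le> indicator {0..T} u * rate u"
  using rate_nonneg by (auto simp: indicator_def)

lemma sets_\<mu>[simp, measurable_cong]: "sets \<mu> = sets borel"
  by (simp add: \<mu>_def)

lemma space_\<mu>[simp]: "space \<mu> = UNIV"
  by (simp add: \<mu>_def)

lemma finite_measure_\<mu>: "finite_measure \<mu>"
proof
  have "emeasure \<mu> (space \<mu>) = (\<integral>\<^sup>+u. ennreal (indicator {0..T} u * rate u) \<partial>lborel)"
    by (simp add: \<mu>_def emeasure_density)
  also have "\<dots> = ennreal (LINT u|lborel. indicator {0..T} u * rate u)"
    using rate_int rate_ind_nonneg
    by (intro nn_integral_eq_integral) (auto simp: set_integrable_def)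
  finally show "emeasure \<mu> (space \<mu>) \<noteq> \<infinity>" by simp
qed

lemma integral_\<mu>:
  fixes f :: "real \<Rightarrow> real"
  assumes "f \<in> borel_measurable borel"
  shows "(LINT u|\<mu>. f u) = (LINT u|lborel. indicator {0..T} u * rate u * f u)"
  unfolding \<mu>_def using assms rate_ind_nonneg by (subst integral_density) auto

lemma measure_\<mu>_interval:
  assumes "0 \<le> s" "s \<le> t" "t \<le> T"
  shows "measure \<mu> {s<..t} = (LINT u:{s..t}|lborel. rate u)"
proof -
  have "measure \<mu> {s<..t} = (LINT u|\<mu>. indicator {s<..t} u)"
    by simp
  also have "\<dots> = (LINT u|lborel. indicator {0..T} u * rate u * indicator {s<..t} u)"
    by (rule integral_\<mu>) simp
  also have "\<dots> = (LINT u:{s<..t}|lborel. rate u)"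
    unfolding set_lebesgue_integral_def using assms
    by (intro Bochner_Integration.integral_cong) (auto simp: indicator_def)
  also have "\<dots> = (LINT u:{s..t}|lborel. rate u)"
  proof -
    have "AE u in lborel. u \<in> {s..t} \<longleftrightarrow> u \<in> {s<..t}"
      using AE_lborel_singleton[of s] by eventually_elim auto
    moreover have meas: "set_borel_measurable lborel B rate" if "B \<subseteq> {0..T}" "B \<in> sets borel" for B
    proof -
      have "(\<lambda>u. indicator B u *\<^sub>R rate u) = (\<lambda>u. indicator B u * (indicator {0..T} u * rate u))"
        using that by (auto simp: indicator_def fun_eq_iff)
      then show ?thesis unfolding set_borel_measurable_def using that by simp
    qed
    ultimately show ?thesis
      using assms by (intro set_integral_cong_set meas) auto
  qed
  finally show ?thesis .
qed

lemma emeasure_\<mu>_outside: "emeasure \<mu> (- {0<..T}) = 0"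
proof -
  have "AE u in lborel. u \<noteq> 0" by (rule AE_lborel_singleton)
  then have "AE u in lborel. ennreal (indicator {0..T} u * rate u) * indicator (- {0<..T}) u = 0"
    by eventually_elim (auto simp: indicator_def)
  then have "(\<integral>\<^sup>+u. ennreal (indicator {0..T} u * rate u) * indicator (- {0<..T}) u \<partial>lborel) = 0"
    by (subst nn_integral_0_iff_AE) simp_all
  then show ?thesis by (simp add: \<mu>_def emeasure_density)
qed

lemma \<mu>_uniformly_continuous:
  assumes "0 < \<epsilon>"
  shows "\<exists>d>0. \<forall>s t. 0 \<le> s \<longrightarrow> s \<le> t \<longrightarrow> t \<le> T \<longrightarrow> t - s < d \<longrightarrow> measure \<mu> {s<..t} < \<epsilon>"
proof -
  interpret \<mu>: finite_measure \<mu> by (rule finite_measure_\<mu>)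
  interpret \<mu>: finite_borel_measure \<mu>
    by (rule finite_borel_measure.intro[OF \<mu>.finite_measure_axioms])
       (simp add: finite_borel_measure_axioms_def)
  have "{x} \<in> null_sets \<mu>" for x
  proof -
    have "{x} \<in> null_sets lborel" by (simp add: null_sets_def)
    moreover have "null_sets lborel \<subseteq> null_sets \<mu>"
      using absolutely_continuousI_density[of "\<lambda>u. ennreal (indicator {0..T} u * rate u)" lborel]
      unfolding \<mu>_def absolutely_continuous_def by simp
    ultimately show ?thesis by (rule rev_subsetD)
  qed
  then have "measure \<mu> {x} = 0" for x by (auto simp: measure_def null_sets_def)
  then have "isCont (cdf \<mu>) x" for x unfolding \<mu>.isCont_cdf by simp
  then have "continuous_on {0..T} (cdf \<mu>)" by (intro continuous_at_imp_continuous_on) simp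
  then have "uniformly_continuous_on {0..T} (cdf \<mu>)" by (intro compact_uniformly_continuous) auto
  then obtain d where d: "0 < d" "\<And>s t. s \<in> {0..T} \<Longrightarrow> t \<in> {0..T} \<Longrightarrow> dist t s < d \<Longrightarrow> dist (cdf \<mu> t) (cdf \<mu> s) < \<epsilon>"
    unfolding uniformly_continuous_on_def using assms by metis
  have "measure \<mu> {s<..t} < \<epsilon>" if st: "0 \<le> s" "s \<le> t" "t \<le> T" "t - s < d" for s t
  proof (cases "s = t")
    case False
    have "dist (cdf \<mu> t) (cdf \<mu> s) < \<epsilon>" using st by (intro d(2)) (auto simp: dist_real_def)
    then show ?thesis using \<mu>.cdf_diff_eq[of s t] st False by (auto simp: dist_real_def)
  qed (use assms in simp)
  with d(1) show ?thesis by blast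
qed

lemma poisson_process_increments:
  assumes "1 \<le> n"
  shows "0 \<le> ts 0 \<Longrightarrow> mono ts \<Longrightarrow>
      indep_vars (\<lambda>_. count_space UNIV) (\<lambda>j \<omega>. A n (ts (Suc j)) \<omega> - A n (ts j) \<omega>) {..<k}"
    and "0 \<le> s \<Longrightarrow> s \<le> t \<Longrightarrow> prob {\<omega>\<in>space M. A n t \<omega> - A n s \<omega> = k} =
      (LINT u:{s..t}|lborel. real n * rate u) ^ k / fact k * exp (- (LINT u:{s..t}|lborel. real n * rate u))"
  using poisson[OF assms] unfolding poisson_process_def Let_def by simp_all

lemma counting: "1 \<le> n \<Longrightarrow> \<omega> \<in> space M \<Longrightarrow> counting_path (\<lambda>t. A n t \<omega>)"
  using poisson[of n] by (auto simp: poisson_process_def)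

lemma A_measurable: "1 \<le> n \<Longrightarrow> 0 \<le> t \<Longrightarrow> A n t \<in> measurable M (count_space UNIV)"
  using poisson[of n] by (auto simp: poisson_process_def)

context
  fixes h :: real and L :: nat
  assumes h: "0 < h" and Lh: "real L * h = T"
begin

definition increment :: "nat \<Rightarrow> nat \<Rightarrow> 'w \<Rightarrow> nat" where
  "increment n j \<omega> = A n (real (Suc j) * h) \<omega> - A n (real j * h) \<omega>"

lemma increment_measurable: "1 \<le> n \<Longrightarrow> increment n j \<in> measurable M (count_space UNIV)"
proof -
  assume n: "1 \<le> n"
  have [measurable]: "A n (real (Suc j) * h) \<in> measurable M (count_space UNIV)" "A n (real j * h) \<in> measurable M (count_space UNIV)"
    using h by (intro A_measurable[OF n]; simp)+
  show ?thesis unfolding increment_def by measurable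
qed

lemma increments_indep:
  assumes n: "1 \<le> n"
  shows "indep_vars (\<lambda>_. count_space UNIV) (increment n) {..<L}"
proof -
  have "mono (\<lambda>j. real j * h)"
    using h by (intro monoI mult_right_mono) simp_all
  from poisson_process_increments(1)[OF n _ this, of L]
  show ?thesis by (simp add: increment_def[abs_def])
qed

lemma increment_poisson:
  assumes n: "1 \<le> n" and j: "j < L"
  shows "prob {\<omega>\<in>space M. increment n j \<omega> = k} =
    (real n * measure \<mu> (cell h j)) ^ k / fact k * exp (- (real n * measure \<mu> (cell h j)))"
proof -
  have le: "0 \<le> real j * h" "real j * h \<le> real (Suc j) * h" "real (Suc j) * h \<le> T"
    using h j unfolding Lh[symmetric] by (auto intro!: mult_right_mono)
  have "(LINT u:{real j * h..real (Suc j) * h}|lborel. real n * rate u) = real n * measure \<mu> (cell h j)"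
    unfolding cell_def measure_\<mu>_interval[OF le] by simp
  with poisson_process_increments(2)[OF n le(1,2), of k] show ?thesis
    by (simp only: increment_def)
qed

lemma increments_chernoff:
  assumes n: "1 \<le> n" and J: "J \<subseteq> {..<L}" and b: "measure \<mu> (\<Union>j\<in>J. cell h j) \<le> b" and \<epsilon>: "0 < \<epsilon>"
  shows "prob {\<omega>\<in>space M. real n * (measure \<mu> (\<Union>j\<in>J. cell h j) + \<epsilon>) \<le> real (\<Sum>j\<in>J. increment n j \<omega>)}
      \<le> exp (- chernoff_rate b \<epsilon> * n)"
    and "prob {\<omega>\<in>space M. real (\<Sum>j\<in>J. increment n j \<omega>) \<le> real n * (measure \<mu> (\<Union>j\<in>J. cell h j) - \<epsilon>)}
      \<le> exp (- chernoff_rate b \<epsilon> * n)"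
proof -
  interpret \<mu>: finite_measure \<mu> by (rule finite_measure_\<mu>)
  have fin: "finite J" using J finite_subset by blast
  have sum: "(\<Sum>j\<in>J. measure \<mu> (cell h j)) = measure \<mu> (\<Union>j\<in>J. cell h j)"
    using fin disjoint_family_cell[OF h]
    by (subst \<mu>.finite_measure_finite_Union) auto
  have indep: "indep_vars (\<lambda>_. count_space UNIV) (increment n) J"
    using increments_indep[OF n] J by (rule indep_vars_subset)
  have pois: "prob {\<omega>\<in>space M. increment n j \<omega> = k} =
    (real n * measure \<mu> (cell h j)) ^ k / fact k * exp (- (real n * measure \<mu> (cell h j)))" if "j \<in> J" for j k
    using that J by (intro increment_poisson[OF n]) auto
  note tail = poisson_sum_chernoff[OF fin indep measure_nonneg _ _ \<epsilon> pois, unfolded sum, OF of_nat_0_le_iff b]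
  show "prob {\<omega>\<in>space M. real n * (measure \<mu> (\<Union>j\<in>J. cell h j) + \<epsilon>) \<le> real (\<Sum>j\<in>J. increment n j \<omega>)}
      \<le> exp (- chernoff_rate b \<epsilon> * n)"
    by (rule tail(1))
  show "prob {\<omega>\<in>space M. real (\<Sum>j\<in>J. increment n j \<omega>) \<le> real n * (measure \<mu> (\<Union>j\<in>J. cell h j) - \<epsilon>)}
      \<le> exp (- chernoff_rate b \<epsilon> * n)"
    by (rule tail(2))
qed

end

lemma chernoff_rate_pos: "0 \<le> b \<Longrightarrow> 0 < \<epsilon> \<Longrightarrow> 0 < chernoff_rate b \<epsilon>"
  by (simp add: chernoff_rate_def)

lemma AE_eventually_increment:
  fixes \<epsilon> :: real
  assumes h: "0 < h" "real L * h = T" and j: "j < L" and \<epsilon>: "0 < \<epsilon>"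
  shows "AE \<omega> in M. \<forall>\<^sub>F n in sequentially.
    \<bar>real (increment h n j \<omega>) - n * measure \<mu> (cell h j)\<bar> < \<epsilon> * n"
proof -
  define v where "v = measure \<mu> (cell h j)"
  define E where "E n = {\<omega>\<in>space M. real n * (v + \<epsilon>) \<le> real (increment h n j \<omega>)} \<union>
    {\<omega>\<in>space M. real (increment h n j \<omega>) \<le> real n * (v - \<epsilon>)}" for n
  have "AE \<omega> in M. \<forall>\<^sub>F n in sequentially. \<omega> \<notin> E n"
  proof (rule AE_eventually_not_if_exponentially_small[where a = 2 and c = "chernoff_rate v \<epsilon>"])
    show "0 < chernoff_rate v \<epsilon>" using \<epsilon> by (intro chernoff_rate_pos) (auto simp: v_def)
    fix n :: nat assume n: "1 \<le> n"
    note [measurable] = increment_measurable[OF h n]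
    show E_meas: "E n \<in> events" unfolding E_def by measurable
    have "prob (E n) \<le> prob {\<omega>\<in>space M. real n * (v + \<epsilon>) \<le> real (increment h n j \<omega>)} +
      prob {\<omega>\<in>space M. real (increment h n j \<omega>) \<le> real n * (v - \<epsilon>)}"
      unfolding E_def by (intro measure_Un_le) measurable
    also have "\<dots> \<le> exp (- chernoff_rate v \<epsilon> * n) + exp (- chernoff_rate v \<epsilon> * n)"
      using increments_chernoff[OF h n, of "{j}" v \<epsilon>] j \<epsilon> by (intro add_mono) (simp_all add: v_def)
    finally show "prob (E n) \<le> 2 * exp (- chernoff_rate v \<epsilon> * n)" by simp
  qed
  then show ?thesis
    using AE_space
  proof eventually_elim
    case (elim \<omega>)
    show ?case using elim(1)
    proof eventually_elim
      case (elim n)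
      then have "\<not> real n * (v + \<epsilon>) \<le> real (increment h n j \<omega>)"
        "\<not> real (increment h n j \<omega>) \<le> real n * (v - \<epsilon>)"
        using \<open>\<omega> \<in> space M\<close> unfolding E_def by blast+
      then have "real (increment h n j \<omega>) < n * v + \<epsilon> * n" "n * v - \<epsilon> * n < real (increment h n j \<omega>)"
        by (simp_all add: not_le distrib_left right_diff_distrib mult.commute)
      then show ?case unfolding v_def[symmetric] by linarith
    qed
  qed
qed

text \<open>
  The set \<open>W - dyadic_inner T W m\<close> may have a boundary of positive measure, so convergence of the
  arrival counts on intervals does not control the arrivals in it.  It is the increasing
  limit of finite unions of cells, on which the count is a sum of independent
  Poisson variables; the Chernoff bound is uniform over these unions and passes to the limit.
\<close>

lemma AE_eventually_arrivals_outside_dyadic_inner: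
  assumes W: "W \<subseteq> {0<..T}"
    and W_open: "\<And>u. u \<in> W \<Longrightarrow> \<exists>d>0. {u - d<..<u + d} \<inter> {0<..T} \<subseteq> W"
    and \<epsilon>: "0 < \<epsilon>"
  shows "AE \<omega> in M. \<forall>\<^sub>F n in sequentially.
    (\<Sum>i\<in>{1..A n T \<omega>}. indicator (W - dyadic_inner T W m) (epoch_time (\<lambda>t. A n t \<omega>) i)) <
      real n * (measure \<mu> (W - dyadic_inner T W m) + \<epsilon>)"
proof -
  interpret \<mu>: finite_measure \<mu> by (rule finite_measure_\<mu>)
  define D where "D = W - dyadic_inner T W m"
  define d where "d k = dyadic_inner T W k - dyadic_inner T W m" for k
  define b where "b = measure \<mu> D"
  have D_eq: "D = (\<Union>k. d k)"
    unfolding D_def d_def using Union_dyadic_inner[OF T W W_open] by auto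
  have d_mono: "d k \<subseteq> d k'" if "k \<le> k'" for k k'
    unfolding d_def using dyadic_inner_mono[OF T that] by auto
  have [measurable]: "D \<in> sets borel" unfolding D_eq d_def by measurable
  define N where "N B n \<omega> = (\<Sum>i\<in>{1..A n T \<omega>}. indicat_real B (epoch_time (\<lambda>t. A n t \<omega>) i))" for B n \<omega>
  have N_mono: "N B n \<omega> \<le> N B' n \<omega>" if "B \<subseteq> B'" for B B' n \<omega>
    unfolding N_def using that by (intro sum_mono) (auto simp: indicator_def)
  have N_D: "\<exists>k\<ge>m. N (d k) n \<omega> = N D n \<omega>" for n \<omega>
  proof -
    let ?I = "{i\<in>{1..A n T \<omega>}. epoch_time (\<lambda>t. A n t \<omega>) i \<in> D}"
    have "\<forall>i\<in>?I. \<exists>k. epoch_time (\<lambda>t. A n t \<omega>) i \<in> d k" unfolding D_eq by blast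
    from bchoice[OF this]
    obtain \<kappa> where \<kappa>: "\<forall>i\<in>?I. epoch_time (\<lambda>t. A n t \<omega>) i \<in> d (\<kappa> i)" ..
    have fin: "finite ?I" by (rule finite_subset[of _ "{1..A n T \<omega>}"]) blast+
    define k where "k = m + (\<Sum>i\<in>?I. \<kappa> i)"
    have "\<kappa> i \<le> k" if "i \<in> ?I" for i
    proof -
      have "\<kappa> i \<le> (\<Sum>i\<in>?I. \<kappa> i)" by (rule member_le_sum[OF that le0 fin])
      then show ?thesis unfolding k_def by (rule trans_le_add2)
    qed
    then have in_d: "epoch_time (\<lambda>t. A n t \<omega>) i \<in> d k" if "i \<in> ?I" for i
      using bspec[OF \<kappa> that] d_mono[of "\<kappa> i" k] that by blast
    have "d k \<subseteq> D" unfolding D_eq by blast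
    then have "epoch_time (\<lambda>t. A n t \<omega>) i \<in> d k \<longleftrightarrow> epoch_time (\<lambda>t. A n t \<omega>) i \<in> D"
      if "i \<in> {1..A n T \<omega>}" for i
      using in_d[of i] that by blast
    then have "N (d k) n \<omega> = N D n \<omega>"
      unfolding N_def indicator_def by (intro sum.cong refl) simp
    then show ?thesis by (intro exI[of _ k]) (simp add: k_def)
  qed
  define E where "E n k = {\<omega>\<in>space M. real n * (b + \<epsilon>) \<le> N (d (m + k)) n \<omega>}" for n k
  have E: "E n k \<in> events" "prob (E n k) \<le> exp (- chernoff_rate b \<epsilon> * n)" if n: "1 \<le> n" for n k
  proof -
    define h where "h = T / 2 ^ (m + k)"
    define J where "J = {j\<in>dyadic_cells T W (m + k). cell h j \<inter> dyadic_inner T W m = {}}"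
    have h: "0 < h" "real (2 ^ (m + k)) * h = T" using T by (auto simp: h_def)
    have J: "J \<subseteq> {..<2 ^ (m + k)}" using dyadic_cells_finite(2) by (auto simp: J_def)
    have d_eq: "d (m + k) = (\<Union>j\<in>J. cell h j)"
      unfolding d_def J_def h_def by (rule dyadic_inner_diff[OF T]) simp
    have "N (d (m + k)) n \<omega> = real (\<Sum>j\<in>J. increment h n j \<omega>)" if "\<omega> \<in> space M" for \<omega>
      using sum_arrivals_in_cells[OF counting[OF n that] h(1) J, unfolded h(2)]
      unfolding N_def d_eq increment_def[OF h] .
    then have E_eq: "E n k = {\<omega>\<in>space M. real n * (b + \<epsilon>) \<le> real (\<Sum>j\<in>J. increment h n j \<omega>)}"
      by (auto simp: E_def)
    note [measurable] = increment_measurable[OF h n]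
    show "E n k \<in> events" unfolding E_eq by measurable
    have le: "measure \<mu> (\<Union>j\<in>J. cell h j) \<le> b"
    proof -
      have "d (m + k) \<subseteq> D" unfolding D_eq by blast
      then show ?thesis unfolding d_eq[symmetric] b_def by (rule \<mu>.finite_measure_mono) simp
    qed
    have "prob (E n k) \<le> prob {\<omega>\<in>space M. real n * (measure \<mu> (\<Union>j\<in>J. cell h j) + \<epsilon>) \<le> real (\<Sum>j\<in>J. increment h n j \<omega>)}"
      unfolding E_eq
    proof (rule finite_measure_mono)
      have "real n * (measure \<mu> (\<Union>j\<in>J. cell h j) + \<epsilon>) \<le> real n * (b + \<epsilon>)"
        using le by (intro mult_left_mono) auto
      then show "{\<omega>\<in>space M. real n * (b + \<epsilon>) \<le> real (\<Sum>j\<in>J. increment h n j \<omega>)} \<subseteq>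
        {\<omega>\<in>space M. real n * (measure \<mu> (\<Union>j\<in>J. cell h j) + \<epsilon>) \<le> real (\<Sum>j\<in>J. increment h n j \<omega>)}"
        by (blast intro: order_trans)
    qed measurable
    also have "\<dots> \<le> exp (- chernoff_rate b \<epsilon> * n)"
      by (rule increments_chernoff(1)[OF h n J le \<epsilon>])
    finally show "prob (E n k) \<le> exp (- chernoff_rate b \<epsilon> * n)" .
  qed
  have "AE \<omega> in M. \<forall>\<^sub>F n in sequentially. \<omega> \<notin> (\<Union>k. E n k)"
  proof (rule AE_eventually_not_if_exponentially_small[where a = 1 and c = "chernoff_rate b \<epsilon>"])
    show "0 < chernoff_rate b \<epsilon>" using \<epsilon> by (intro chernoff_rate_pos) (auto simp: b_def)
    fix n :: nat assume n: "1 \<le> n"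
    show "(\<Union>k. E n k) \<in> events" using E(1)[OF n] by auto
    have "incseq (E n)"
    proof (intro incseq_SucI subsetI)
      fix k \<omega> assume "\<omega> \<in> E n k"
      then show "\<omega> \<in> E n (Suc k)"
        using N_mono[OF d_mono[of "m + k" "m + Suc k"], of n \<omega>] by (auto simp: E_def)
    qed
    then have "(\<lambda>k. prob (E n k)) \<longlonglongrightarrow> prob (\<Union>k. E n k)"
      using E(1)[OF n] by (intro finite_Lim_measure_incseq) auto
    then show "prob (\<Union>k. E n k) \<le> 1 * exp (- chernoff_rate b \<epsilon> * n)"
      by (rule LIMSEQ_le_const2) (use E(2)[OF n] in auto)
  qed
  then show ?thesis
    using AE_space
  proof eventually_elim
    case (elim \<omega>)
    show ?case using elim(1)
    proof eventually_elim
      case (elim n)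
      obtain k where "m \<le> k" "N (d k) n \<omega> = N D n \<omega>" using N_D by blast
      moreover have "\<omega> \<notin> E n (k - m)" using elim by blast
      ultimately have "\<not> real n * (b + \<epsilon>) \<le> N D n \<omega>"
        using \<open>\<omega> \<in> space M\<close> by (auto simp: E_def)
      then show ?case by (simp add: N_def D_def b_def)
    qed
  qed
qed

lemma measure_outside_dyadic_inner_tendsto:
  assumes W: "W \<subseteq> {0<..T}"
    and W_open: "\<And>u. u \<in> W \<Longrightarrow> \<exists>d>0. {u - d<..<u + d} \<inter> {0<..T} \<subseteq> W"
  shows "(\<lambda>m. measure \<mu> (W - dyadic_inner T W m)) \<longlonglongrightarrow> 0"
proof -
  interpret \<mu>: finite_measure \<mu> by (rule finite_measure_\<mu>)
  have U: "(\<Union>m. dyadic_inner T W m) = W" by (rule Union_dyadic_inner[OF T W W_open])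
  have [measurable]: "W \<in> sets borel" by (rule sets_relatively_open[OF T W W_open])
  have "(\<lambda>m. measure \<mu> (W - dyadic_inner T W m)) \<longlonglongrightarrow> measure \<mu> (\<Inter>m. W - dyadic_inner T W m)"
  proof (rule \<mu>.finite_Lim_measure_decseq)
    show "decseq (\<lambda>m. W - dyadic_inner T W m)"
      unfolding decseq_def using dyadic_inner_mono[OF T] by blast
  qed auto
  moreover have "(\<Inter>m. W - dyadic_inner T W m) = {}" using U by blast
  ultimately show ?thesis by (simp only: measure_empty)
qed

end

section \<open>Laws of large numbers for the initial jobs and for a fixed acceptance policy\<close>

text \<open>
  A grid as in the Glivenko-Cantelli theorem.  Gaps are measured as open intervals,
  which leaves atoms on the grid; compactness of \<open>[a, b]\<close> makes it finite.
\<close>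

lemma finite_small_gap_grid:
  fixes \<mu> :: "real measure"
  assumes "finite_borel_measure \<mu>" and \<theta>: "0 < \<theta>"
  shows "\<exists>X. finite X \<and> (\<forall>t\<in>{a..b}. t \<in> X \<or> (\<exists>c\<in>X. \<exists>d\<in>X. c < t \<and> t < d \<and> measure \<mu> {c<..<d} \<le> \<theta>))"
proof -
  interpret finite_borel_measure \<mu> by fact
  have gap: "\<exists>e>0. measure \<mu> {c<..<c + e} \<le> \<theta> \<and> measure \<mu> {c - e<..<c} \<le> \<theta>" for c
  proof -
    define u where "u k = inverse (real (Suc k))" for k
    have u: "u \<longlonglongrightarrow> 0" unfolding u_def by (rule LIMSEQ_inverse_real_of_nat)
    have u_dec: "u k' \<le> u k" if "k \<le> k'" for k k'
      unfolding u_def using that by (intro le_imp_inverse_le) auto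
    have "(\<lambda>k. measure \<mu> {c<..<c + u k}) \<longlonglongrightarrow> measure \<mu> (\<Inter>k. {c<..<c + u k})"
      using u_dec by (intro finite_Lim_measure_decseq) (fastforce simp: decseq_def)+
    moreover have "(\<Inter>k. {c<..<c + u k}) = {}"
    proof (rule equals0I)
      fix x assume x: "x \<in> (\<Inter>k. {c<..<c + u k})"
      then have "c < x" and le: "\<And>k. x - c < u k" by (auto simp: diff_less_eq add.commute)
      have "\<forall>\<^sub>F k in sequentially. u k < x - c"
        using u \<open>c < x\<close> by (intro order_tendstoD(2)) auto
      then obtain k where "u k < x - c" using eventually_happens by fastforce
      with le[of k] show False by simp
    qed
    moreover have "(\<lambda>k. measure \<mu> {c - u k<..<c}) \<longlonglongrightarrow> measure \<mu> (\<Inter>k. {c - u k<..<c})"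
      using u_dec by (intro finite_Lim_measure_decseq) (fastforce simp: decseq_def)+
    moreover have "(\<Inter>k. {c - u k<..<c}) = {}"
    proof (rule equals0I)
      fix x assume x: "x \<in> (\<Inter>k. {c - u k<..<c})"
      then have "x < c" and le: "\<And>k. c - x < u k" by (auto simp: diff_less_eq add.commute)
      have "\<forall>\<^sub>F k in sequentially. u k < c - x"
        using u \<open>x < c\<close> by (intro order_tendstoD(2)) auto
      then obtain k where "u k < c - x" using eventually_happens by fastforce
      with le[of k] show False by simp
    qed
    ultimately have "(\<lambda>k. measure \<mu> {c<..<c + u k}) \<longlonglongrightarrow> 0" "(\<lambda>k. measure \<mu> {c - u k<..<c}) \<longlonglongrightarrow> 0"
      by simp_all
    then have "\<forall>\<^sub>F k in sequentially. measure \<mu> {c<..<c + u k} < \<theta> \<and> measure \<mu> {c - u k<..<c} < \<theta>"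
      using \<theta> by (intro eventually_conj order_tendstoD(2)[where y = 0]) auto
    then obtain k where "measure \<mu> {c<..<c + u k} < \<theta>" "measure \<mu> {c - u k<..<c} < \<theta>"
      using eventually_happens by fastforce
    moreover have "0 < u k" by (simp add: u_def)
    ultimately show ?thesis by (intro exI[of _ "u k"]) auto
  qed
  then obtain e where e: "\<And>c. 0 < e c" "\<And>c. measure \<mu> {c<..<c + e c} \<le> \<theta>"
    "\<And>c. measure \<mu> {c - e c<..<c} \<le> \<theta>" by metis
  have "\<exists>C\<subseteq>{a..b}. finite C \<and> {a..b} \<subseteq> (\<Union>c\<in>C. {c - e c<..<c + e c})"
  proof (rule compactE_image[of "{a..b}" "{a..b}" "\<lambda>c. {c - e c<..<c + e c}"])
    show "{a..b} \<subseteq> (\<Union>c\<in>{a..b}. {c - e c<..<c + e c})"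
      using e(1) by force
  qed auto
  then obtain C where C: "finite C" "{a..b} \<subseteq> (\<Union>c\<in>C. {c - e c<..<c + e c})" by blast
  define X where "X = C \<union> (\<lambda>c. c - e c) ` C \<union> (\<lambda>c. c + e c) ` C"
  have "t \<in> X \<or> (\<exists>c\<in>X. \<exists>d\<in>X. c < t \<and> t < d \<and> measure \<mu> {c<..<d} \<le> \<theta>)" if t: "t \<in> {a..b}" for t
  proof -
    obtain c where c: "c \<in> C" "t \<in> {c - e c<..<c + e c}" using C(2) t by blast
    have X: "c \<in> X" "c - e c \<in> X" "c + e c \<in> X" using c(1) by (auto simp: X_def)
    consider "t = c" | "t < c" | "c < t" by linarith
    then show ?thesis
    proof cases
      case 1
      then show ?thesis using X(1) by simp
    next
      case 2
      then have "c - e c < t \<and> t < c \<and> measure \<mu> {c - e c<..<c} \<le> \<theta>" using c(2) e(3) by simp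
      then show ?thesis using X by blast
    next
      case 3
      then have "c < t \<and> t < c + e c \<and> measure \<mu> {c<..<c + e c} \<le> \<theta>" using c(2) e(2) by simp
      then show ?thesis using X by blast
    qed
  qed
  moreover have "finite X" using C(1) by (simp add: X_def)
  ultimately show ?thesis by blast
qed

text \<open>
  Since \<open>\<mu>\<close> may have atoms, both the jobs with remaining service \<open>> c\<close> and those with \<open>\<ge> c\<close> are
  counted at every grid point \<open>c\<close>; monotonicity in \<open>t\<close> fills the gaps.
\<close>

lemma (in prob_space) AE_eventually_initial_close:
  fixes S0 :: "nat \<Rightarrow> nat \<Rightarrow> 'a \<Rightarrow> real" and N0 :: "nat \<Rightarrow> 'a \<Rightarrow> nat" and \<delta> r a b :: real
  assumes \<mu>: "real_distribution \<mu>"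
    and iid: "\<And>n. 1 \<le> n \<Longrightarrow> iid_with_cdf M {1..n} (S0 n) (cdf \<mu>)"
    and N0: "\<And>n \<omega>. 1 \<le> n \<Longrightarrow> \<omega> \<in> space M \<Longrightarrow> N0 n \<omega> \<le> n"
    and lim: "AE \<omega> in M. (\<lambda>n. real (N0 n \<omega>) / real n) \<longlonglongrightarrow> r"
    and \<delta>: "0 < \<delta>"
  shows "AE \<omega> in M. \<forall>\<^sub>F n in sequentially. \<forall>t\<in>{a..b}.
    \<bar>1 / real n * (\<Sum>i\<in>{1..N0 n \<omega>}. of_bool (t < S0 n i \<omega>)) - r * (1 - cdf \<mu> t)\<bar> \<le> \<delta>"
proof -
  interpret \<mu>: real_distribution \<mu> by fact
  define \<theta> where "\<theta> = \<delta> / 3"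
  have \<theta>: "0 < \<theta>" using \<delta> by (simp add: \<theta>_def)
  have "finite_borel_measure \<mu>" by unfold_locales
  from finite_small_gap_grid[OF this \<theta>, of a b]
  obtain X where X: "finite X" "\<And>t. t \<in> {a..b} \<Longrightarrow>
      t \<in> X \<or> (\<exists>c\<in>X. \<exists>d\<in>X. c < t \<and> t < d \<and> measure \<mu> {c<..<d} \<le> \<theta>)" by auto
  have counts: "AE \<omega> in M. \<forall>\<^sub>F n in sequentially. \<forall>k\<le>1 * n.
      \<bar>(\<Sum>i=1..k. indicat_real B (S0 n i \<omega>)) - k * measure \<mu> B\<bar> < \<theta> * n" if "B \<in> sets borel" for B
    by (rule AE_eventually_iid_counts[OF iid _ \<mu> that \<theta>]) auto
  have all_counts: "AE \<omega> in M. \<forall>c\<in>X. (\<forall>\<^sub>F n in sequentially. \<forall>k\<le>1 * n.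
      \<bar>(\<Sum>i=1..k. indicat_real {c<..} (S0 n i \<omega>)) - k * measure \<mu> {c<..}\<bar> < \<theta> * n) \<and>
      (\<forall>\<^sub>F n in sequentially. \<forall>k\<le>1 * n.
      \<bar>(\<Sum>i=1..k. indicat_real {c..} (S0 n i \<omega>)) - k * measure \<mu> {c..}\<bar> < \<theta> * n)"
    using counts X(1) by (intro AE_finite_allI AE_conjI) auto
  show ?thesis
    using all_counts lim AE_space
  proof eventually_elim
    case (elim \<omega>)
    have "\<forall>\<^sub>F n in sequentially. \<bar>real (N0 n \<omega>) / real n - r\<bar> < \<theta>"
      using tendstoD[OF elim(2) \<theta>] by (simp add: dist_real_def)
    moreover have "\<forall>\<^sub>F n in sequentially. \<forall>c\<in>X. (\<forall>k\<le>1 * n.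
      \<bar>(\<Sum>i=1..k. indicat_real {c<..} (S0 n i \<omega>)) - k * measure \<mu> {c<..}\<bar> < \<theta> * n) \<and>
      (\<forall>k\<le>1 * n. \<bar>(\<Sum>i=1..k. indicat_real {c..} (S0 n i \<omega>)) - k * measure \<mu> {c..}\<bar> < \<theta> * n)"
      using elim(1) X(1) by (simp only: eventually_ball_finite_distrib eventually_conj_iff)
    ultimately show ?case
      using eventually_ge_at_top[of 1]
    proof eventually_elim
      case (elim n)
      define k where "k = N0 n \<omega>"
      have k: "k \<le> n" "k \<le> 1 * n" using N0[OF elim(3) \<open>\<omega> \<in> space M\<close>] by (auto simp: k_def)
      define f where "f B = (\<Sum>i=1..k. indicat_real B (S0 n i \<omega>))" for B
      have f1: "\<bar>f {c<..} - k * measure \<mu> {c<..}\<bar> < \<theta> * n" and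
        f2: "\<bar>f {c..} - k * measure \<mu> {c..}\<bar> < \<theta> * n" if "c \<in> X" for c
        using elim(2) that k(2) unfolding f_def by blast+
      have f_mono: "f B \<le> f B'" if "B \<subseteq> B'" for B B'
        unfolding f_def using that by (intro sum_mono) (auto simp: indicator_def)
      have mono: "measure \<mu> B \<le> measure \<mu> B'" if "B \<subseteq> B'" "B' \<in> sets borel" for B B'
        using that by (intro \<mu>.finite_measure_mono) auto
      have surv: "measure \<mu> {t<..} = 1 - cdf \<mu> t" for t
      proof -
        have "{t<..} = space \<mu> - {..t}" by auto
        then show ?thesis using \<mu>.prob_compl[of "{..t}"] by (simp add: cdf_def)
      qed
      have close: "\<bar>f {t<..} - k * measure \<mu> {t<..}\<bar> \<le> 2 * \<theta> * n" if t: "t \<in> {a..b}" for t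
        using X(2)[OF t]
      proof (elim disjE bexE conjE)
        assume "t \<in> X"
        from f1[OF this] show ?thesis using \<theta> by simp
      next
        fix c d assume cd: "c \<in> X" "d \<in> X" "c < t" "t < d" "measure \<mu> {c<..<d} \<le> \<theta>"
        have "{c<..} = {c<..<d} \<union> {d..}" using cd by auto
        then have "measure \<mu> {c<..} \<le> measure \<mu> {c<..<d} + measure \<mu> {d..}"
          using measure_Un_le[of "{c<..<d}" \<mu> "{d..}"] by simp
        then have gap: "measure \<mu> {c<..} \<le> \<theta> + measure \<mu> {d..}" using cd by simp
        have ord: "measure \<mu> {d..} \<le> measure \<mu> {t<..}" "measure \<mu> {t<..} \<le> measure \<mu> {c<..}"
          using cd by (auto intro!: mono)
        have kn: "k * \<theta> \<le> n * \<theta>" using k \<theta> by (intro mult_right_mono) auto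
        have "k * measure \<mu> {c<..} \<le> k * (\<theta> + measure \<mu> {t<..})"
          using gap ord by (intro mult_left_mono) auto
        moreover have "k * measure \<mu> {t<..} \<le> k * (\<theta> + measure \<mu> {d..})"
          using gap ord by (intro mult_left_mono) auto
        moreover have "f {d..} \<le> f {t<..}" "f {t<..} \<le> f {c<..}"
          using cd by (auto intro!: f_mono)
        ultimately show ?thesis
          using f1[OF cd(1)] f2[OF cd(2)] kn by (simp add: algebra_simps abs_le_iff abs_less_iff)
      qed
      show ?case
      proof
        fix t assume t: "t \<in> {a..b}"
        have n: "0 < real n" using elim(3) by simp
        have "\<bar>f {t<..} / n - k / n * measure \<mu> {t<..}\<bar> = \<bar>f {t<..} - k * measure \<mu> {t<..}\<bar> / n"
          using n by (simp add: diff_divide_distrib[symmetric])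
        also have "\<dots> \<le> 2 * \<theta>" using close[OF t] n by (simp add: field_simps)
        finally have 1: "\<bar>f {t<..} / n - k / n * measure \<mu> {t<..}\<bar> \<le> 2 * \<theta>" .
        have "\<bar>k / n * measure \<mu> {t<..} - r * measure \<mu> {t<..}\<bar> = \<bar>k / n - r\<bar> * measure \<mu> {t<..}"
          by (simp only: left_diff_distrib[symmetric] abs_mult abs_of_nonneg[OF measure_nonneg])
        also have "\<dots> \<le> \<theta> * 1"
          using elim(1) by (intro mult_mono) (auto simp: k_def)
        finally have 2: "\<bar>k / n * measure \<mu> {t<..} - r * measure \<mu> {t<..}\<bar> \<le> \<theta>" by simp
        have "\<bar>x - z\<bar> \<le> \<delta>" if "\<bar>x - y\<bar> \<le> 2 * \<theta>" "\<bar>y - z\<bar> \<le> \<theta>" for x y z :: real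
          using that unfolding \<theta>_def by linarith
        from this[OF 1 2] have "\<bar>f {t<..} / n - r * (1 - cdf \<mu> t)\<bar> \<le> \<delta>"
          unfolding surv .
        moreover have "f {t<..} = (\<Sum>i\<in>{1..N0 n \<omega>}. of_bool (t < S0 n i \<omega>))"
          by (simp add: f_def k_def indicator_def)
        ultimately show "\<bar>1 / real n * (\<Sum>i\<in>{1..N0 n \<omega>}. of_bool (t < S0 n i \<omega>)) - r * (1 - cdf \<mu> t)\<bar> \<le> \<delta>"
          by simp
      qed
    qed
  qed
qed

context poisson_arrivals
begin

text \<open>
  For a fixed dyadic level the hypotheses of \<open>busy_close_to_fluid\<close> involve only finitely many counts.
  Given the numbers of arrivals at the ends of a cell, the jobs of that cell have
  consecutive indices, and the number of long services among them is a difference of two partial sums.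
\<close>

lemma AE_eventually_busy_close:
  fixes S :: "nat \<Rightarrow> nat \<Rightarrow> 'w \<Rightarrow> real" and \<delta> :: real
  assumes S: "\<And>n. 1 \<le> n \<Longrightarrow> iid_with_cdf M {1..} (S n) (cdf \<sigma>)"
    and \<sigma>: "real_distribution \<sigma>" and cont: "continuous_on UNIV (cdf \<sigma>)"
    and W: "W \<subseteq> {0<..T}"
    and W_open: "\<And>u. u \<in> W \<Longrightarrow> \<exists>d>0. {u - d<..<u + d} \<inter> {0<..T} \<subseteq> W"
    and \<delta>: "0 < \<delta>"
  shows "AE \<omega> in M. \<forall>\<^sub>F n in sequentially. \<forall>t. 0 < t \<longrightarrow> t \<le> T \<longrightarrow>
    \<bar>1 / real n * busy {i\<in>{1..A n T \<omega>}. epoch_time (\<lambda>t. A n t \<omega>) i \<in> W} (epoch_time (\<lambda>t. A n t \<omega>)) (\<lambda>i. S n i \<omega>) t -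
     (LINT u|\<mu>. of_bool (u \<in> W \<and> u \<le> t) * (1 - cdf \<sigma> (t - u)))\<bar> \<le> \<delta>"
proof -
  interpret \<mu>: finite_measure \<mu> by (rule finite_measure_\<mu>)
  interpret \<sigma>: real_distribution \<sigma> by fact
  let ?F = "cdf \<sigma>"
  have W_meas: "W \<in> sets borel"
    by (rule sets_relatively_open[OF T W W_open])
  define \<theta> where "\<theta> = \<delta> / (2 * (measure \<mu> UNIV + 2))"
  have tot: "0 < measure \<mu> UNIV + 2" using measure_nonneg[of \<mu> UNIV] by linarith
  have half: "\<delta> / (2 * c) * c = \<delta> / 2" if "0 < c" for c :: real
    using that by (simp add: field_simps)
  have \<theta>: "0 < \<theta>" "\<theta> * (measure \<mu> UNIV + 2) = \<delta> / 2"
    using \<delta> tot half[OF tot] unfolding \<theta>_def by (simp, simp only:)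
  obtain d1 where d1: "0 < d1" "\<And>s t. 0 \<le> s \<Longrightarrow> s \<le> t \<Longrightarrow> t \<le> T \<Longrightarrow> t - s < d1 \<Longrightarrow> measure \<mu> {s<..t} < \<theta>"
    using \<mu>_uniformly_continuous[OF \<theta>(1)] by blast
  have "uniformly_continuous_on {0..T} ?F"
    by (intro compact_uniformly_continuous continuous_on_subset[OF cont]) auto
  then obtain d2 where d2: "0 < d2" "\<And>s t. s \<in> {0..T} \<Longrightarrow> t \<in> {0..T} \<Longrightarrow> dist t s < d2 \<Longrightarrow> dist (?F t) (?F s) < \<theta>"
    unfolding uniformly_continuous_on_def using \<theta>(1) by metis
  have "\<forall>\<^sub>F m in sequentially. measure \<mu> (W - dyadic_inner T W m) < \<theta>"
    using measure_outside_dyadic_inner_tendsto[OF W W_open] \<theta>(1) by (rule order_tendstoD(2))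
  moreover have "\<forall>\<^sub>F m in sequentially. 2 * T / 2 ^ m < min d1 d2"
  proof -
    have "(\<lambda>m. 2 * T * (1 / 2) ^ m) \<longlonglongrightarrow> 2 * T * 0"
      by (intro tendsto_intros LIMSEQ_power_zero) simp
    then have "(\<lambda>m. 2 * T / 2 ^ m) \<longlonglongrightarrow> 0" by (simp add: power_one_over field_simps)
    then show ?thesis using d1(1) d2(1) by (intro order_tendstoD(2)) auto
  qed
  ultimately have "\<forall>\<^sub>F m in sequentially. measure \<mu> (W - dyadic_inner T W m) < \<theta> \<and> 2 * T / 2 ^ m < min d1 d2"
    by (rule eventually_conj)
  then obtain m where m: "measure \<mu> (W - dyadic_inner T W m) < \<theta>" "2 * T / 2 ^ m < min d1 d2"
    using eventually_happens by fastforce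
  define h where "h = T / 2 ^ m"
  define L :: nat where "L = 2 ^ m"
  have h: "0 < h" "real L * h = T" using T by (auto simp: h_def L_def)
  have h2: "2 * h < d1" "2 * h < d2" using m(2) by (auto simp: h_def)
  have inner: "dyadic_inner T W m = (\<Union>j\<in>dyadic_cells T W m. cell h j)"
    by (simp add: dyadic_inner_def h_def)
  define \<eta> where "\<eta> = \<delta> / (2 * real (L + 2))"
  have \<eta>: "0 < \<eta>" "real (L + 2) * \<eta> = \<delta> / 2" using \<delta> half[of "real (L + 2)"] by (auto simp: \<eta>_def mult.commute)
  define C where "C = nat \<lceil>measure \<mu> UNIV + 1\<rceil>"
  have grid: "0 \<le> real r * h \<and> real r * h \<le> T" if "r \<le> L" for r
  proof -
    have "real r * h \<le> real L * h" using that h(1) by (intro mult_right_mono) auto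
    then show ?thesis using h by simp
  qed
  have small: "measure \<mu> (cell h j) \<le> \<theta>" if "j < L" for j
  proof -
    have "real (Suc j) * h - real j * h < d1" using h h2 by (simp add: algebra_simps)
    then have "measure \<mu> {real j * h<..real (Suc j) * h} < \<theta>"
      using grid[of j] grid[of "Suc j"] that h(1) by (intro d1(2)) auto
    then show ?thesis by (simp add: cell_def)
  qed
  have osc: "?F (real (Suc (Suc r)) * h) - ?F (real r * h) \<le> \<theta>" if "Suc (Suc r) \<le> L" for r
  proof -
    have "dist (real (Suc (Suc r)) * h) (real r * h) < d2" using h h2 by (simp add: dist_real_def algebra_simps)
    then have "dist (?F (real (Suc (Suc r)) * h)) (?F (real r * h)) < \<theta>"
      using grid[of r] grid[of "Suc (Suc r)"] that by (intro d2(2)) auto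
    then show ?thesis by (simp add: dist_real_def)
  qed
  have counts: "AE \<omega> in M. \<forall>r\<le>L. \<forall>\<^sub>F n in sequentially. \<forall>k\<le>C * n.
      \<bar>(\<Sum>i=1..k. indicat_real {real r * h<..} (S n i \<omega>)) - k * measure \<sigma> {real r * h<..}\<bar> < \<eta> / 3 * n"
    using \<eta>(1) by (intro AE_all_countable[THEN iffD2] allI AE_impI AE_eventually_iid_counts[OF S _ \<sigma>]) auto
  have incs: "AE \<omega> in M. \<forall>j\<in>{..<L}. \<forall>\<^sub>F n in sequentially.
      \<bar>real (increment h n j \<omega>) - n * measure \<mu> (cell h j)\<bar> < \<eta> / 3 * n"
    using \<eta>(1) by (intro AE_finite_allI AE_eventually_increment[OF h]) auto
  have total: "AE \<omega> in M. \<forall>\<^sub>F n in sequentially. \<bar>real (increment T n 0 \<omega>) - n * measure \<mu> (cell T 0)\<bar> < 1 * real n"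
    using T by (intro AE_eventually_increment[where L = 1]) auto
  have rest: "AE \<omega> in M. \<forall>\<^sub>F n in sequentially.
      (\<Sum>i\<in>{1..A n T \<omega>}. indicator (W - dyadic_inner T W m) (epoch_time (\<lambda>t. A n t \<omega>) i)) <
      real n * (measure \<mu> (W - dyadic_inner T W m) + \<eta>)"
    by (rule AE_eventually_arrivals_outside_dyadic_inner[OF W W_open \<eta>(1)])
  show ?thesis
    using counts incs total rest AE_space
  proof eventually_elim
    case (elim \<omega>)
    have "\<forall>\<^sub>F n in sequentially. \<forall>r\<in>{..L}. \<forall>k\<le>C * n.
        \<bar>(\<Sum>i=1..k. indicat_real {real r * h<..} (S n i \<omega>)) - k * measure \<sigma> {real r * h<..}\<bar> < \<eta> / 3 * n"
      using elim(1) by (subst eventually_ball_finite_distrib) auto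
    moreover have "\<forall>\<^sub>F n in sequentially. \<forall>j\<in>{..<L}.
        \<bar>real (increment h n j \<omega>) - n * measure \<mu> (cell h j)\<bar> < \<eta> / 3 * n"
      using elim(2) by (subst eventually_ball_finite_distrib) auto
    ultimately show ?case
      using elim(3,4) eventually_ge_at_top[of 1]
    proof eventually_elim
      case (elim n)
      note \<omega> = \<open>\<omega> \<in> space M\<close>
      have n: "1 \<le> n" "0 < real n" using elim(5) by auto
      define a where "a t = A n t \<omega>" for t
      have a: "counting_path a" unfolding a_def using counting[OF n(1) \<omega>] .
      have a0: "a 0 = 0" using a by (simp add: counting_path_def)
      define s where "s i = S n i \<omega>" for i
      define p where "p r = measure \<sigma> {real r * h<..}" for r :: nat
      have p: "p r = 1 - ?F (real r * h)" for r
      proof -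
        have "{real r * h<..} = space \<sigma> - {..real r * h}" by auto
        then show ?thesis using \<sigma>.prob_compl[of "{..real r * h}"] by (simp add: p_def cdf_def)
      qed
      have p01: "0 \<le> p r" "p r \<le> 1" for r by (simp_all add: p_def)
      define f where "f r k = (\<Sum>i=1..k. indicat_real {real r * h<..} (s i))" for r k :: nat
      have f: "\<bar>f r k - k * p r\<bar> < \<eta> / 3 * n" if "r \<le> L" "k \<le> C * n" for r k
        using elim(1) that unfolding f_def p_def s_def by auto
      have aT: "a T \<le> C * n"
      proof -
        have "increment T n 0 \<omega> = a T" unfolding increment_def[OF T, of 1, simplified] using a0 by (simp add: a_def)
        moreover have "measure \<mu> (cell T 0) \<le> measure \<mu> UNIV"
          using \<mu>.bounded_measure[of "cell T 0"] by simp
        then have "n * measure \<mu> (cell T 0) \<le> n * measure \<mu> UNIV" by (intro mult_left_mono) auto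
        ultimately have "real (a T) \<le> n * (measure \<mu> UNIV + 1)"
          using elim(3) by (simp add: algebra_simps)
        also have "\<dots> \<le> n * real C"
          unfolding C_def by (intro mult_left_mono real_nat_ceiling_ge) auto
        finally show ?thesis by (simp add: mult.commute flip: of_nat_mult)
      qed
      have a_le: "a (real j * h) \<le> C * n" if "j \<le> L" for j
        using grid[OF that] counting_path_mono[OF a, of "real j * h" T] aT by linarith
      have inc: "\<bar>real (a (real (Suc j) * h)) - real (a (real j * h)) - n * measure \<mu> (cell h j)\<bar> < \<eta> / 3 * n"
        "a (real j * h) \<le> a (real (Suc j) * h)" if "j < L" for j
      proof -
        show le: "a (real j * h) \<le> a (real (Suc j) * h)"
          using h(1) by (intro counting_path_mono[OF a]) (auto intro!: mult_right_mono)
        have "\<bar>real (increment h n j \<omega>) - n * measure \<mu> (cell h j)\<bar> < \<eta> / 3 * n" using elim(2) that by blast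
        then show "\<bar>real (a (real (Suc j) * h)) - real (a (real j * h)) - n * measure \<mu> (cell h j)\<bar> < \<eta> / 3 * n"
          unfolding increment_def[OF h] a_def[symmetric] using le by (simp only: of_nat_diff)
      qed
      let ?K = "{1..a T}" and ?\<tau> = "epoch_time a"
      have "\<bar>1 / real n * busy {i\<in>?K. ?\<tau> i \<in> W} ?\<tau> s t -
          (LINT u|\<mu>. of_bool (u \<in> W \<and> u \<le> t) * (1 - ?F (t - u)))\<bar> \<le>
          \<theta> * (measure \<mu> UNIV + 2) + real (L + 2) * \<eta>" if t: "0 < t" "t \<le> T" for t
      proof (rule busy_close_to_fluid[where J = "dyadic_cells T W m"])
        show "0 < h" "finite ?K" "0 \<le> \<eta>" "finite_measure \<mu>" "W \<in> sets borel" "0 < t" "0 < real n"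
          using h t \<eta>(1) W_meas finite_measure_\<mu> n by simp_all
        show "sets \<mu> = sets borel" by simp
        show "emeasure \<mu> (- {0<..real L * h}) = 0" unfolding h(2) by (rule emeasure_\<mu>_outside)
        show "t \<le> real L * h" unfolding h(2) by fact
        show "0 < ?\<tau> i \<and> ?\<tau> i \<le> real L * h" if "i \<in> ?K" for i
        proof -
          have i: "1 \<le> i" "i \<le> a T" using that by auto
          then show ?thesis
            using counting_path_epoch_time(2)[OF a i(1) _ i(2)] counting_path_epoch_time_le_iff[OF a i, of T] T
            unfolding h(2) by simp
        qed
        show "dyadic_cells T W m \<subseteq> {..<L}" unfolding L_def by (rule dyadic_cells_finite)
        show "cell h j \<subseteq> W" if "j \<in> dyadic_cells T W m" for j
          using that by (simp add: dyadic_cells_def h_def)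
        show "mono ?F" using \<sigma>.cdf_nondecreasing by (auto simp: mono_def)
        show "0 \<le> ?F x" "?F x \<le> 1" for x by (rule \<sigma>.cdf_nonneg, rule \<sigma>.cdf_bounded_prob)
        show "\<bar>1 / real n * (\<Sum>i\<in>?K. of_bool (real r * h < s i) * indicator (cell h j) (?\<tau> i)) -
         (1 - ?F (real r * h)) * measure \<mu> (cell h j)\<bar> \<le> \<eta>" if jr: "j < L" "r \<le> L" for j r
        proof -
          define k1 where "k1 = a (real j * h)"
          define k2 where "k2 = a (real (Suc j) * h)"
          define v where "v = measure \<mu> (cell h j)"
          have k: "k1 \<le> k2" "k1 \<le> C * n" "k2 \<le> C * n" "\<bar>real k2 - real k1 - n * v\<bar> < \<eta> / 3 * n"
            using inc[OF jr(1)] a_le[of j] a_le[of "Suc j"] jr(1) by (auto simp: k1_def k2_def v_def)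
          have "(\<Sum>i\<in>?K. of_bool (real r * h < s i) * indicator (cell h j) (?\<tau> i)) =
              (\<Sum>i\<in>{k1<..k2}. (of_bool (real r * h < s i) :: real))"
            unfolding k1_def k2_def using sum_arrivals_in_cell[OF a h(1) jr(1), of "\<lambda>i. of_bool (real r * h < s i)"]
            unfolding h(2) .
          also have "\<dots> = f r k2 - f r k1"
          proof -
            have "{1..k2} = {1..k1} \<union> {k1<..k2}" using k(1) by auto
            then have "f r k2 = f r k1 + (\<Sum>i\<in>{k1<..k2}. indicat_real {real r * h<..} (s i))"
              unfolding f_def by (simp only:) (intro sum.union_disjoint; auto)
            then show ?thesis by (simp add: indicator_def)
          qed
          finally have eq: "(\<Sum>i\<in>?K. of_bool (real r * h < s i) * indicator (cell h j) (?\<tau> i)) = f r k2 - f r k1" .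
          have "\<bar>real k2 - real k1 - n * v\<bar> * p r \<le> \<eta> / 3 * n * 1"
            using k(4) p01 \<eta>(1) by (intro mult_mono) auto
          then have "\<bar>(real k2 - real k1 - n * v) * p r\<bar> \<le> \<eta> / 3 * n"
            using p01[of r] by (simp add: abs_mult)
          moreover have "(real k2 - real k1 - n * v) * p r = k2 * p r - k1 * p r - n * (p r * v)"
            by (simp add: algebra_simps)
          ultimately have "\<bar>f r k2 - f r k1 - n * (p r * v)\<bar> \<le> \<eta> * n"
            using f[OF jr(2) k(2)] f[OF jr(2) k(3)] by linarith
          then have "\<bar>f r k2 - f r k1 - n * (p r * v)\<bar> / n \<le> \<eta>"
            using n by (simp add: pos_divide_le_eq)
          moreover have "f r k2 - f r k1 - n * (p r * v) = n * (1 / n * (f r k2 - f r k1) - p r * v)"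
            using n by (simp add: right_diff_distrib)
          then have "\<bar>f r k2 - f r k1 - n * (p r * v)\<bar> / n = \<bar>1 / n * (f r k2 - f r k1) - p r * v\<bar>"
            using n by (simp only: abs_mult) simp
          ultimately show ?thesis unfolding eq p[symmetric] v_def[symmetric] by linarith
        qed
        show "1 / real n * (\<Sum>i\<in>?K. indicator (cell h j) (?\<tau> i)) \<le> measure \<mu> (cell h j) + \<eta>" if j: "j < L" for j
        proof -
          have "(\<Sum>i\<in>?K. indicator (cell h j) (?\<tau> i)) = real (a (real (Suc j) * h) - a (real j * h))"
            using sum_arrivals_in_cell[OF a h(1) j, of "\<lambda>_. 1"] unfolding h(2) by simp
          also have "\<dots> = real (a (real (Suc j) * h)) - real (a (real j * h))"
            using inc(2)[OF j] by (rule of_nat_diff)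
          also have "\<dots> \<le> n * measure \<mu> (cell h j) + \<eta> / 3 * n"
            using inc(1)[OF j] by linarith
          also have "\<dots> \<le> n * measure \<mu> (cell h j) + \<eta> * n"
            using \<eta>(1) by (intro add_left_mono mult_right_mono) auto
          finally show ?thesis using n by (simp add: field_simps)
        qed
        show "1 / real n * (\<Sum>i\<in>?K. indicator (W - (\<Union>j\<in>dyadic_cells T W m. cell h j)) (?\<tau> i)) \<le>
            measure \<mu> (W - (\<Union>j\<in>dyadic_cells T W m. cell h j)) + \<eta>"
          using elim(4) n unfolding a_def[symmetric] inner by (simp add: field_simps)
        show "measure \<mu> (cell h j) \<le> \<theta>" if "j < L" for j using small[OF that] .
        show "measure \<mu> (W - (\<Union>j\<in>dyadic_cells T W m. cell h j)) \<le> \<theta>"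
          using m(1) unfolding inner by simp
        show "?F (real (Suc (Suc r)) * h) - ?F (real r * h) \<le> \<theta>" if "Suc (Suc r) \<le> L" for r
          using osc[OF that] .
      qed
      then show ?case unfolding \<theta>(2) \<eta>(2) a_def s_def by auto
    qed
  qed
qed

end

section \<open>Regularity of solutions of the Volterra equation\<close>

text \<open>
  The only subtle point is that \<open>has_density\<close> does not say that \<open>\<nu>\<close> has finite mass, and
  \<open>measure\<close> is \<open>0\<close> on sets of infinite mass; the limit \<open>1\<close> of \<open>F\<close> at infinity excludes this.
\<close>

lemma continuous_cdf_of_density:
  assumes F: "nonneg_distribution_function F" and dens: "has_density F \<nu>"
  shows "continuous_on UNIV F"
proof -
  obtain \<mu>0 where \<mu>0: "real_distribution \<mu>0" "cdf \<mu>0 = F"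
    using F by (auto simp: nonneg_distribution_function_def)
  interpret \<mu>0: real_distribution \<mu>0 by fact
  define D where "D = density lborel (\<lambda>x. ennreal (\<nu> x))"
  have [measurable]: "\<nu> \<in> borel_measurable borel" and FD: "F = cdf D"
    using dens by (auto simp: has_density_def D_def)
  have [simp, measurable_cong]: "sets D = sets borel" by (simp add: D_def)
  have "(F \<longlongrightarrow> 1) at_top" using \<mu>0.cdf_lim_at_top_prob \<mu>0(2) by simp
  then have "\<forall>\<^sub>F x in at_top. 1 / 2 < F x" by (rule order_tendstoD) simp
  then obtain K where K: "\<And>x. K \<le> x \<Longrightarrow> 1 / 2 < F x" by (auto simp: eventually_at_top_linorder)
  have le1: "emeasure D {..x} \<le> 1" if "K \<le> x" for x
  proof -
    have pos: "0 < measure D {..x}" using K[OF that] by (simp add: FD cdf_def)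
    then have "emeasure D {..x} \<noteq> \<infinity>" by (auto simp: measure_def)
    then have "emeasure D {..x} = ennreal (measure D {..x})"
      by (simp add: emeasure_eq_ennreal_measure)
    also have "measure D {..x} = F x" unfolding FD cdf_def ..
    finally show ?thesis
      using \<mu>0.cdf_bounded_prob[of x] unfolding \<mu>0(2) by (simp add: ennreal_le_1)
  qed
  have "emeasure D (\<Union>k. {..K + real k}) \<le> 1"
  proof (rule LIMSEQ_le_const2)
    show "(\<lambda>k. emeasure D {..K + real k}) \<longlonglongrightarrow> emeasure D (\<Union>k. {..K + real k})"
      by (intro Lim_emeasure_incseq) (auto simp: incseq_def)
  qed (use le1 in auto)
  moreover have "(\<Union>k. {..K + real k}) = (UNIV :: real set)"
  proof (intro set_eqI iffI UNIV_I)
    fix x :: real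
    obtain k where "x - K \<le> real k" using real_arch_simple by blast
    then show "x \<in> (\<Union>k. {..K + real k})" by (auto intro!: exI[of _ k])
  qed
  moreover have "space D = UNIV" by (simp add: D_def)
  ultimately have "emeasure D (space D) \<le> 1" by simp
  then have finD: "emeasure D (space D) \<noteq> \<infinity>" by (auto simp: top_unique)
  interpret D: finite_measure D by (rule finite_measureI[OF finD])
  interpret D: finite_borel_measure D
    by (rule finite_borel_measure.intro[OF D.finite_measure_axioms])
       (simp add: finite_borel_measure_axioms_def)
  have "{x} \<in> null_sets D" for x
  proof -
    have "{x} \<in> null_sets lborel" by (simp add: null_sets_def)
    moreover have "null_sets lborel \<subseteq> null_sets D"
      using absolutely_continuousI_density[of "\<lambda>x. ennreal (\<nu> x)" lborel]
      unfolding D_def absolutely_continuous_def by simp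
    ultimately show ?thesis by (rule rev_subsetD)
  qed
  then have "measure D {x} = 0" for x by (auto simp: measure_def null_sets_def)
  then have "isCont F x" for x unfolding FD D.isCont_cdf by simp
  then show ?thesis by (simp add: continuous_on_eq_continuous_at)
qed

lemma left_limit_bound_le:
  fixes f :: "real \<Rightarrow> real"
  assumes "(f \<longlongrightarrow> l) (at_left v)" "s < v" "\<And>x. s < x \<Longrightarrow> x < v \<Longrightarrow> f x \<le> b"
  shows "l \<le> b"
proof (rule tendsto_upperbound[OF assms(1)])
  show "\<forall>\<^sub>F x in at_left v. f x \<le> b"
    using eventually_at_left_real[OF assms(2)] by eventually_elim (simp add: assms(3))
qed simp

text \<open>
  The left limit at \<open>u\<close> is the limit of the values at \<open>(\<lceil>2 ^ k * u\<rceil> - 1) / 2 ^ k\<close>, the largest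
  dyadic number of level \<open>k\<close> below \<open>u\<close>, and these values are step functions of \<open>u\<close>.
\<close>

lemma borel_measurable_left_limit:
  fixes f :: "real \<Rightarrow> real"
  assumes lim: "\<And>u. 0 < u \<Longrightarrow> (f \<longlongrightarrow> left_limit f u) (at_left u)"
  shows "(\<lambda>u. if 0 < u then left_limit f u else 0) \<in> borel_measurable borel"
proof (rule borel_measurable_LIMSEQ_real)
  define d where "d k u = (real_of_int \<lceil>2 ^ k * u\<rceil> - 1) / 2 ^ k" for k :: nat and u :: real
  define g where "g k z = f ((real_of_int z - 1) / 2 ^ k)" for k :: nat and z :: int
  have [measurable]: "(\<lambda>u::real. g k \<lceil>2 ^ k * u\<rceil>) \<in> borel_measurable borel" for k
  proof -
    have "(\<lambda>u::real. \<lceil>2 ^ k * u\<rceil>) \<in> measurable borel (count_space UNIV)" by measurable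
    then show ?thesis by (rule measurable_compose) simp
  qed
  show "(\<lambda>u::real. if 0 < u then g k \<lceil>2 ^ k * u\<rceil> else 0) \<in> borel_measurable borel" for k
    by measurable
  fix u :: real
  show "(\<lambda>k. if 0 < u then g k \<lceil>2 ^ k * u\<rceil> else 0) \<longlonglongrightarrow> (if 0 < u then left_limit f u else 0)"
  proof (cases "0 < u")
    case True
    have less: "d k u < u" "u - 1 / 2 ^ k \<le> d k u" for k
    proof -
      have "real_of_int \<lceil>2 ^ k * u\<rceil> < 2 ^ k * u + 1" "2 ^ k * u \<le> real_of_int \<lceil>2 ^ k * u\<rceil>" by linarith+
      then show "d k u < u" "u - 1 / 2 ^ k \<le> d k u" by (simp_all add: d_def field_simps)
    qed
    have "(\<lambda>k. u - (1 / 2) ^ k) \<longlonglongrightarrow> u - 0"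
      by (intro tendsto_intros LIMSEQ_power_zero) simp
    then have low: "(\<lambda>k. u - 1 / 2 ^ k) \<longlonglongrightarrow> u" by (simp add: power_one_over)
    have "(\<lambda>k. d k u) \<longlonglongrightarrow> u"
      by (rule tendsto_sandwich[OF _ _ low tendsto_const]) (auto intro!: always_eventually less_imp_le less)
    then have "filterlim (\<lambda>k. d k u) (at_left u) sequentially"
      using less(1) by (auto simp: filterlim_at intro!: always_eventually less_imp_neq)
    from filterlim_compose[OF lim[OF True] this] show ?thesis
      using True by (simp add: d_def g_def)
  qed simp
qed

context poisson_arrivals
begin

definition unsaturated :: "(real \<Rightarrow> real) \<Rightarrow> real set" where
  "unsaturated r = {u\<in>{0<..T}. left_limit r u < 1}"

context
  fixes F G :: "real \<Rightarrow> real" and r\<^sub>0 :: real and r :: "real \<Rightarrow> real"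
  assumes F: "mono F" "\<And>x. 0 \<le> F x" "\<And>x. F x \<le> 1"
    and G: "mono G"
    and r0: "0 \<le> r\<^sub>0"
    and r: "volterra_solution rate F G r\<^sub>0 r"
begin

lemma volterra_left_limit: "0 < u \<Longrightarrow> (r \<longlongrightarrow> left_limit r u) (at_left u)"
proof -
  assume "0 < u"
  then obtain l where l: "(r \<longlongrightarrow> l) (at_left u)" using r by (auto simp: volterra_solution_def)
  moreover have "left_limit r u = l" unfolding left_limit_def by (rule tendsto_Lim[OF _ l]) simp
  ultimately show ?thesis by simp
qed

lemma sets_unsaturated: "unsaturated r \<in> sets borel"
proof -
  note [measurable] = borel_measurable_left_limit[OF volterra_left_limit]
  have "unsaturated r = {0<..T} \<inter> {u. (if 0 < u then left_limit r u else 0) < 1}"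
    by (auto simp: unsaturated_def)
  also have "\<dots> \<in> sets borel" by measurable
  finally show ?thesis .
qed

text \<open>
  At \<open>u = 0\<close> the left limit is a default value, which is why \<open>unsaturated\<close> omits \<open>0\<close> and the
  integrands agree only almost everywhere.
\<close>

lemma volterra_eq:
  assumes t: "0 < t" "t \<le> T"
  shows "r t = r\<^sub>0 * (1 - G t) + (LINT u|\<mu>. of_bool (u \<in> unsaturated r \<and> u \<le> t) * (1 - F (t - u)))"
proof -
  note [measurable] = sets_unsaturated
  have F_meas[measurable]: "F \<in> borel_measurable borel" using F(1) by (rule borel_measurable_mono)
  let ?f = "\<lambda>u. of_bool (u \<in> unsaturated r \<and> u \<le> t) * (1 - F (t - u))"
  let ?rhs = "\<lambda>u. indicator {0..T} u * rate u * ?f u"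
  let ?lhs = "\<lambda>u. indicator {0..t} u *\<^sub>R (of_bool (left_limit r u < 1) * (1 - F (t - u)) * rate u)"
  have eq: "?lhs u = ?rhs u" if "u \<noteq> 0" for u
    using t that by (auto simp: indicator_def unsaturated_def)
  have rhs[measurable]: "?rhs \<in> borel_measurable borel" by measurable
  have "?lhs = (\<lambda>u. ?rhs u + indicator {0} u * ?lhs 0)"
  proof
    fix u show "?lhs u = ?rhs u + indicator {0} u * ?lhs 0"
    proof (cases "u = 0")
      case True
      then show ?thesis by (simp add: unsaturated_def)
    next
      case False
      then show ?thesis using eq[OF False] by simp
    qed
  qed
  moreover have "(\<lambda>u. ?rhs u + indicator {0} u * ?lhs 0) \<in> borel_measurable borel" by measurable
  ultimately have lhs: "?lhs \<in> borel_measurable borel" by (simp only:)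
  have "r t = r 0 * (1 - G t) + (LINT u:{0..t}|lborel. of_bool (left_limit r u < 1) * (1 - F (t - u)) * rate u)"
    "r 0 = r\<^sub>0"
    using r t(1) by (simp_all add: volterra_solution_def)
  moreover have "(LINT u:{0..t}|lborel. of_bool (left_limit r u < 1) * (1 - F (t - u)) * rate u) = (LINT u|lborel. ?rhs u)"
    unfolding set_lebesgue_integral_def
  proof (rule integral_cong_AE)
    have "AE u in lborel. u \<noteq> (0::real)" by (rule AE_lborel_singleton)
    then show "AE u in lborel. ?lhs u = ?rhs u"
      by eventually_elim (rule eq)
  qed (use lhs rhs in simp_all)
  moreover have "(LINT u|lborel. ?rhs u) = (LINT u|\<mu>. ?f u)"
    by (rule integral_\<mu>[symmetric]) measurable
  ultimately show ?thesis by (simp only:)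
qed

lemma integrable_accepted: "integrable \<mu> (\<lambda>u. of_bool (u \<in> unsaturated r \<and> u \<le> t) * (1 - F (t - u)))"
proof -
  interpret \<mu>: finite_measure \<mu> by (rule finite_measure_\<mu>)
  note [measurable] = sets_unsaturated borel_measurable_mono[OF F(1)]
  show ?thesis
    using F(2,3) by (intro \<mu>.integrable_const_bound[where B = 1]) (auto simp: abs_mult of_bool_def)
qed

text \<open>A solution grows at most by the accepted arrivals, since jobs already present only leave.\<close>

lemma volterra_growth:
  assumes "0 < s" "s \<le> t" "t \<le> T"
  shows "r t \<le> r s + measure \<mu> {s<..t}"
proof -
  interpret \<mu>: finite_measure \<mu> by (rule finite_measure_\<mu>)
  let ?f = "\<lambda>t u. of_bool (u \<in> unsaturated r \<and> u \<le> t) * (1 - F (t - u))"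
  have int: "integrable \<mu> (indicat_real {s<..t})"
    by (intro \<mu>.integrable_const_bound[where B = 1]) (auto simp: indicator_def)
  have "(LINT u|\<mu>. ?f t u) \<le> (LINT u|\<mu>. ?f s u + indicator {s<..t} u)"
  proof (rule integral_mono)
    fix u
    have "F (s - u) \<le> F (t - u)" using assms by (intro monoD[OF F(1)]) simp
    then show "?f t u \<le> ?f s u + indicator {s<..t} u"
      using F(2)[of "t - u"] F(3)[of "t - u"] F(3)[of "s - u"] assms(2)
      by (cases "u \<in> unsaturated r"; cases "u \<le> s"; cases "u \<le> t") auto
  qed (use int integrable_accepted in auto)
  also have "\<dots> = (LINT u|\<mu>. ?f s u) + measure \<mu> {s<..t}"
    using int integrable_accepted by simp
  finally have 1: "(LINT u|\<mu>. ?f t u) \<le> (LINT u|\<mu>. ?f s u) + measure \<mu> {s<..t}" .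
  have "r\<^sub>0 * (1 - G t) \<le> r\<^sub>0 * (1 - G s)"
    using monoD[OF G assms(2)] r0 by (intro mult_left_mono) auto
  with 1 show ?thesis
    using volterra_eq[of t] volterra_eq[of s] assms by simp
qed

text \<open>
  By \<open>volterra_growth\<close> a solution that is below \<open>1\<close> just before \<open>u\<close> needs some time to climb back to
  \<open>1\<close>, so the left limits stay below \<open>1\<close> on both sides of \<open>u\<close>.
\<close>

lemma unsaturated_relatively_open:
  assumes "u \<in> unsaturated r"
  shows "\<exists>d>0. {u - d<..<u + d} \<inter> {0<..T} \<subseteq> unsaturated r"
proof -
  have u: "0 < u" "u \<le> T" "left_limit r u < 1" using assms by (auto simp: unsaturated_def)
  define \<theta> where "\<theta> = (1 - left_limit r u) / 3"
  have \<theta>: "0 < \<theta>" "left_limit r u < 1 - 2 * \<theta>" using u(3) by (auto simp: \<theta>_def field_simps)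
  obtain d0 where d0: "0 < d0"
    "\<And>s t. 0 \<le> s \<Longrightarrow> s \<le> t \<Longrightarrow> t \<le> T \<Longrightarrow> t - s < d0 \<Longrightarrow> measure \<mu> {s<..t} < \<theta>"
    using \<mu>_uniformly_continuous[OF \<theta>(1)] by blast
  have "\<forall>\<^sub>F s in at_left u. r s < 1 - 2 * \<theta>"
    using volterra_left_limit[OF u(1)] \<theta>(2) by (rule order_tendstoD(2))
  moreover have "\<forall>\<^sub>F s in at_left u. s \<in> {max 0 (u - d0 / 2)<..<u}"
    using u d0(1) by (intro eventually_at_left_real) auto
  ultimately have "\<forall>\<^sub>F s in at_left u. r s < 1 - 2 * \<theta> \<and> s \<in> {max 0 (u - d0 / 2)<..<u}"
    by (rule eventually_conj)
  then obtain s where s: "r s < 1 - 2 * \<theta>" "0 < s" "u - d0 / 2 < s" "s < u"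
    using eventually_happens by fastforce
  define d where "d = min (u - s) (d0 / 2)"
  have d: "0 < d" using s d0(1) by (simp add: d_def)
  have "v \<in> unsaturated r" if v: "v \<in> {u - d<..<u + d}" "v \<in> {0<..T}" for v
  proof -
    have v': "s < v" "v - s < d0" "0 < v" "v \<le> T"
      using v s unfolding d_def by auto
    have "left_limit r v \<le> 1 - \<theta>"
    proof (rule left_limit_bound_le[OF volterra_left_limit[OF v'(3)] v'(1)])
      fix x assume x: "s < x" "x < v"
      have "measure \<mu> {s<..x} < \<theta>" using x v' s by (intro d0(2)) auto
      then show "r x \<le> 1 - \<theta>" using volterra_growth[of s x] s x v' by simp
    qed
    then show ?thesis using v' \<theta>(1) by (auto simp: unsaturated_def)
  qed
  then show ?thesis using d by blast
qed

lemma borel_measurable_volterra_rhs: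
  "(\<lambda>t. r\<^sub>0 * (1 - G t) + (LINT u|\<mu>. of_bool (u \<in> unsaturated r \<and> u \<le> t) * (1 - F (t - u))))
     \<in> borel_measurable borel"
proof -
  interpret \<mu>: finite_measure \<mu> by (rule finite_measure_\<mu>)
  note [measurable] = sets_unsaturated borel_measurable_mono[OF F(1)] borel_measurable_mono[OF G]
  show ?thesis by measurable
qed

end

end

section \<open>Convergence of the occupied fraction\<close>

lemma eventually_less_of_limits:
  fixes f g :: "'a \<Rightarrow> real"
  assumes "(f \<longlongrightarrow> l) F" "(g \<longlongrightarrow> m) F" "l < m"
  shows "\<forall>\<^sub>F x in F. f x < g x"
proof -
  obtain c where c: "l < c" "c < m" using dense[OF assms(3)] by blast
  show ?thesis
    using order_tendstoD(2)[OF assms(1) c(1)] order_tendstoD(1)[OF assms(2) c(2)]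
    by eventually_elim simp
qed

lemma set_integrable_if_eq_bounded:
  fixes x y :: "real \<Rightarrow> real"
  assumes y[measurable]: "y \<in> borel_measurable borel" and B: "\<And>u. \<bar>y u\<bar> \<le> B"
    and eq: "\<And>u. 0 < u \<Longrightarrow> u \<le> T \<Longrightarrow> x u = y u"
  shows "set_integrable lborel {0..T} x"
proof -
  have "(\<lambda>u. indicator {0..T} u *\<^sub>R x u) = (\<lambda>u. indicator {0<..T} u * y u + indicator {0} u * (indicator {0..T} 0 * x 0))"
    using eq by (auto simp: fun_eq_iff indicator_def)
  also have "\<dots> \<in> borel_measurable borel" by measurable
  finally have meas: "(\<lambda>u. indicator {0..T} u *\<^sub>R x u) \<in> borel_measurable lborel" by simp
  have "integrable lborel (\<lambda>u. indicator {0..T} u *\<^sub>R x u)"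
  proof (rule Bochner_Integration.integrable_bound[OF _ meas])
    show "integrable lborel (\<lambda>u. (B + \<bar>x 0\<bar>) * indicat_real {0..T} u)"
      by (intro integrable_mult_right integrable_real_indicator) (simp_all add: emeasure_lborel_Icc_eq)
    have "0 \<le> B" using B[of 0] by linarith
    then have "\<bar>x u\<bar> \<le> B + \<bar>x 0\<bar>" if "0 \<le> u" "u \<le> T" for u
      using eq[of u] B[of u] that by (cases "u = 0") auto
    then show "AE u in lborel. norm (indicator {0..T} u *\<^sub>R x u) \<le> norm ((B + \<bar>x 0\<bar>) * indicat_real {0..T} u)"
      by (intro AE_I2) (auto simp: indicator_def intro: order_trans[OF _ abs_ge_self])
  qed
  then show ?thesis by (simp add: set_integrable_def)
qed

lemma borel_measurable_in_service[measurable]: "in_service \<tau> s \<in> borel_measurable borel"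
  unfolding in_service_def[abs_def] by measurable

lemma loss_system_path_integrable:
  assumes a: "counting_path a" and x: "loss_system_path n a s k s0 x"
  shows "set_integrable lborel {0..T} x"
proof (rule set_integrable_if_eq_bounded)
  let ?y = "\<lambda>t. 1 / real n * (\<Sum>i\<in>{1..k}. of_bool (s0 i > t)) +
    1 / real n * (\<Sum>i\<in>{1..a T}. of_bool (left_limit x (epoch_time a i) < 1) *
       in_service (epoch_time a i) (s i) t)"
  show "?y \<in> borel_measurable borel" by measurable
  show "x u = ?y u" if "0 < u" "u \<le> T" for u
    by (rule loss_system_path_eq[OF a x that])
  fix u
  have 1: "0 \<le> (\<Sum>i\<in>{1..k}. of_bool (s0 i > u) :: real)" "(\<Sum>i\<in>{1..k}. of_bool (s0 i > u) :: real) \<le> (\<Sum>i\<in>{1..k}. 1)"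
    by (intro sum_nonneg sum_mono; simp)+
  have 2: "0 \<le> (\<Sum>i\<in>{1..a T}. of_bool (left_limit x (epoch_time a i) < 1) * in_service (epoch_time a i) (s i) u)"
    "(\<Sum>i\<in>{1..a T}. of_bool (left_limit x (epoch_time a i) < 1) * in_service (epoch_time a i) (s i) u) \<le> (\<Sum>i\<in>{1..a T}. 1)"
    by (intro sum_nonneg sum_mono; simp add: in_service_def)+
  have "0 \<le> ?y u" using 1 2 by simp
  moreover have "?y u \<le> 1 / real n * (\<Sum>i\<in>{1..k}. 1) + 1 / real n * (\<Sum>i\<in>{1..a T}. 1)"
    using 1 2 by (intro add_mono mult_left_mono) simp_all
  ultimately show "\<bar>?y u\<bar> \<le> 1 / real n * (\<Sum>i\<in>{1..k}. 1) + 1 / real n * (\<Sum>i\<in>{1..a T}. 1)"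
    by (simp only: abs_of_nonneg)
qed

text \<open>The time \<open>0\<close> is excluded because an atom of the remaining service times at \<open>0\<close> makes the paths jump there.\<close>

lemma SUP_integral_diff_bound:
  fixes x y :: "real \<Rightarrow> real"
  assumes T: "0 \<le> T" and x: "set_integrable lborel {0..T} x" and y: "set_integrable lborel {0..T} y"
    and close: "\<And>t. 0 < t \<Longrightarrow> t \<le> T \<Longrightarrow> \<bar>x t - y t\<bar> \<le> \<epsilon>" and \<epsilon>: "0 \<le> \<epsilon>"
  shows "\<bar>SUP t\<in>{0..T}. \<bar>(LINT u:{0..t}|lborel. x u) - (LINT u:{0..t}|lborel. y u)\<bar>\<bar> \<le> T * \<epsilon>"
proof -
  let ?D = "\<lambda>t. \<bar>(LINT u:{0..t}|lborel. x u) - (LINT u:{0..t}|lborel. y u)\<bar>"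
  have bound: "?D t \<le> T * \<epsilon>" if t: "t \<in> {0..T}" for t
  proof -
    have sub: "{0..t} \<in> sets lborel" "{0..t} \<subseteq> {0..T}" using t by auto
    note xt = set_integrable_subset[OF x sub] and yt = set_integrable_subset[OF y sub]
    have "?D t = \<bar>LINT u:{0..t}|lborel. x u - y u\<bar>"
      using set_integral_diff(2)[OF xt yt] by simp
    also have "\<dots> \<le> (LINT u:{0..t}|lborel. \<epsilon>)"
      unfolding set_lebesgue_integral_def real_norm_def[symmetric]
    proof (rule order_trans[OF integral_norm_bound integral_mono_AE])
      show "integrable lborel (\<lambda>u. norm (indicat_real {0..t} u *\<^sub>R (x u - y u)))"
        using set_integral_diff(1)[OF xt yt] unfolding set_integrable_def by (rule integrable_norm)
      show "integrable lborel (\<lambda>u. indicat_real {0..t} u *\<^sub>R \<epsilon>)"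
        by (intro integrable_scaleR_left integrable_real_indicator) (simp_all add: emeasure_lborel_Icc_eq)
      have "AE u in lborel. u \<noteq> (0::real)" by (rule AE_lborel_singleton)
      then show "AE u in lborel. norm (indicat_real {0..t} u *\<^sub>R (x u - y u)) \<le> indicat_real {0..t} u *\<^sub>R \<epsilon>"
        by eventually_elim (use t close in \<open>auto simp: indicator_def\<close>)
    qed
    also have "\<dots> = t * \<epsilon>" using t by (simp add: set_lebesgue_integral_def)
    also have "\<dots> \<le> T * \<epsilon>" using t \<epsilon> by (intro mult_right_mono) auto
    finally show ?thesis .
  qed
  have "(SUP t\<in>{0..T}. ?D t) \<le> T * \<epsilon>"
    using T bound by (intro cSUP_least) auto
  moreover have "?D 0 \<le> (SUP t\<in>{0..T}. ?D t)"
    using T by (intro cSUP_upper bdd_aboveI2[where M = "T * \<epsilon>"] bound) auto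
  ultimately show ?thesis by linarith
qed

theorem theorem3p9:
  fixes M :: "'w measure"
    and rate F \<nu> G :: "real \<Rightarrow> real"
    and A :: "nat \<Rightarrow> real \<Rightarrow> 'w \<Rightarrow> nat"
    and S S0 :: "nat \<Rightarrow> nat \<Rightarrow> 'w \<Rightarrow> real"
    and N0 :: "nat \<Rightarrow> 'w \<Rightarrow> nat"
    and \<rho>n :: "nat \<Rightarrow> real \<Rightarrow> 'w \<Rightarrow> real"
    and r\<^sub>0 T :: real
    and \<rho> :: "real \<Rightarrow> real"
  assumes "prob_space M"
    and rate_nonneg: "\<And>t. 0 \<le> t \<Longrightarrow> 0 \<le> rate t"
    and rate_locally_integrable: "\<And>t. 0 \<le> t \<Longrightarrow> set_integrable lborel {0..t} rate"
    and F: "nonneg_distribution_function F" "has_density F \<nu>"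
    and F_first_moment: "integrable lborel (\<lambda>x. x * \<nu> x)"
    and G: "nonneg_distribution_function G"
    and arrivals: "\<And>n. 1 \<le> n \<Longrightarrow> poisson_process M (\<lambda>t. real n * rate t) (A n)"
    and services: "\<And>n. 1 \<le> n \<Longrightarrow> iid_with_cdf M {1..} (S n) F"
    and services_indep_arrivals: "\<And>n. 1 \<le> n \<Longrightarrow>
          indep_random_elements M
            (PiM {1..} (\<lambda>_. borel)) (\<lambda>\<omega>. \<lambda>i\<in>{1..}. S n i \<omega>)
            (PiM {0..} (\<lambda>_. count_space UNIV)) (\<lambda>\<omega>. \<lambda>t\<in>{0..}. A n t \<omega>)"
    and initial_number: "\<And>n. 1 \<le> n \<Longrightarrow> N0 n \<in> measurable M (count_space UNIV)"
          "\<And>n \<omega>. 1 \<le> n \<Longrightarrow> \<omega> \<in> space M \<Longrightarrow> N0 n \<omega> \<le> n"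
    and initial_services: "\<And>n. 1 \<le> n \<Longrightarrow> iid_with_cdf M {1..n} (S0 n) G"
    and system: "\<And>n \<omega>. 1 \<le> n \<Longrightarrow> \<omega> \<in> space M \<Longrightarrow>
          loss_system_path n (\<lambda>t. A n t \<omega>) (\<lambda>i. S n i \<omega>) (N0 n \<omega>) (\<lambda>i. S0 n i \<omega>)
            (\<lambda>t. \<rho>n n t \<omega>)"
    and r0: "0 < r\<^sub>0" "r\<^sub>0 \<le> 1"
    and initial_limit: "AE \<omega> in M. (\<lambda>n. \<bar>\<rho>n n 0 \<omega> - r\<^sub>0\<bar>) \<longlonglongrightarrow> 0"
    and solution: "volterra_solution rate F G r\<^sub>0 \<rho>"
    and T: "0 < T"
  shows "AE \<omega> in M.
    (\<lambda>n. SUP t\<in>{0..T}.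
        \<bar>(LINT u:{0..t}|lborel. \<rho>n n u \<omega>) - (LINT u:{0..t}|lborel. \<rho> u)\<bar>) \<longlonglongrightarrow> 0"
proof -
  interpret poisson_arrivals M rate A T
    using assms(1) T rate_nonneg rate_locally_integrable[of T] arrivals
    by (simp add: poisson_arrivals_def poisson_arrivals_axioms_def)
  interpret \<mu>: finite_measure \<mu> by (rule finite_measure_\<mu>)
  obtain \<sigma> where \<sigma>: "real_distribution \<sigma>" "F = cdf \<sigma>" using F(1) by (auto simp: nonneg_distribution_function_def)
  obtain \<gamma> where \<gamma>: "real_distribution \<gamma>" "G = cdf \<gamma>" using G by (auto simp: nonneg_distribution_function_def)
  interpret \<sigma>: real_distribution \<sigma> by (rule \<sigma>(1))
  interpret \<gamma>: real_distribution \<gamma> by (rule \<gamma>(1))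
  have F_props: "mono F" "\<And>x. 0 \<le> F x" "\<And>x. F x \<le> 1" and G_props: "mono G" "\<And>x. 0 \<le> G x" "\<And>x. G x \<le> 1"
    unfolding \<sigma>(2) \<gamma>(2)
    using \<sigma>.cdf_nondecreasing \<sigma>.cdf_nonneg \<sigma>.cdf_bounded_prob \<gamma>.cdf_nondecreasing \<gamma>.cdf_nonneg \<gamma>.cdf_bounded_prob
    by (auto simp: mono_def)
  have F_cont: "continuous_on UNIV F" using F by (rule continuous_cdf_of_density)
  have r0': "0 \<le> r\<^sub>0" using r0 by simp
  note volterra = F_props G_props(1) r0' solution
  define W where "W = unsaturated \<rho>"
  have W: "W \<subseteq> {0<..T}" by (auto simp: W_def unsaturated_def)
  have W_open: "\<exists>d>0. {u - d<..<u + d} \<inter> {0<..T} \<subseteq> W" if "u \<in> W" for u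
    using unsaturated_relatively_open[OF volterra, of u] that unfolding W_def by simp
  define fluid where "fluid t = (LINT u|\<mu>. of_bool (u \<in> W \<and> u \<le> t) * (1 - F (t - u)))" for t
  have \<rho>_eq: "\<rho> t = r\<^sub>0 * (1 - G t) + fluid t" if "0 < t" "t \<le> T" for t
    unfolding fluid_def W_def by (rule volterra_eq[OF volterra that])
  have initial: "AE \<omega> in M. (\<lambda>n. real (N0 n \<omega>) / real n) \<longlonglongrightarrow> r\<^sub>0"
    using initial_limit AE_space
  proof eventually_elim
    case (elim \<omega>)
    have "(\<lambda>n. \<rho>n n 0 \<omega>) \<longlonglongrightarrow> r\<^sub>0"
      using elim(1) by (simp add: tendsto_rabs_zero_iff LIM_zero_cancel)
    moreover have "\<forall>\<^sub>F n in sequentially. \<rho>n n 0 \<omega> = real (N0 n \<omega>) / real n"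
      using eventually_ge_at_top[of 1]
    proof eventually_elim
      case (elim n)
      then show ?case using system[OF elim \<open>\<omega> \<in> space M\<close>] by (simp add: loss_system_path_def)
    qed
    ultimately show ?case by (rule Lim_transform_eventually)
  qed
  \<comment> \<open>Convergence holds uniformly on \<open>(0, T]\<close>, before integration.\<close>
  have uniform: "AE \<omega> in M. \<forall>\<^sub>F n in sequentially. \<forall>t. 0 < t \<longrightarrow> t \<le> T \<longrightarrow> \<bar>\<rho>n n t \<omega> - \<rho> t\<bar> \<le> \<epsilon>"
    if \<epsilon>: "0 < \<epsilon>" for \<epsilon> :: real
  proof -
    have "\<forall>\<^sub>F m in sequentially. measure \<mu> (W - dyadic_inner T W m) < \<epsilon> / 4"
      using measure_outside_dyadic_inner_tendsto[OF W W_open] \<epsilon> by (intro order_tendstoD(2)) auto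
    then obtain m where m: "measure \<mu> (W - dyadic_inner T W m) < \<epsilon> / 4"
      using eventually_happens by fastforce
    define L :: nat where "L = 2 ^ m"
    define h where "h = T / 2 ^ m"
    have h: "0 < h" "real L * h = T" using T by (auto simp: h_def L_def)
    \<comment> \<open>With \<open>m\<close> fixed, the error \<open>\<delta>\<close> may be taken small compared with the number of cells.\<close>
    define \<delta> where "\<delta> = \<epsilon> / (8 * (real L + 1))"
    have \<delta>: "0 < \<delta>" "(real L + 1) * \<delta> = \<epsilon> / 8" using \<epsilon> by (auto simp: \<delta>_def field_simps)
    have I_close: "AE \<omega> in M. \<forall>\<^sub>F n in sequentially. \<forall>t\<in>{0..T}.
        \<bar>1 / real n * (\<Sum>i\<in>{1..N0 n \<omega>}. of_bool (t < S0 n i \<omega>)) - r\<^sub>0 * (1 - G t)\<bar> \<le> \<delta> / 2"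
      unfolding \<gamma>(2)
    proof (rule AE_eventually_initial_close[OF \<gamma>(1)])
      show "iid_with_cdf M {1..n} (S0 n) (cdf \<gamma>)" if "1 \<le> n" for n
        using initial_services[OF that] unfolding \<gamma>(2) .
    qed (use initial initial_number(2) \<delta>(1) in auto)
    have H_close: "AE \<omega> in M. \<forall>\<^sub>F n in sequentially. \<forall>t. 0 < t \<longrightarrow> t \<le> T \<longrightarrow>
        \<bar>1 / real n * busy {i\<in>{1..A n T \<omega>}. epoch_time (\<lambda>t. A n t \<omega>) i \<in> W} (epoch_time (\<lambda>t. A n t \<omega>)) (\<lambda>i. S n i \<omega>) t -
         fluid t\<bar> \<le> \<delta> / 2"
      unfolding fluid_def \<sigma>(2)
    proof (rule AE_eventually_busy_close[OF _ \<sigma>(1) _ W W_open])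
      show "iid_with_cdf M {1..} (S n) (cdf \<sigma>)" if "1 \<le> n" for n
        using services[OF that] unfolding \<sigma>(2) .
      show "continuous_on UNIV (cdf \<sigma>)" using F_cont unfolding \<sigma>(2) .
    qed (use \<delta>(1) in auto)
    have D_small: "AE \<omega> in M. \<forall>\<^sub>F n in sequentially.
        (\<Sum>i\<in>{1..A n T \<omega>}. indicator (W - dyadic_inner T W m) (epoch_time (\<lambda>t. A n t \<omega>) i)) <
        real n * (measure \<mu> (W - dyadic_inner T W m) + \<epsilon> / 4)"
      using \<epsilon> by (intro AE_eventually_arrivals_outside_dyadic_inner[OF W W_open]) auto
    have inv_small: "\<forall>\<^sub>F n in sequentially. real L * (1 / real n) \<le> \<epsilon> / 8"
    proof -
      have "(\<lambda>n. real L * (1 / real n)) \<longlonglongrightarrow> real L * 0"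
        by (intro tendsto_mult tendsto_const lim_1_over_n)
      then have "\<forall>\<^sub>F n in sequentially. real L * (1 / real n) < \<epsilon> / 8"
        using \<epsilon> by (intro order_tendstoD(2)) auto
      then show ?thesis by eventually_elim simp
    qed
    show ?thesis
      using I_close H_close D_small AE_space
    proof eventually_elim
      case (elim \<omega>)
      show ?case
        using elim(1,2,3) inv_small eventually_ge_at_top[of 1]
      proof eventually_elim
        case (elim n)
        note \<omega> = \<open>\<omega> \<in> space M\<close>
        have n: "1 \<le> n" "0 < real n" using elim(5) by auto
        define a where "a t = A n t \<omega>" for t
        define x where "x t = \<rho>n n t \<omega>" for t
        define s where "s i = S n i \<omega>" for i
        define s0 where "s0 i = S0 n i \<omega>" for i
        define k where "k = N0 n \<omega>"
        have a: "counting_path a" unfolding a_def by (rule counting[OF n(1) \<omega>])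
        have path: "loss_system_path n a s k s0 x"
          using system[OF n(1) \<omega>] unfolding a_def x_def s_def s0_def k_def .
        let ?K = "{1..a T}" and ?\<tau> = "epoch_time a"
        define acc where "acc i \<longleftrightarrow> left_limit x (?\<tau> i) < 1" for i
        define J where "J t = 1 / real n * (\<Sum>i\<in>{1..k}. of_bool (t < s0 i))" for t
        have \<tau>: "0 < ?\<tau> i \<and> ?\<tau> i \<le> T" if "i \<in> ?K" for i
        proof -
          have i: "1 \<le> i" "i \<le> a T" using that by auto
          then show ?thesis
            using counting_path_epoch_time(2)[OF a i(1) _ i(2)] counting_path_epoch_time_le_iff[OF a i, of T] T by simp
        qed
        have x_lim: "(x \<longlongrightarrow> left_limit x u) (at_left u)" if "0 < u" for u
          by (rule loss_system_path_left_limit[OF a path that])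
        have \<rho>_lim: "(\<rho> \<longlongrightarrow> left_limit \<rho> u) (at_left u)" if "0 < u" for u
          by (rule volterra_left_limit[OF volterra that])
        define D where "D = {i\<in>?K. ?\<tau> i \<in> W \<and>
          (\<exists>j<L. ?\<tau> i \<in> {real j * h<..real (Suc j) * h} \<and> \<not> {real j * h<..real (Suc j) * h} \<subseteq> W)}"
        have card_D: "real (card D) \<le> n * (\<epsilon> / 2)"
        proof -
          have "real (card D) = (\<Sum>i\<in>D. 1)" by simp
          also have "\<dots> \<le> (\<Sum>i\<in>D. indicator (W - dyadic_inner T W m) (?\<tau> i))"
          proof (rule sum_mono)
            fix i assume "i \<in> D"
            then obtain j where j: "?\<tau> i \<in> W" "?\<tau> i \<in> cell h j" "\<not> cell h j \<subseteq> W"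
              by (auto simp: D_def cell_def)
            have "?\<tau> i \<notin> dyadic_inner T W m"
            proof
              assume "?\<tau> i \<in> dyadic_inner T W m"
              then obtain j' where j': "cell h j' \<subseteq> W" "?\<tau> i \<in> cell h j'"
                by (auto simp: dyadic_inner_def dyadic_cells_def h_def)
              then have "j' = j" using cell_unique[OF h(1) j'(2) j(2)] by simp
              then show False using j'(1) j(3) by simp
            qed
            then show "1 \<le> (indicator (W - dyadic_inner T W m) (?\<tau> i) :: real)" using j(1) by simp
          qed
          also have "\<dots> \<le> (\<Sum>i\<in>?K. indicator (W - dyadic_inner T W m) (?\<tau> i))"
            by (intro sum_mono2) (auto simp: D_def)
          also have "\<dots> \<le> n * (measure \<mu> (W - dyadic_inner T W m) + \<epsilon> / 4)"
            using elim(3) unfolding a_def[symmetric] by simp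
          also have "\<dots> \<le> n * (\<epsilon> / 2)" using m by (intro mult_left_mono) auto
          finally show ?thesis .
        qed
        have "\<bar>x t - \<rho> t\<bar> \<le> \<delta> + real L * (\<delta> + 1 / real n) + card D / n" if t: "0 < t" "t \<le> T" for t
          unfolding D_def
        proof (rule loss_comparison[where K = ?K and acc = acc and J = J and \<tau> = ?\<tau> and s = s and T = T
            and x = x and y = \<rho> and a = "\<lambda>j. real j * h" and W = W and L = L and n = "real n" and t = t and \<delta> = \<delta>])
          show "finite ?K" by simp
          show "inj_on ?\<tau> ?K" using T by (intro inj_on_epoch_time[OF a]) simp
          show "0 < ?\<tau> i \<and> ?\<tau> i \<le> T" if "i \<in> ?K" for i by (rule \<tau>[OF that])
          show "0 < real n" "0 \<le> \<delta>" "real 0 * h = 0" "real L * h = T" "0 < t" "t \<le> T"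
            using n \<delta>(1) h t by simp_all
          show "mono (\<lambda>j. real j * h)" using h(1) by (intro monoI mult_right_mono) auto
          show "x t = J t + 1 / real n * busy {i\<in>?K. acc i} ?\<tau> s t" if "0 < t" "t \<le> T" for t
            unfolding loss_system_path_eq[OF a path that] J_def acc_def
            by (simp only: busy_filter finite_atLeastAtMost)
          show "\<bar>J t + 1 / real n * busy {i\<in>?K. ?\<tau> i \<in> W} ?\<tau> s t - \<rho> t\<bar> \<le> \<delta>" if t: "0 < t" "t \<le> T" for t
          proof -
            have "\<bar>J t - r\<^sub>0 * (1 - G t)\<bar> \<le> \<delta> / 2"
              using elim(1) t unfolding J_def k_def s0_def by auto
            moreover have "\<bar>1 / real n * busy {i\<in>?K. ?\<tau> i \<in> W} ?\<tau> s t - fluid t\<bar> \<le> \<delta> / 2"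
              using elim(2) t unfolding a_def s_def by blast
            ultimately show ?thesis unfolding \<rho>_eq[OF t] by linarith
          qed
          show "\<forall>\<^sub>F t in at_left (?\<tau> i). x t < \<rho> t" if i: "i \<in> ?K" "acc i" "?\<tau> i \<notin> W" for i
          proof (rule eventually_less_of_limits[OF x_lim \<rho>_lim])
            show "left_limit x (?\<tau> i) < left_limit \<rho> (?\<tau> i)"
              using i \<tau>[OF i(1)] unfolding W_def unsaturated_def acc_def by auto
          qed (use \<tau>[OF i(1)] in auto)
          show "\<forall>\<^sub>F t in at_left (?\<tau> i). \<rho> t < x t" if i: "i \<in> ?K" "\<not> acc i" "?\<tau> i \<in> W" for i
          proof (rule eventually_less_of_limits[OF \<rho>_lim x_lim])
            show "left_limit \<rho> (?\<tau> i) < left_limit x (?\<tau> i)"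
              using i \<tau>[OF i(1)] unfolding W_def unsaturated_def acc_def by auto
          qed (use \<tau>[OF i(1)] in auto)
        qed
        moreover have "\<delta> + real L * (\<delta> + 1 / real n) + card D / n \<le> \<epsilon>"
        proof -
          have "card D / n \<le> \<epsilon> / 2" using card_D n by (simp add: field_simps)
          moreover have "\<delta> + real L * (\<delta> + 1 / real n) = (real L + 1) * \<delta> + real L * (1 / real n)"
            by (simp add: algebra_simps)
          ultimately show ?thesis using elim(4) \<delta>(2) \<epsilon> by linarith
        qed
        ultimately show ?case unfolding x_def by fastforce
      qed
    qed
  qed
  have \<rho>_int: "set_integrable lborel {0..T} \<rho>"
  proof (rule set_integrable_if_eq_bounded)
    show "(\<lambda>t. r\<^sub>0 * (1 - G t) + fluid t) \<in> borel_measurable borel"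
      unfolding fluid_def W_def by (rule borel_measurable_volterra_rhs[OF volterra])
    show "\<rho> u = r\<^sub>0 * (1 - G u) + fluid u" if "0 < u" "u \<le> T" for u by (rule \<rho>_eq[OF that])
    fix t
    have "0 \<le> fluid t" unfolding fluid_def using F_props by (intro integral_nonneg_AE AE_I2) auto
    moreover have "fluid t \<le> (LINT u|\<mu>. 1)"
      unfolding fluid_def using integrable_accepted[OF volterra, of t] F_props
      by (intro integral_mono) (auto simp: W_def)
    moreover have "0 \<le> r\<^sub>0 * (1 - G t)" "r\<^sub>0 * (1 - G t) \<le> r\<^sub>0"
      using r0' G_props(2,3) by (simp_all add: mult_left_le)
    ultimately show "\<bar>r\<^sub>0 * (1 - G t) + fluid t\<bar> \<le> r\<^sub>0 + (LINT u|\<mu>. 1)" by linarith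
  qed
  have "AE \<omega> in M. \<forall>k. \<forall>\<^sub>F n in sequentially. \<forall>t. 0 < t \<longrightarrow> t \<le> T \<longrightarrow>
      \<bar>\<rho>n n t \<omega> - \<rho> t\<bar> \<le> inverse (real (Suc k))"
    unfolding AE_all_countable by (intro allI uniform) simp
  then show ?thesis
    using AE_space
  proof eventually_elim
    case (elim \<omega>)
    show ?case
    proof (rule LIMSEQ_I)
      fix e :: real assume e: "0 < e"
      obtain k where k: "inverse (real (Suc k)) < e / T" using reals_Archimedean[of "e / T"] e T by auto
      have "\<forall>\<^sub>F n in sequentially. \<forall>t. 0 < t \<longrightarrow> t \<le> T \<longrightarrow> \<bar>\<rho>n n t \<omega> - \<rho> t\<bar> \<le> inverse (real (Suc k))"
        using elim(1) by blast
      then have "\<forall>\<^sub>F n in sequentially. norm ((SUP t\<in>{0..T}.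
          \<bar>(LINT u:{0..t}|lborel. \<rho>n n u \<omega>) - (LINT u:{0..t}|lborel. \<rho> u)\<bar>) - 0) < e"
        using eventually_ge_at_top[of 1]
      proof eventually_elim
        case (elim n)
        have "set_integrable lborel {0..T} (\<lambda>u. \<rho>n n u \<omega>)"
          by (rule loss_system_path_integrable[OF counting[OF elim(2) \<open>\<omega> \<in> space M\<close>] system[OF elim(2) \<open>\<omega> \<in> space M\<close>]])
        then have "\<bar>SUP t\<in>{0..T}. \<bar>(LINT u:{0..t}|lborel. \<rho>n n u \<omega>) - (LINT u:{0..t}|lborel. \<rho> u)\<bar>\<bar>
            \<le> T * inverse (real (Suc k))"
          using T elim(1) by (intro SUP_integral_diff_bound \<rho>_int) auto
        also have "\<dots> < e" using k T by (simp add: pos_less_divide_eq mult.commute)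
        finally show ?case by simp
      qed
      then show "\<exists>no. \<forall>n\<ge>no. norm ((SUP t\<in>{0..T}.
          \<bar>(LINT u:{0..t}|lborel. \<rho>n n u \<omega>) - (LINT u:{0..t}|lborel. \<rho> u)\<bar>) - 0) < e"
        by (simp only: eventually_sequentially)
    qed
  qed
qed

end
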